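(* Let $\Gamma$ be a finitely generated group of fixed price $c$, with finite symmetric generating set $S$. Then for any sofic approximation $(G_n)$ of $\Gamma$ (with respect to $S$, with $|V(G_n)|\to\infty$) we have $$\mathrm{cc}\big((G_n)\big)=c.$$
   Context: **Cost and fixed price.** Let $\Gamma$ act by probability measure preserving (p.m.p.) transformations on a standard Borel probability space $(X,\mu)$, and let $\mathcal{R}$ be the orbit equivalence relation. The cost of the action is $\frac12\inf\int_X\deg_{\mathcal{H}}(x)\,d\mu(x)$, where the infimum is over symmetric Borel graphs $\mathcal{H}\subseteq\mathcal{R}$ on $X$ whose connected components coincide with the $\mathcal{R}$-classes for $\mu$-almost every point. An action is essentially free if $\mu$-almost every point has trivial stabilizer. The group $\Gamma$ has fixed price $c$ if every essentially free p.m.p. action of $\Gamma$ has cost $c$. **Sofic approximation.** A sofic approximation of $\Gamma$ (with respect to the finite symmetric generating set $S$) is a sequence $(G_n)$ of finite directed graphs with edges labeled by elements of $S$ and uniformly bounded degrees, converging in the Benjamini–Schramm sense to the Cayley graph $\mathrm{Cay}(\Gamma,S)$: for every $r$, the proportion of vertices $v\in V(G_n)$ whose $r$-ball in $G_n$ is isomorphic, as a rooted $S$-edge-labeled graph, to the $r$-ball around the identity in $\mathrm{Cay}(\Gamma,S)$ tends to $1$ as $n\to\infty$. **Combinatorial cost.** Regard $G_n$ as an undirected graph with graph distance $d_{G_n}$ ($\infty$ between different components). A rewiring of $(G_n)$ is a sequence of graphs $(H_n)$ with $V(H_n)=V(G_n)$ for which there is $L\in\mathbb{N}$ such that for all $n$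 and all $x,y\in V(G_n)$, $\frac1L d_{H_n}(x,y)\le d_{G_n}(x,y)\le L\,d_{H_n}(x,y)$. The combinatorial cost is $$\mathrm{cc}\big((G_n)\big)=\inf\Big\{\liminf_{n\to\infty}\frac{|E(H_n)|}{|V(H_n)|}\ :\ (H_n)\text{ a rewiring of }(G_n)\Big\}.$$ *)

theory Defs
  imports "HOL-Probability.Probability" "HOL-Algebra.Group_Action" "HOL-Algebra.Generated_Groups"
begin

definition standard_borel :: "'x measure \<Rightarrow> bool" where
  "standard_borel M \<longleftrightarrow>
     (\<exists>T. completely_metrizable_space T \<and> separable_space T \<and> topspace T = space M \<and>
          sets M = sigma_sets (space M) {U. openin T U})"

definition standard_prob_space :: "'x measure \<Rightarrow> bool" where
  "standard_prob_space M \<longleftrightarrow> prob_space M \<and> standard_borel M"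

definition pmp_action :: "('g, 'm) monoid_scheme \<Rightarrow> 'x measure \<Rightarrow> ('g \<Rightarrow> 'x \<Rightarrow> 'x) \<Rightarrow> bool" where
  "pmp_action \<Gamma> M \<phi> \<longleftrightarrow>
     group_action \<Gamma> (space M) \<phi> \<and>
     (\<forall>g\<in>carrier \<Gamma>. \<phi> g \<in> M \<rightarrow>\<^sub>M M \<and> distr M M (\<phi> g) = M)"

definition essentially_free :: "('g, 'm) monoid_scheme \<Rightarrow> 'x measure \<Rightarrow> ('g \<Rightarrow> 'x \<Rightarrow> 'x) \<Rightarrow> bool" where
  "essentially_free \<Gamma> M \<phi> \<longleftrightarrow> (AE x in M. stabilizer \<Gamma> \<phi> x = {\<one>\<^bsub>\<Gamma>\<^esub>})"

definition orbit_rel :: "('g, 'm) monoid_scheme \<Rightarrow> 'x measure \<Rightarrow> ('g \<Rightarrow> 'x \<Rightarrow> 'x) \<Rightarrow> ('x \<times> 'x) set" where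
  "orbit_rel \<Gamma> M \<phi> = {(x, y). x \<in> space M \<and> y \<in> orbit \<Gamma> \<phi> x}"

definition graphing :: "'x measure \<Rightarrow> ('x \<times> 'x) set \<Rightarrow> ('x \<times> 'x) set \<Rightarrow> bool" where
  "graphing M R H \<longleftrightarrow>
     H \<in> sets (M \<Otimes>\<^sub>M M) \<and> sym H \<and> irrefl H \<and> H \<subseteq> R \<and>
     (AE x in M. H\<^sup>* `` {x} = R `` {x})"

definition rel_cost :: "'x measure \<Rightarrow> ('x \<times> 'x) set \<Rightarrow> ennreal" where
  "rel_cost M R =
     (INF H \<in> {H. graphing M R H}. \<integral>\<^sup>+ x. emeasure (count_space UNIV) (H `` {x}) \<partial>M) / 2"

definition action_cost :: "('g, 'm) monoid_scheme \<Rightarrow> 'x measure \<Rightarrow> ('g \<Rightarrow> 'x \<Rightarrow> 'x) \<Rightarrow> ennreal" where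
  "action_cost \<Gamma> M \<phi> = rel_cost M (orbit_rel \<Gamma> M \<phi>)"

text \<open>
  A definition cannot quantify over all types. A standard Borel space has at most continuum
  many points, so each is isomorphic to one whose points are reals; the space and the Borel
  structure below are otherwise arbitrary and need not be those inherited from the real line.
\<close>
definition fixed_price :: "('g, 'm) monoid_scheme \<Rightarrow> ennreal \<Rightarrow> bool" where
  "fixed_price \<Gamma> c \<longleftrightarrow>
     (\<forall>(M :: real measure) \<phi>.
        standard_prob_space M \<and> pmp_action \<Gamma> M \<phi> \<and> essentially_free \<Gamma> M \<phi> \<longrightarrow>
        action_cost \<Gamma> M \<phi> = c)"

definition symmetric_generating_set :: "('g, 'm) monoid_scheme \<Rightarrow> 'g set \<Rightarrow> bool" where
  "symmetric_generating_set \<Gamma> S \<longleftrightarrow>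
     S \<subseteq> carrier \<Gamma> \<and> (\<forall>s\<in>S. inv\<^bsub>\<Gamma>\<^esub> s \<in> S) \<and> generate \<Gamma> S = carrier \<Gamma>"

text \<open>An arc \<open>(x, s, y)\<close> goes from \<open>x\<close> to \<open>y\<close> and has label \<open>s\<close>.\<close>
record ('v, 'l) ldigraph =
  lverts :: "'v set"
  larcs :: "('v \<times> 'l \<times> 'v) set"

definition finite_ldigraph :: "'l set \<Rightarrow> ('v, 'l) ldigraph \<Rightarrow> bool" where
  "finite_ldigraph S G \<longleftrightarrow> finite (lverts G) \<and> larcs G \<subseteq> lverts G \<times> S \<times> lverts G"

definition ldegree :: "('v, 'l) ldigraph \<Rightarrow> 'v \<Rightarrow> nat" where
  "ldegree G v = card {(x, s, y) \<in> larcs G. x = v \<or> y = v}"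

definition cayley_graph :: "('g, 'm) monoid_scheme \<Rightarrow> 'g set \<Rightarrow> ('g, 'g) ldigraph" where
  "cayley_graph \<Gamma> S =
     \<lparr>lverts = carrier \<Gamma>, larcs = {(g, s, g \<otimes>\<^bsub>\<Gamma>\<^esub> s) | g s. g \<in> carrier \<Gamma> \<and> s \<in> S}\<rparr>"

text \<open>
  Undirected simple graphs are given by their sets of two-element edges. The infimum of the
  empty set is \<open>\<infinity>\<close>.
\<close>
definition gdist :: "'v set set \<Rightarrow> 'v \<Rightarrow> 'v \<Rightarrow> enat" where
  "gdist E x y = (INF k \<in> {k. ((\<lambda>u v. {u, v} \<in> E) ^^ k) x y}. enat k)"

definition underlying_edges :: "('v, 'l) ldigraph \<Rightarrow> 'v set set" where
  "underlying_edges G = {{x, y} | x s y. (x, s, y) \<in> larcs G \<and> x \<noteq> y}"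

definition lball :: "('v, 'l) ldigraph \<Rightarrow> 'v \<Rightarrow> nat \<Rightarrow> ('v, 'l) ldigraph" where
  "lball G v r =
     (let B = {u \<in> lverts G. gdist (underlying_edges G) v u \<le> enat r}
      in \<lparr>lverts = B, larcs = larcs G \<inter> B \<times> UNIV \<times> B\<rparr>)"

definition rooted_iso :: "('v, 'l) ldigraph \<Rightarrow> 'v \<Rightarrow> ('w, 'l) ldigraph \<Rightarrow> 'w \<Rightarrow> bool" where
  "rooted_iso G v H w \<longleftrightarrow>
     (\<exists>f. bij_betw f (lverts G) (lverts H) \<and> f v = w \<and>
          (\<forall>x\<in>lverts G. \<forall>y\<in>lverts G. \<forall>s. (x, s, y) \<in> larcs G \<longleftrightarrow> (f x, s, f y) \<in> larcs H))"

definition sofic_approximation ::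
    "('g, 'm) monoid_scheme \<Rightarrow> 'g set \<Rightarrow> (nat \<Rightarrow> ('v, 'g) ldigraph) \<Rightarrow> bool" where
  "sofic_approximation \<Gamma> S G \<longleftrightarrow>
     (\<forall>n. finite_ldigraph S (G n)) \<and>
     (\<exists>D. \<forall>n. \<forall>v\<in>lverts (G n). ldegree (G n) v \<le> D) \<and>
     (\<forall>r. (\<lambda>n. real (card {v \<in> lverts (G n).
                 rooted_iso (lball (G n) v r) v (lball (cayley_graph \<Gamma> S) \<one>\<^bsub>\<Gamma>\<^esub> r) \<one>\<^bsub>\<Gamma>\<^esub>}) /
               real (card (lverts (G n)))) \<longlonglongrightarrow> 1)"

definition rewiring :: "(nat \<Rightarrow> ('v, 'l) ldigraph) \<Rightarrow> (nat \<Rightarrow> 'v set set) \<Rightarrow> bool" where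
  "rewiring G H \<longleftrightarrow>
     (\<forall>n. H n \<subseteq> {e. e \<subseteq> lverts (G n) \<and> card e = 2}) \<and>
     (\<exists>L\<ge>1. \<forall>n. \<forall>x\<in>lverts (G n). \<forall>y\<in>lverts (G n).
        gdist (H n) x y \<le> enat L * gdist (underlying_edges (G n)) x y \<and>
        gdist (underlying_edges (G n)) x y \<le> enat L * gdist (H n) x y)"

definition comb_cost :: "(nat \<Rightarrow> ('v, 'l) ldigraph) \<Rightarrow> ennreal" where
  "comb_cost G =
     (INF H \<in> {H. rewiring G H}.
        liminf (\<lambda>n. ennreal (real (card (H n)) / real (card (lverts (G n))))))"

end

theory Submission
  imports Defs
begin

text \<open>
  A sofic approximation \<open>G\<^sub>n\<close> carries an almost action of the group on its vertices: \<open>v \<cdot> g\<close> is the end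
  of the walk from \<open>v\<close> along a fixed word for \<open>g\<close>, and each group law holds off a vanishing
  proportion of vertices.

  Upper bound. The Bernoulli action on labelings by i.i.d. uniform reals is essentially free, so it
  has a graphing of cost close to \<open>c\<close>. Truncate it and approximate it by events that depend on
  finitely many labels. Evaluated at i.i.d. labels of the vertices of \<open>G\<^sub>n\<close>, these events define a
  random graph; adding the few edges of \<open>G\<^sub>n\<close> whose ends it does not connect makes it a rewiring.
  Its expected number of edges is at most about \<open>c |V(G\<^sub>n)|\<close>, so some labeling is good enough.

  Lower bound. Seen from a uniform vertex, a rewiring \<open>H\<^sub>n\<close> is a random graph on the group. A
  subsequential weak limit is an invariant random graph that is almost surely connected and
  whose expected degree at the identity is at most \<open>2 lim |E(H\<^sub>n)| / |V(G\<^sub>n)|\<close>. The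
  product of this invariant measure with the Bernoulli action is essentially free, and the random
  graph is a graphing of it.
\<close>

section \<open>Actions on spaces of cardinality at most the continuum\<close>

text \<open>Connectedness is not a closed condition, so neither direction can pass it through an
  approximation for free. For the lower bound the uniform constant of the rewiring helps: an edge of
  \<open>G n\<close> is replaced by a path that stays within a fixed distance, so being joined
  depends on finitely many coordinates and survives a weak limit. For the upper bound, approximation
  by cylinder sets destroys some connections, but only with small probability, and each failure is
  paid for by one edge. Expected degrees are controlled one finite set of group elements at a time,
  which gives an inequality in the direction needed.

  The limit random graph may have symmetries; the Bernoulli factor makes the action free.

  Price is fixed only for measures on the reals, whereas the actions built below live on function
  spaces. They are transported along a bijection that need not respect the usual Borel sets. Degree
  functions of graphings are nowhere required to be measurable: integrals are suprema over simple
  functions, and all comparisons are arranged as inequalities.\<close>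

text \<open>Every simple function below \<open>f\<close> on the target pulls back to a simple
  function below the composition. No measurability of \<open>f\<close> is assumed, so that degree
  functions can be inserted directly; the price is having an inequality only.\<close>

lemma nn_integral_distr_le:
  assumes T: "T \<in> M \<rightarrow>\<^sub>M N"
  shows "(\<integral>\<^sup>+ y. f y \<partial>distr M N T) \<le> (\<integral>\<^sup>+ x. f (T x) \<partial>M)"
proof (subst nn_integral_def, rule SUP_least)
  fix g assume "g \<in> {g. simple_function (distr M N T) g \<and> g \<le> f}"
  then have sg: "simple_function (distr M N T) g" and gf: "g \<le> f" by auto
  have "simple_integral (distr M N T) g = (\<integral>\<^sup>+ y. g y \<partial>distr M N T)"
    by (rule nn_integral_eq_simple_integral[OF sg, symmetric])
  also have "\<dots> = (\<integral>\<^sup>+ x. g (T x) \<partial>M)"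
    using T borel_measurable_simple_function[OF sg] by (intro nn_integral_distr) auto
  also have "\<dots> \<le> (\<integral>\<^sup>+ x. f (T x) \<partial>M)"
    using gf by (intro nn_integral_mono) (auto simp: le_fun_def)
  finally show "simple_integral (distr M N T) g \<le> (\<integral>\<^sup>+ x. f (T x) \<partial>M)" .
qed

text \<open>A graphing pulls back along an isomorphism of actions with the same classes and degrees,
  so every graphing for \<open>N\<close> has a competitor in the infimum for \<open>M\<close>.
  Exchanging the two maps gives the reverse inequality.\<close>

lemma action_cost_iso_le:
  assumes f: "f \<in> M \<rightarrow>\<^sub>M N" and g: "g \<in> N \<rightarrow>\<^sub>M M"
    and gf: "\<And>x. g (f x) = x" and fg: "\<And>y. f (g y) = y"
    and spM: "space M = UNIV" and spN: "space N = UNIV"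
    and distr: "distr M N f = N"
    and equiv: "\<And>a x. a \<in> carrier \<Gamma> \<Longrightarrow> \<psi> a (f x) = f (\<phi> a x)"
  shows "action_cost \<Gamma> M \<phi> \<le> action_cost \<Gamma> N \<psi>"
  unfolding action_cost_def rel_cost_def
proof (rule divide_right_mono_ennreal, rule INF_greatest)
  define R where "R = orbit_rel \<Gamma> M \<phi>"
  define R' where "R' = orbit_rel \<Gamma> N \<psi>"
  have RR: "(x, y) \<in> R \<longleftrightarrow> (f x, f y) \<in> R'" for x y
  proof -
    have "f y = \<psi> a (f x) \<longleftrightarrow> y = \<phi> a x" if "a \<in> carrier \<Gamma>" for a
      using equiv[OF that] gf by metis
    then show ?thesis unfolding R_def R'_def orbit_rel_def orbit_def spM spN by blast
  qed
  fix H' assume "H' \<in> {H. graphing N (orbit_rel \<Gamma> N \<psi>) H}"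
  then have H': "H' \<in> sets (N \<Otimes>\<^sub>M N)" "sym H'" "irrefl H'" "H' \<subseteq> R'"
    and AE': "AE x in N. H'\<^sup>* `` {x} = R' `` {x}"
    unfolding graphing_def R'_def by auto
  define H where "H = {(x, y). (f x, f y) \<in> H'}"
  have dNM: "distr N M g = M"
  proof -
    have "distr N M g = distr (distr M N f) M g" by (simp add: distr)
    also have "\<dots> = distr M M (g \<circ> f)" using f g by (rule distr_distr[rotated])
    also have "g \<circ> f = id" using gf by (auto simp: fun_eq_iff)
    finally show ?thesis by (simp add: id_def)
  qed
  have Hs: "H \<in> sets (M \<Otimes>\<^sub>M M)"
  proof -
    have "(\<lambda>p. (f (fst p), f (snd p))) \<in> (M \<Otimes>\<^sub>M M) \<rightarrow>\<^sub>M (N \<Otimes>\<^sub>M N)"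
      using f by measurable
    from measurable_sets[OF this H'(1)] show ?thesis
      by (auto simp: H_def space_pair_measure spM vimage_def case_prod_beta')
  qed
  have rt1: "(f x, f y) \<in> H'\<^sup>*" if "(x, y) \<in> H\<^sup>*" for x y
    using that by induction (auto simp: H_def intro: rtrancl.rtrancl_into_rtrancl)
  have rt2: "(g u, g v) \<in> H\<^sup>*" if "(u, v) \<in> H'\<^sup>*" for u v
    using that by induction (auto simp: H_def fg intro: rtrancl.rtrancl_into_rtrancl)
  have rt: "(x, y) \<in> H\<^sup>* \<longleftrightarrow> (f x, f y) \<in> H'\<^sup>*" for x y
    using rt1[of x y] rt2[of "f x" "f y"] by (auto simp: gf)
  have "AE x in M. H'\<^sup>* `` {f x} = R' `` {f x}"
    using AE_distrD[OF f, where P="\<lambda>x. H'\<^sup>* `` {x} = R' `` {x}"] AE' distr by metis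
  then have AE: "AE x in M. H\<^sup>* `` {x} = R `` {x}"
    by eventually_elim (auto simp: rt RR)
  have "graphing M R H"
    unfolding graphing_def using Hs AE H'
    by (auto simp: H_def sym_def irrefl_def RR)
  then have "(INF H\<in>{H. graphing M R H}. \<integral>\<^sup>+ x. emeasure (count_space UNIV) (H `` {x}) \<partial>M)
      \<le> (\<integral>\<^sup>+ x. emeasure (count_space UNIV) (H `` {x}) \<partial>M)"
    by (intro INF_lower) auto
  \<comment> \<open>Writing \<open>M\<close> as the image of \<open>N\<close> under
    \<open>g\<close>, rather than \<open>N\<close> as the image of \<open>M\<close>, orients the
    inequality for non-measurable degrees correctly.\<close>
  also have "\<dots> = (\<integral>\<^sup>+ x. emeasure (count_space UNIV) (H `` {x}) \<partial>distr N M g)"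
    by (simp add: dNM)
  also have "\<dots> \<le> (\<integral>\<^sup>+ y. emeasure (count_space UNIV) (H `` {g y}) \<partial>N)"
    by (rule nn_integral_distr_le[OF g])
  also have "\<dots> = (\<integral>\<^sup>+ y. emeasure (count_space UNIV) (H' `` {y}) \<partial>N)"
  proof (rule nn_integral_cong)
    fix y
    have "H `` {g y} = g ` (H' `` {y})"
      by (auto simp: H_def fg gf image_iff Bex_def) (metis gf)
    moreover have "inj g" by (metis fg injI)
    ultimately show "emeasure (count_space UNIV) (H `` {g y}) = emeasure (count_space UNIV) (H' `` {y})"
      by (metis (no_types, lifting) card_image emeasure_count_space_finite emeasure_count_space_infinite
          finite_imageD inj_on_subset top_greatest finite_imageI)
  qed
  finally show "(INF H\<in>{H. graphing M (orbit_rel \<Gamma> M \<phi>) H}. \<integral>\<^sup>+ x. emeasure (count_space UNIV) (H `` {x}) \<partial>M)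
      \<le> (\<integral>\<^sup>+ y. emeasure (count_space UNIV) (H' `` {y}) \<partial>N)" unfolding R_def .
qed

lemma homeomorphic_map_pullback_inv:
  assumes f: "bij f"
  shows "homeomorphic_map euclidean (pullback_topology UNIV (inv_into UNIV f) euclidean) f"
proof -
  have inj: "inj f" and surj: "range f = UNIV" using f by (auto simp: bij_def)
  have *: "inv_into UNIV f -` V = f ` V" for V
    using f by (metis bij_imp_bij_inv bij_vimage_eq_inv_image inv_inv_eq)
  show ?thesis
    unfolding homeomorphic_map_def quotient_map_def openin_pullback_topology topspace_pullback_topology
    using inj surj by (auto simp: * vimage_def[symmetric] inj_vimage_image_eq)
qed

text \<open>\<open>standard_borel\<close> asks for some Polish topology generating the sets, so the
  topology may be carried along with the points: the one used here makes the arbitrary bijection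
  \<open>f\<close> a homeomorphism.\<close>

lemma standard_borel_embed_measure:
  fixes M :: "('x::{complete_space, second_countable_topology}) measure" and f :: "'x \<Rightarrow> 'y"
  assumes sM: "sets M = sets borel" and f: "bij f"
  shows "standard_borel (embed_measure M f)"
proof -
  have inj: "inj f" and surj: "range f = UNIV" using f by (auto simp: bij_def)
  have spM: "space M = UNIV" using sets_eq_imp_space_eq[OF sM] by simp
  have *: "inv_into UNIV f -` V = f ` V" for V
    using f by (metis bij_imp_bij_inv bij_vimage_eq_inv_image inv_inv_eq)
  define T where "T = pullback_topology UNIV (inv_into UNIV f) (euclidean :: 'x topology)"
  have opT: "openin T U \<longleftrightarrow> (\<exists>V. open V \<and> U = f ` V)" for U
    unfolding T_def openin_pullback_topology by (simp add: *)
  have tsT: "topspace T = UNIV" unfolding T_def by (simp add: topspace_pullback_topology)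
  have hs: "(euclidean :: 'x topology) homeomorphic_space T"
    using homeomorphic_map_imp_homeomorphic_space[OF homeomorphic_map_pullback_inv[OF f]]
    unfolding T_def .
  have "completely_metrizable_space T"
    using homeomorphic_completely_metrizable_space[OF hs] completely_metrizable_space_euclidean by blast
  moreover have "separable_space T"
  proof -
    obtain D :: "'x set" where D: "countable D" "\<And>X. open X \<Longrightarrow> X \<noteq> {} \<Longrightarrow> \<exists>d\<in>D. d \<in> X"
      by (rule countable_dense_setE) blast
    have "closure D = UNIV"
      using D(2)[of "- closure D"] by (metis ComplD Compl_eq_Compl_iff closed_closure closure_subset
          compl_bot_eq double_compl open_Compl subsetD)
    then have "separable_space (euclidean :: 'x topology)"
      unfolding separable_space_def using D(1) by (intro exI[of _ D]) auto
    then show ?thesis using homeomorphic_separable_space[OF hs] by simp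
  qed
  moreover have "sets (embed_measure M f) = sigma_sets (space (embed_measure M f)) {U. openin T U}"
  proof -
    have "sets M = sigma_sets UNIV {V. open V}"
      by (simp add: sM borel_def)
    then have "sets (embed_measure M f) = {inv_into UNIV f -` A \<inter> UNIV |A. A \<in> sigma_sets UNIV {V. open V}}"
      unfolding sets_embed_measure[OF inj] * by simp
    also have "\<dots> = sigma_sets UNIV {inv_into UNIV f -` A \<inter> UNIV |A. A \<in> {V. open V}}"
      by (rule sigma_sets_vimage_commute) auto
    also have "{inv_into UNIV f -` A \<inter> UNIV |A. A \<in> {V. open V}} = {U. openin T U}"
      unfolding opT * by auto
    finally show ?thesis by (simp add: space_embed_measure spM surj)
  qed
  ultimately show ?thesis
    unfolding standard_borel_def by (intro exI[of _ T]) (auto simp: space_embed_measure spM surj tsT)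
qed

text \<open>This frees \<open>fixed_price\<close> from the type \<open>real\<close>. The action is
  conjugated by \<open>f\<close>, about which only bijectivity is known, and the costs are compared
  in both directions.\<close>

lemma action_cost_eq_fixed_price:
  fixes M :: "('x::{complete_space, second_countable_topology}) measure" and f :: "'x \<Rightarrow> real"
  assumes fp: "fixed_price \<Gamma> c" and \<Gamma>: "group \<Gamma>" and f: "bij f"
    and sM: "sets M = sets borel" and "prob_space M"
    and pmp: "pmp_action \<Gamma> M \<phi>" and free: "essentially_free \<Gamma> M \<phi>"
  shows "action_cost \<Gamma> M \<phi> = c"
proof -
  interpret prob_space M by fact
  define N where "N = embed_measure M f"
  define g where "g = inv_into UNIV f"
  define \<psi> where "\<psi> = (\<lambda>a y. f (\<phi> a (g y)))"
  have inj: "inj f" and surj: "range f = UNIV" using f by (auto simp: bij_def)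
  have spM: "space M = UNIV" using sets_eq_imp_space_eq[OF sM] by simp
  have spN: "space N = UNIV" by (simp add: N_def space_embed_measure spM surj)
  have gf[simp]: "g (f x) = x" for x by (simp add: g_def inj)
  have fg[simp]: "f (g y) = y" for y by (simp add: g_def surj surj_f_inv_f)
  have fm: "f \<in> M \<rightarrow>\<^sub>M N" unfolding N_def by (rule measurable_embed_measure2[OF inj])
  have gm: "g \<in> N \<rightarrow>\<^sub>M M" unfolding N_def by (rule measurable_embed_measure1) simp
  have dMN: "distr M N f = N" unfolding N_def by (rule embed_measure_eq_distr[OF inj, symmetric])
  have dNM: "distr N M g = M"
  proof -
    have "distr N M g = distr (distr M N f) M g" by (simp add: dMN)
    also have "\<dots> = distr M M (g \<circ> f)" using fm gm by (rule distr_distr[rotated])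
    also have "g \<circ> f = id" using gf by (auto simp: fun_eq_iff)
    finally show ?thesis by (simp add: id_def)
  qed
  interpret A: group_action \<Gamma> UNIV \<phi>
    using pmp unfolding pmp_action_def spM by simp
  interpret group \<Gamma> by fact
  have m\<phi>: "\<phi> a \<in> M \<rightarrow>\<^sub>M M" and d\<phi>: "distr M M (\<phi> a) = M" if "a \<in> carrier \<Gamma>" for a
    using pmp that unfolding pmp_action_def by auto
  have "group_action \<Gamma> UNIV \<psi>"
    unfolding group_action_def group_hom_def group_hom_axioms_def hom_def
  proof (intro conjI \<Gamma> group_BijGroup CollectI Pi_I ballI)
    have bij: "bij (\<psi> a)" if "a \<in> carrier \<Gamma>" for a
    proof -
      have "bij (\<phi> a)" using A.bij_prop0[OF that] by (simp add: Bij_def)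
      moreover have "bij g" by (metis bij_imp_bij_inv f g_def)
      moreover have "\<psi> a = f \<circ> \<phi> a \<circ> g" by (auto simp: \<psi>_def)
      ultimately show ?thesis using f by (metis bij_comp)
    qed
    show "\<psi> a \<in> carrier (BijGroup UNIV)" if "a \<in> carrier \<Gamma>" for a
      using bij[OF that] by (simp add: BijGroup_def Bij_def)
    show "\<psi> (a \<otimes>\<^bsub>\<Gamma>\<^esub> b) = \<psi> a \<otimes>\<^bsub>BijGroup UNIV\<^esub> \<psi> b" if "a \<in> carrier \<Gamma>" "b \<in> carrier \<Gamma>" for a b
      using bij[OF that(1)] bij[OF that(2)] A.composition_rule[of _ a b] that
      by (auto simp: BijGroup_def Bij_def compose_def fun_eq_iff \<psi>_def)
  qed
  moreover have "\<psi> a \<in> N \<rightarrow>\<^sub>M N \<and> distr N N (\<psi> a) = N" if a: "a \<in> carrier \<Gamma>" for a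
  proof
    show \<psi>m: "\<psi> a \<in> N \<rightarrow>\<^sub>M N"
      unfolding \<psi>_def using fm gm m\<phi>[OF a] by measurable
    have "distr N N (\<psi> a) = distr (distr M N f) N (\<psi> a)" by (simp add: dMN)
    also have "\<dots> = distr M N (\<psi> a \<circ> f)" using fm \<psi>m by (rule distr_distr[rotated])
    also have "\<psi> a \<circ> f = f \<circ> \<phi> a" by (auto simp: \<psi>_def)
    also have "distr M N (f \<circ> \<phi> a) = distr (distr M M (\<phi> a)) N f"
      using distr_distr[OF fm m\<phi>[OF a]] by simp
    finally show "distr N N (\<psi> a) = N" by (simp add: d\<phi>[OF a] dMN)
  qed
  ultimately have "pmp_action \<Gamma> N \<psi>" unfolding pmp_action_def spN by auto
  moreover have "essentially_free \<Gamma> N \<psi>"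
  proof -
    have "stabilizer \<Gamma> \<psi> (f x) = stabilizer \<Gamma> \<phi> x" for x
      unfolding stabilizer_def \<psi>_def using inj by (auto simp: inj_eq)
    then show ?thesis
      using free unfolding essentially_free_def N_def AE_embed_measure[OF inj] by simp
  qed
  moreover have "standard_prob_space N"
    unfolding standard_prob_space_def
  proof
    show "prob_space N" using prob_space_distr[OF fm] by (simp add: dMN)
    show "standard_borel N" unfolding N_def by (rule standard_borel_embed_measure[OF sM f])
  qed
  ultimately have "action_cost \<Gamma> N \<psi> = c" using fp unfolding fixed_price_def by blast
  moreover have "action_cost \<Gamma> M \<phi> \<le> action_cost \<Gamma> N \<psi>"
    by (rule action_cost_iso_le[OF fm gm _ _ spM spN dMN]) (auto simp: \<psi>_def)
  moreover have "action_cost \<Gamma> N \<psi> \<le> action_cost \<Gamma> M \<phi>"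
    by (rule action_cost_iso_le[OF gm fm _ _ spN spM dNM]) (auto simp: \<psi>_def)
  ultimately show ?thesis by simp
qed

text \<open>A real is a set of naturals, and countably many sets of naturals are coded by a single
  set of pairs of naturals.\<close>

lemma lepoll_fun_reals: "(UNIV :: ('i::countable \<Rightarrow> real) set) \<lesssim> (UNIV :: real set)"
proof -
  obtain h :: "real \<Rightarrow> nat set" where h: "inj h"
    using nat_sets_eqpoll_reals eqpoll_sym unfolding eqpoll_def bij_betw_def by metis
  define k :: "('i \<Rightarrow> real) \<Rightarrow> nat set" where
    "k x = {prod_encode (to_nat (i::'i), n) |i n. n \<in> h (x i)}" for x
  have "inj k"
  proof (rule injI, rule ext)
    fix x y :: "'i \<Rightarrow> real" and i :: 'i assume "k x = k y"
    then have "prod_encode (to_nat i, n) \<in> k x \<longleftrightarrow> prod_encode (to_nat i, n) \<in> k y" for n by simp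
    then have "h (x i) = h (y i)" unfolding k_def by auto
    then show "x i = y i" using h by (simp add: inj_eq)
  qed
  then have "(UNIV :: ('i \<Rightarrow> real) set) \<lesssim> (UNIV :: nat set set)"
    unfolding lepoll_def by (intro exI[of _ k]) auto
  then show ?thesis using nat_sets_eqpoll_reals by (metis lepoll_trans2)
qed

lemma ex_bij_fun_reals: "\<exists>f :: ('i::countable \<Rightarrow> real) \<Rightarrow> real. bij f"
proof -
  have "inj (\<lambda>(r::real) (i::'i). r)" by (auto simp: inj_def fun_eq_iff)
  then have "(UNIV :: real set) \<lesssim> (UNIV :: ('i \<Rightarrow> real) set)" unfolding lepoll_def by blast
  with lepoll_fun_reals show ?thesis using lepoll_antisym unfolding eqpoll_def by blast
qed

lemma ex_bij_fun_prod_reals: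
  "\<exists>f :: ('i::countable \<Rightarrow> real) \<times> ('j::countable \<Rightarrow> real) \<Rightarrow> real. bij f"
proof -
  obtain f :: "('i + 'j \<Rightarrow> real) \<Rightarrow> real" where f: "bij f" using ex_bij_fun_reals by blast
  define h :: "('i \<Rightarrow> real) \<times> ('j \<Rightarrow> real) \<Rightarrow> ('i + 'j \<Rightarrow> real)" where
    "h p = (\<lambda>s. case s of Inl i \<Rightarrow> fst p i | Inr j \<Rightarrow> snd p j)" for p
  have "bij h"
  proof (rule bijI')
    show "(h p = h q) = (p = q)" for p q
      unfolding h_def fun_eq_iff by (auto simp: prod_eq_iff fun_eq_iff split: sum.splits)
    show "\<exists>p. z = h p" for z
      by (rule exI[of _ "(z \<circ> Inl, z \<circ> Inr)"]) (auto simp: h_def fun_eq_iff split: sum.splits)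
  qed
  with f have "bij (f \<circ> h)" by (metis bij_comp)
  then show ?thesis by blast
qed

section \<open>The almost action on a sofic approximation\<close>

lemma gdist_le_iff: "gdist E x y \<le> enat k \<longleftrightarrow> (\<exists>j\<le>k. ((\<lambda>u v. {u, v} \<in> E) ^^ j) x y)"
proof
  assume le: "gdist E x y \<le> enat k"
  let ?K = "{j. ((\<lambda>u v. {u, v} \<in> E) ^^ j) x y}"
  have "?K \<noteq> {}"
  proof
    assume "?K = {}"
    then have "gdist E x y = \<infinity>" by (simp add: gdist_def top_enat_def)
    with le show False by simp
  qed
  then have "gdist E x y \<in> enat ` ?K"
    unfolding gdist_def by (metis (mono_tags) Inf_enat_def LeastI_ex empty_iff ex_in_conv image_is_empty)
  then show "\<exists>j\<le>k. ((\<lambda>u v. {u, v} \<in> E) ^^ j) x y" using le by auto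
next
  assume "\<exists>j\<le>k. ((\<lambda>u v. {u, v} \<in> E) ^^ j) x y"
  then obtain j where j: "j \<le> k" "((\<lambda>u v. {u, v} \<in> E) ^^ j) x y" by blast
  have "gdist E x y \<le> enat j" unfolding gdist_def using j by (intro INF_lower) auto
  then show "gdist E x y \<le> enat k" using j by (auto elim: order_trans)
qed

lemma gdist_same [simp]: "gdist E x x = 0"
  using gdist_le_iff[of E x x 0] by (simp add: zero_enat_def[symmetric])

lemma gdist_edge: "{x, y} \<in> E \<Longrightarrow> gdist E x y \<le> enat 1"
  unfolding gdist_le_iff by (intro exI[of _ 1]) (auto simp: OO_def)

lemma gdist_trans: "gdist E x y \<le> enat j \<Longrightarrow> gdist E y z \<le> enat k \<Longrightarrow> gdist E x z \<le> enat (j + k)"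
  unfolding gdist_le_iff by (blast intro: add_mono relpowp_trans)

text \<open>Each of the two inequalities of a rewiring follows from a bound on single edges, by
  concatenating along a shortest path.\<close>

lemma gdist_le_mult:
  assumes L: "1 \<le> L" and step: "\<And>x y. {x, y} \<in> E \<Longrightarrow> gdist E' x y \<le> enat L"
  shows "gdist E' x y \<le> enat L * gdist E x y"
proof (cases "gdist E x y")
  case (enat k)
  then obtain j where j: "j \<le> k" "((\<lambda>u v. {u, v} \<in> E) ^^ j) x y"
    by (metis gdist_le_iff order_refl)
  have "gdist E' x y \<le> enat (L * j)"
    using j(2)
  proof (induction j arbitrary: y)
    case (Suc j)
    then obtain z where z: "((\<lambda>u v. {u, v} \<in> E) ^^ j) x z" "{z, y} \<in> E" by auto
    show ?case using gdist_trans[OF Suc.IH[OF z(1)] step[OF z(2)]] by (simp add: algebra_simps)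
  qed (simp add: zero_enat_def[symmetric])
  also have "\<dots> \<le> enat (L * k)" using j(1) by simp
  finally show ?thesis using enat by simp
next
  case infinity
  \<comment> \<open>This is where \<open>L\<close> must be nonzero: zero times infinity is zero in
    \<open>enat\<close>.\<close>
  then show ?thesis using L by (simp add: imult_is_infinity)
qed

text \<open>The walk is made total: without a suitable arc it stays in place, and among several arcs
  one is chosen. At vertices whose ball looks like the Cayley graph neither exception occurs within
  that ball.\<close>

primrec walk :: "('v \<times> 'l \<times> 'v) set \<Rightarrow> 'v \<Rightarrow> 'l list \<Rightarrow> 'v" where
  "walk A v [] = v"
| "walk A v (s # w) = walk A (if \<exists>u. (v, s, u) \<in> A then SOME u. (v, s, u) \<in> A else v) w"

lemma walk_append: "walk A v (a @ b) = walk A (walk A v a) b"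
  by (induction a arbitrary: v) auto

lemma walk_single_cases: "(v, s, walk A v [s]) \<in> A \<or> walk A v [s] = v"
  by (auto intro: someI)

lemma walk_single_unique:
  assumes "(v, s, u) \<in> A" "\<And>u'. (v, s, u') \<in> A \<Longrightarrow> u' = u"
  shows "walk A v [s] = u"
proof -
  have "(SOME u'. (v, s, u') \<in> A) = u" using assms by (rule some_equality)
  then show ?thesis using assms(1) by auto
qed

section \<open>Groups with a finite symmetric generating set\<close>

locale marked_group = group \<Gamma> for \<Gamma> :: "('g, 'm) monoid_scheme" (structure) +
  fixes S :: "'g set"
  assumes finite_S: "finite S" and sym_gen: "symmetric_generating_set \<Gamma> S"
begin

lemma S_carrier: "S \<subseteq> carrier \<Gamma>" and S_inv: "s \<in> S \<Longrightarrow> inv s \<in> S"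
  and S_gen: "generate \<Gamma> S = carrier \<Gamma>"
  using sym_gen unfolding symmetric_generating_set_def by auto

primrec word_prod :: "'g list \<Rightarrow> 'g" where
  "word_prod [] = \<one>"
| "word_prod (s # w) = s \<otimes> word_prod w"

lemma word_prod_closed [simp]: "w \<in> lists S \<Longrightarrow> word_prod w \<in> carrier \<Gamma>"
  using S_carrier by (induction w) auto

lemma word_prod_append:
  "a \<in> lists S \<Longrightarrow> b \<in> lists S \<Longrightarrow> word_prod (a @ b) = word_prod a \<otimes> word_prod b"
proof (induction a)
  case (Cons s a)
  then show ?case using S_carrier by (auto simp: m_assoc subset_iff simp flip: in_lists_conv_set)
qed auto

lemma ex_word: "g \<in> carrier \<Gamma> \<Longrightarrow> \<exists>w\<in>lists S. word_prod w = g"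
  unfolding S_gen[symmetric]
proof (induction rule: generate.induct)
  case one
  show ?case by (intro bexI[of _ "[]"]) auto
next
  case (incl h)
  then show ?case using S_carrier by (intro bexI[of _ "[h]"]) auto
next
  case (inv h)
  then show ?case using S_carrier S_inv by (intro bexI[of _ "[inv h]"]) auto
next
  case (eng g h)
  then show ?case using word_prod_append by (metis append_in_lists_conv)
qed

text \<open>The identity gets the empty word so that it acts trivially at every vertex, not merely
  at almost all of them.\<close>

definition word :: "'g \<Rightarrow> 'g list" where
  "word g = (if g = \<one> then [] else SOME w. w \<in> lists S \<and> word_prod w = g)"

lemma word: "g \<in> carrier \<Gamma> \<Longrightarrow> word g \<in> lists S" "g \<in> carrier \<Gamma> \<Longrightarrow> word_prod (word g) = g"
  using ex_word[of g] someI_ex[of "\<lambda>w. w \<in> lists S \<and> word_prod w = g"]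
  unfolding word_def by auto

lemma word_one [simp]: "word \<one> = []"
  by (simp add: word_def)

lemma countable_carrier: "countable (carrier \<Gamma>)"
proof -
  have "carrier \<Gamma> \<subseteq> word_prod ` lists S" using ex_word by blast
  moreover have "countable (lists S)" using finite_S by (simp add: countable_finite countable_lists)
  ultimately show ?thesis by (metis countable_image countable_subset)
qed

text \<open>The balls about the identity in the word metric. They serve as the finite sets that
  exhaust the group.\<close>

primrec cball :: "nat \<Rightarrow> 'g set" where
  "cball 0 = {\<one>}"
| "cball (Suc m) = cball m \<union> (\<lambda>(h, s). h \<otimes> s) ` (cball m \<times> S)"

lemma finite_cball [simp]: "finite (cball m)"
  using finite_S by (induction m) auto

lemma cball_carrier: "cball m \<subseteq> carrier \<Gamma>"
proof (induction m)
  case (Suc m)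
  then show ?case using S_carrier by auto
qed simp

lemma one_in_cball: "\<one> \<in> cball m"
  by (induction m) auto

lemma cball_mono: "m \<le> k \<Longrightarrow> cball m \<subseteq> cball k"
  by (induction k) (auto simp: le_Suc_eq)

lemma S_cball: "0 < m \<Longrightarrow> S \<subseteq> cball m"
proof (induction m)
  case (Suc m)
  show ?case using one_in_cball[of m] S_carrier by (force simp: image_iff)
qed auto

end

section \<open>Properties of almost all vertices of a sofic approximation\<close>

locale sofic = marked_group \<Gamma> S for \<Gamma> :: "('g, 'm) monoid_scheme" (structure) and S +
  fixes G :: "nat \<Rightarrow> ('v, 'g) ldigraph"
  assumes sofic: "sofic_approximation \<Gamma> S G"
    and card_inf: "filterlim (\<lambda>n. card (lverts (G n))) at_top sequentially"
begin

abbreviation "V n \<equiv> lverts (G n)"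
abbreviation "A n \<equiv> larcs (G n)"
abbreviation "E n \<equiv> underlying_edges (G n)"

lemma finite_V [simp]: "finite (V n)"
  and arcs_sub: "A n \<subseteq> V n \<times> S \<times> V n"
  using sofic unfolding sofic_approximation_def finite_ldigraph_def by auto

lemma finite_A: "finite (A n)"
  using arcs_sub finite_subset[OF _ finite_cartesian_product[OF finite_V finite_cartesian_product[OF finite_S finite_V]]]
  by blast

lemma E_sub: "E n \<subseteq> {e. e \<subseteq> V n \<and> card e = 2}"
  using arcs_sub unfolding underlying_edges_def by (fastforce simp: card_2_iff)

lemma finite_E: "finite (E n)"
  by (rule finite_subset[of _ "Pow (V n)"]) (use E_sub in auto)

lemma eventually_card_pos: "eventually (\<lambda>n. 0 < card (V n)) sequentially"
  using card_inf unfolding filterlim_at_top by (auto elim!: eventually_mono dest!: spec[of _ 1])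

lemma walk_in_V: "v \<in> V n \<Longrightarrow> walk (A n) v w \<in> V n"
proof (induction w rule: rev_induct)
  case (snoc s w)
  have "(walk (A n) v w, s, walk (A n) (walk (A n) v w) [s]) \<in> A n \<or> walk (A n) (walk (A n) v w) [s] = walk (A n) v w"
    by (rule walk_single_cases)
  then show ?case using snoc arcs_sub by (auto simp: walk_append simp del: walk.simps(2))
qed simp

lemma gdist_walk: "gdist (E n) v (walk (A n) v w) \<le> enat (length w)"
proof (induction w rule: rev_induct)
  case (snoc s w)
  let ?u = "walk (A n) v w"
  have "gdist (E n) ?u (walk (A n) ?u [s]) \<le> enat 1"
  proof (cases "walk (A n) ?u [s] = ?u")
    case False
    then have "(?u, s, walk (A n) ?u [s]) \<in> A n" using walk_single_cases by metis
    with False have "{?u, walk (A n) ?u [s]} \<in> E n" unfolding underlying_edges_def by fastforce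
    then show ?thesis by (rule gdist_edge)
  qed (simp add: zero_enat_def[symmetric] del: walk.simps(2))
  from gdist_trans[OF snoc.IH this] show ?case by (simp add: walk_append del: walk.simps(2))
qed (simp add: zero_enat_def[symmetric])

text \<open>\<open>aa\<close> stands for almost all. Such properties are stable under finite
  conjunctions (\<open>aa_ball\<close>) and under translation by a group element
  (\<open>aa_translate\<close>); this is why later arguments are first reduced to finitely many
  group elements.\<close>

definition aa :: "(nat \<Rightarrow> 'v \<Rightarrow> bool) \<Rightarrow> bool" where
  "aa Q \<longleftrightarrow> (\<lambda>n. real (card {v \<in> V n. \<not> Q n v}) / real (card (V n))) \<longlonglongrightarrow> 0"

lemma aa_le:
  assumes "aa Q" "\<And>n. card {v \<in> V n. \<not> P n v} \<le> card {v \<in> V n. \<not> Q n v}"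
  shows "aa P"
  unfolding aa_def
  by (rule tendsto_sandwich[OF _ _ tendsto_const assms(1)[unfolded aa_def]])
    (auto intro!: always_eventually divide_right_mono simp: assms(2))

lemma aa_mono: "aa Q \<Longrightarrow> (\<And>n v. v \<in> V n \<Longrightarrow> Q n v \<Longrightarrow> P n v) \<Longrightarrow> aa P"
  by (erule aa_le) (auto intro!: card_mono)

lemma aa_sum_le:
  assumes "aa Q" "aa R" "\<And>n. card {v \<in> V n. \<not> P n v} \<le> card {v \<in> V n. \<not> Q n v} + card {v \<in> V n. \<not> R n v}"
  shows "aa P"
  unfolding aa_def
proof (rule tendsto_sandwich[OF _ _ tendsto_const])
  show "(\<lambda>n. real (card {v \<in> V n. \<not> Q n v}) / real (card (V n)) +
             real (card {v \<in> V n. \<not> R n v}) / real (card (V n))) \<longlonglongrightarrow> 0"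
    using tendsto_add[OF assms(1,2)[unfolded aa_def]] by simp
  have *: "real (card {v \<in> V n. \<not> P n v}) \<le> real (card {v \<in> V n. \<not> Q n v}) + real (card {v \<in> V n. \<not> R n v})" for n
    using assms(3)[of n] by linarith
  show "\<forall>\<^sub>F n in sequentially. real (card {v \<in> V n. \<not> P n v}) / real (card (V n))
         \<le> real (card {v \<in> V n. \<not> Q n v}) / real (card (V n)) + real (card {v \<in> V n. \<not> R n v}) / real (card (V n))"
    using * by (intro always_eventually) (simp add: divide_right_mono flip: add_divide_distrib)
qed auto

lemma aa_conj:
  assumes "aa Q" "aa R"
  shows "aa (\<lambda>n v. Q n v \<and> R n v)"
proof (rule aa_sum_le[OF assms])
  fix n
  have "{v \<in> V n. \<not> (Q n v \<and> R n v)} = {v \<in> V n. \<not> Q n v} \<union> {v \<in> V n. \<not> R n v}" by auto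
  then show "card {v \<in> V n. \<not> (Q n v \<and> R n v)} \<le> card {v \<in> V n. \<not> Q n v} + card {v \<in> V n. \<not> R n v}"
    by (simp only: card_Un_le)
qed

lemma aa_True: "aa (\<lambda>n v. True)"
  unfolding aa_def by simp

lemma aa_ball: "finite I \<Longrightarrow> (\<And>i. i \<in> I \<Longrightarrow> aa (Q i)) \<Longrightarrow> aa (\<lambda>n v. \<forall>i\<in>I. Q i n v)"
proof (induction rule: finite_induct)
  case empty
  then show ?case by (simp add: aa_True)
next
  case (insert i I)
  then have "aa (\<lambda>n v. Q i n v \<and> (\<forall>i\<in>I. Q i n v))" by (intro aa_conj) auto
  then show ?case by simp
qed

definition good :: "nat \<Rightarrow> nat \<Rightarrow> 'v \<Rightarrow> bool" where
  "good r n v \<longleftrightarrow> rooted_iso (lball (G n) v r) v (lball (cayley_graph \<Gamma> S) \<one> r) \<one>"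

lemma aa_good: "aa (good r)"
proof -
  have "(\<lambda>n. 1 - real (card {v \<in> V n. good r n v}) / real (card (V n))) \<longlonglongrightarrow> 1 - 1"
    using sofic unfolding sofic_approximation_def good_def by (intro tendsto_intros) auto
  moreover have "\<forall>\<^sub>F n in sequentially. 1 - real (card {v \<in> V n. good r n v}) / real (card (V n))
      = real (card {v \<in> V n. \<not> good r n v}) / real (card (V n))"
    using eventually_card_pos
  proof eventually_elim
    case (elim n)
    have "card (V n) = card {v \<in> V n. good r n v} + card {v \<in> V n. \<not> good r n v}"
      by (subst card_Un_disjoint[symmetric]) (auto intro: arg_cong[where f=card])
    then have "real (card (V n)) = real (card {v \<in> V n. good r n v}) + real (card {v \<in> V n. \<not> good r n v})"
      by linarith
    then show ?case using elim by (simp add: field_simps)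
  qed
  ultimately show ?thesis unfolding aa_def using Lim_transform_eventually by force
qed

lemma cayley_gdist: "w \<in> lists S \<Longrightarrow> gdist (underlying_edges (cayley_graph \<Gamma> S)) \<one> (word_prod w) \<le> enat (length w)"
proof (induction w rule: rev_induct)
  case (snoc s w)
  let ?E = "underlying_edges (cayley_graph \<Gamma> S)"
  have s: "s \<in> S" "w \<in> lists S" using snoc.prems by auto
  have eq: "word_prod (w @ [s]) = word_prod w \<otimes> s" using s S_carrier by (subst word_prod_append) auto
  have "gdist ?E (word_prod w) (word_prod w \<otimes> s) \<le> enat 1"
  proof (cases "word_prod w = word_prod w \<otimes> s")
    case False
    have "(word_prod w, s, word_prod w \<otimes> s) \<in> larcs (cayley_graph \<Gamma> S)"
      using s by (auto simp: cayley_graph_def)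
    with False have "{word_prod w, word_prod w \<otimes> s} \<in> ?E" unfolding underlying_edges_def by blast
    then show ?thesis by (rule gdist_edge)
  qed (simp add: zero_enat_def[symmetric])
  from gdist_trans[OF snoc.IH[OF s(2)] this] show ?case by (simp add: eq)
qed (simp add: zero_enat_def[symmetric])

text \<open>The ball isomorphism turns each arc of the walk into multiplication by its label. A walk
  of length at most \<open>r\<close> never leaves the ball, so the induction has the isomorphism
  available at every step.\<close>

lemma good_walk:
  assumes v: "v \<in> V n" and f: "bij_betw f (lverts (lball (G n) v r)) (lverts (lball (cayley_graph \<Gamma> S) \<one> r))"
      "f v = \<one>"
    and iso: "\<And>x y s. x \<in> lverts (lball (G n) v r) \<Longrightarrow> y \<in> lverts (lball (G n) v r) \<Longrightarrow>
       (x, s, y) \<in> larcs (lball (G n) v r) \<longleftrightarrow> (f x, s, f y) \<in> larcs (lball (cayley_graph \<Gamma> S) \<one> r)"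
    and w: "w \<in> lists S" "length w \<le> r"
  shows "f (walk (A n) v w) = word_prod w"
  using w
proof (induction w rule: rev_induct)
  case Nil
  then show ?case using f by simp
next
  case (snoc s w)
  let ?C = "cayley_graph \<Gamma> S"
  let ?u = "walk (A n) v w"
  have s: "s \<in> S" "w \<in> lists S" and len: "Suc (length w) \<le> r" using snoc.prems by auto
  have IH: "f ?u = word_prod w" using snoc by auto
  have eq: "word_prod (w @ [s]) = word_prod w \<otimes> s" using s S_carrier by (subst word_prod_append) auto
  have B1: "lverts (lball (G n) v r) = {u \<in> V n. gdist (E n) v u \<le> enat r}"
    and A1: "larcs (lball (G n) v r) = A n \<inter> lverts (lball (G n) v r) \<times> UNIV \<times> lverts (lball (G n) v r)"
    by (auto simp: lball_def Let_def)
  have B2: "lverts (lball ?C \<one> r) = {u \<in> carrier \<Gamma>. gdist (underlying_edges ?C) \<one> u \<le> enat r}"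
    and A2: "larcs (lball ?C \<one> r) = larcs ?C \<inter> lverts (lball ?C \<one> r) \<times> UNIV \<times> lverts (lball ?C \<one> r)"
    by (auto simp: lball_def Let_def cayley_graph_def)
  have du: "gdist (E n) v ?u \<le> enat (length w)" by (rule gdist_walk)
  have u: "?u \<in> lverts (lball (G n) v r)"
    unfolding B1 using du len walk_in_V[OF v] by (auto intro: order_trans)
  \<comment> \<open>The product of the longer word still lies within distance \<open>r\<close>,
    hence has a preimage in the ball of \<open>G n\<close>; that preimage is where the walk must go
    next.\<close>
  have t: "word_prod w \<otimes> s \<in> lverts (lball ?C \<one> r)"
    unfolding B2 eq[symmetric] using cayley_gdist[of "w @ [s]"] snoc.prems
    by (auto intro: order_trans)
  then obtain u' where u': "u' \<in> lverts (lball (G n) v r)" "f u' = word_prod w \<otimes> s"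
    using f(1) by (metis bij_betw_imp_surj_on imageE)
  have ga: "(f ?u, s, f u') \<in> larcs (lball ?C \<one> r)"
  proof -
    have "word_prod w \<in> lverts (lball ?C \<one> r)"
      using bij_betwE[OF f(1)] u unfolding IH[symmetric] by blast
    moreover have "(word_prod w, s, word_prod w \<otimes> s) \<in> larcs ?C"
      using s by (auto simp: cayley_graph_def)
    ultimately show ?thesis unfolding A2 IH u'(2) using t by blast
  qed
  then have arc: "(?u, s, u') \<in> A n" using iso[OF u u'(1)] A1 by auto
  \<comment> \<open>Any other arc with label \<open>s\<close> also ends inside the ball, and in the
    Cayley graph the label determines the end. So the choice made by \<open>walk\<close> is
    forced.\<close>
  have "u'' = u'" if "(?u, s, u'') \<in> A n" for u''
  proof -
    have "gdist (E n) ?u u'' \<le> enat 1"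
    proof (cases "?u = u''")
      case False
      with that have "{?u, u''} \<in> E n" unfolding underlying_edges_def by blast
      then show ?thesis by (rule gdist_edge)
    qed (simp add: zero_enat_def[symmetric])
    from gdist_trans[OF du this] have "gdist (E n) v u'' \<le> enat r"
      using len by (auto intro: order_trans)
    moreover have "u'' \<in> V n" using that arcs_sub by auto
    ultimately have u'': "u'' \<in> lverts (lball (G n) v r)" by (simp add: B1)
    then have "(f ?u, s, f u'') \<in> larcs ?C" using iso[OF u u''] that u A1 A2 by auto
    then have "f u'' = f u'" using u' IH by (auto simp: cayley_graph_def)
    then show ?thesis using f(1) u' u'' by (auto simp: bij_betw_def inj_on_def)
  qed
  then have "walk (A n) ?u [s] = u'" by (rule walk_single_unique[OF arc])
  then show ?case using u' by (simp add: walk_append eq del: walk.simps(2))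
qed

text \<open>Injectivity of the ball isomorphism gives both halves of what a free action needs: words
  with equal products end at the same vertex (the group laws), and words with different products at
  different vertices (freeness).\<close>

lemma good_walk_eq_iff:
  assumes v: "v \<in> V n" and g: "good r n v" and a: "a \<in> lists S" "length a \<le> r" and b: "b \<in> lists S" "length b \<le> r"
  shows "walk (A n) v a = walk (A n) v b \<longleftrightarrow> word_prod a = word_prod b"
proof -
  obtain f where f: "bij_betw f (lverts (lball (G n) v r)) (lverts (lball (cayley_graph \<Gamma> S) \<one> r))" "f v = \<one>"
    and iso: "\<And>x y s. x \<in> lverts (lball (G n) v r) \<Longrightarrow> y \<in> lverts (lball (G n) v r) \<Longrightarrow>
       (x, s, y) \<in> larcs (lball (G n) v r) \<longleftrightarrow> (f x, s, f y) \<in> larcs (lball (cayley_graph \<Gamma> S) \<one> r)"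
    using g unfolding good_def rooted_iso_def by blast
  have B: "walk (A n) v w \<in> lverts (lball (G n) v r)" if "length w \<le> r" for w
    using walk_in_V[OF v, of w] gdist_walk[of n v w] that by (auto simp: lball_def Let_def intro: order_trans)
  have "f (walk (A n) v a) = f (walk (A n) v b) \<longleftrightarrow> word_prod a = word_prod b"
    using good_walk[OF v f iso a] good_walk[OF v f iso b] by simp
  moreover have "f (walk (A n) v a) = f (walk (A n) v b) \<longleftrightarrow> walk (A n) v a = walk (A n) v b"
    using f(1) B a b by (auto simp: bij_betw_def dest: inj_onD)
  ultimately show ?thesis by simp
qed

text \<open>An edge may come from an arc in either direction. An incoming arc with label
  \<open>s\<close> makes the neighbor correspond to \<open>inv s\<close>, which is again a
  generator.\<close>

lemma good_nbr:
  assumes v: "v \<in> V n" and g: "good 1 n v" and e: "{v, u} \<in> E n"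
  shows "\<exists>s\<in>S. u = walk (A n) v [s]"
proof -
  let ?C = "cayley_graph \<Gamma> S"
  obtain f where f: "bij_betw f (lverts (lball (G n) v 1)) (lverts (lball ?C \<one> 1))" "f v = \<one>"
    and iso: "\<And>x y s. x \<in> lverts (lball (G n) v 1) \<Longrightarrow> y \<in> lverts (lball (G n) v 1) \<Longrightarrow>
       (x, s, y) \<in> larcs (lball (G n) v 1) \<longleftrightarrow> (f x, s, f y) \<in> larcs (lball ?C \<one> 1)"
    using g unfolding good_def rooted_iso_def by blast
  have inB: "u \<in> lverts (lball (G n) v 1)" "v \<in> lverts (lball (G n) v 1)"
    using E_sub e v gdist_edge[OF e] by (auto simp: lball_def Let_def)
  obtain s where s: "(v, s, u) \<in> A n \<or> (u, s, v) \<in> A n"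
    using e unfolding underlying_edges_def by (auto simp: doubleton_eq_iff)
  have sS: "s \<in> S" using s arcs_sub by auto
  have "\<exists>s\<in>S. f u = s"
  proof (cases "(v, s, u) \<in> A n")
    case True
    then have "(f v, s, f u) \<in> larcs ?C" using iso[OF inB(2,1), of s] inB by (auto simp: lball_def Let_def)
    then show ?thesis using sS S_carrier by (auto simp: cayley_graph_def f)
  next
    case False
    then have "(u, s, v) \<in> A n" using s by simp
    then have "(f u, s, f v) \<in> larcs ?C" using iso[OF inB, of s] inB by (auto simp: lball_def Let_def)
    then have *: "f u \<in> carrier \<Gamma>" "f u \<otimes> s = \<one>" by (auto simp: cayley_graph_def f)
    then have "f u = inv s" using sS S_carrier by (metis inv_equality subsetD inv_inv)
    then show ?thesis using S_inv[OF sS] by auto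
  qed
  then obtain t where t: "t \<in> S" "f u = t" by auto
  have "f (walk (A n) v [t]) = word_prod [t]"
    by (rule good_walk[OF v f iso]) (use t in auto)
  then have "f (walk (A n) v [t]) = f u" using t S_carrier by (auto simp del: walk.simps(2))
  moreover have "walk (A n) v [t] \<in> lverts (lball (G n) v 1)"
    using walk_in_V[OF v, of "[t]"] gdist_walk[of n v "[t]"] by (simp add: lball_def Let_def del: walk.simps(2))
  ultimately have "walk (A n) v [t] = u" using f(1) inB by (auto simp: bij_betw_def simp del: walk.simps(2) dest: inj_onD)
  then show ?thesis using t by blast
qed

section \<open>The almost action of group elements\<close>

definition act :: "nat \<Rightarrow> 'v \<Rightarrow> 'g \<Rightarrow> 'v" where
  "act n v g = walk (A n) v (word g)"

lemma act_in_V [simp]: "v \<in> V n \<Longrightarrow> act n v g \<in> V n"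
  by (simp add: act_def walk_in_V)

lemma act_one [simp]: "act n v \<one> = v"
  by (simp add: act_def)

lemma gdist_act: "gdist (E n) v (act n v g) \<le> enat (length (word g))"
  unfolding act_def by (rule gdist_walk)

lemma aa_walk_eq_iff:
  assumes "a \<in> lists S" "b \<in> lists S"
  shows "aa (\<lambda>n v. walk (A n) v a = walk (A n) v b \<longleftrightarrow> word_prod a = word_prod b)"
  by (rule aa_mono[OF aa_good[of "max (length a) (length b)"]])
    (rule good_walk_eq_iff, use assms in auto)

lemma aa_act_assoc:
  assumes "g \<in> carrier \<Gamma>" "h \<in> carrier \<Gamma>"
  shows "aa (\<lambda>n v. act n (act n v g) h = act n v (g \<otimes> h))"
proof -
  have "aa (\<lambda>n v. walk (A n) v (word g @ word h) = walk (A n) v (word (g \<otimes> h)) \<longleftrightarrow>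
     word_prod (word g @ word h) = word_prod (word (g \<otimes> h)))"
    using assms by (intro aa_walk_eq_iff) (auto simp: word)
  then show ?thesis using assms by (simp add: word_prod_append word act_def walk_append)
qed

lemma aa_act_neq:
  assumes "g \<in> carrier \<Gamma>" "h \<in> carrier \<Gamma>" "g \<noteq> h"
  shows "aa (\<lambda>n v. act n v g \<noteq> act n v h)"
proof -
  have "aa (\<lambda>n v. walk (A n) v (word g) = walk (A n) v (word h) \<longleftrightarrow> word_prod (word g) = word_prod (word h))"
    using assms by (intro aa_walk_eq_iff) (auto simp: word)
  then show ?thesis using assms by (simp add: word act_def)
qed

lemma aa_act_inj:
  assumes "finite K" "K \<subseteq> carrier \<Gamma>"
  shows "aa (\<lambda>n v. inj_on (act n v) K)"
proof -
  have "aa (\<lambda>n v. \<forall>p\<in>{(g, h). g \<in> K \<and> h \<in> K \<and> g \<noteq> h}. act n v (fst p) \<noteq> act n v (snd p))"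
    using assms
    by (intro aa_ball aa_act_neq) (auto intro: finite_subset[of _ "K \<times> K"])
  then show ?thesis by (rule aa_mono) (auto simp: inj_on_def)
qed

lemma aa_nbr: "aa (\<lambda>n v. \<forall>u. {v, u} \<in> E n \<longrightarrow> (\<exists>s\<in>S. u = act n v s))"
proof -
  have "aa (\<lambda>n v. walk (A n) v [s] = walk (A n) v (word s) \<longleftrightarrow> word_prod [s] = word_prod (word s))"
    if "s \<in> S" for s
    using that S_carrier word(1)[of s] by (intro aa_walk_eq_iff) auto
  moreover have "word_prod [s] = word_prod (word s)" if "s \<in> S" for s
    using that S_carrier word(2)[of s] by auto
  ultimately have "aa (\<lambda>n v. walk (A n) v [s] = act n v s)" if "s \<in> S" for s
    unfolding act_def using that by fastforce
  then have "aa (\<lambda>n v. good 1 n v \<and> (\<forall>s\<in>S. walk (A n) v [s] = act n v s))"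
    using finite_S by (intro aa_conj aa_ball aa_good)
  then show ?thesis by (rule aa_mono) (metis good_nbr)
qed

text \<open>Where acting by \<open>g\<close> and then by \<open>inv g\<close> returns to
  \<open>v\<close>, acting by \<open>g\<close> is injective, so the preimage of the exceptional set
  is no larger than that set.\<close>

lemma aa_translate:
  assumes Q: "aa Q" and g: "g \<in> carrier \<Gamma>"
  shows "aa (\<lambda>n v. Q n (act n v g))"
proof (rule aa_sum_le[OF Q])
  show "aa (\<lambda>n v. act n (act n v g) (inv g) = v)"
    using aa_act_assoc[OF g inv_closed[OF g]] g by simp
  fix n
  let ?W = "{v \<in> V n. act n (act n v g) (inv g) = v}"
  have "card {v \<in> ?W. \<not> Q n (act n v g)} \<le> card {v \<in> V n. \<not> Q n v}"
    by (rule card_inj_on_le[of "\<lambda>v. act n v g"])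
      (auto intro: inj_on_inverseI[of _ "\<lambda>v. act n v (inv g)"])
  moreover have "{v \<in> V n. \<not> Q n (act n v g)} \<subseteq> {v \<in> ?W. \<not> Q n (act n v g)} \<union> {v \<in> V n. act n (act n v g) (inv g) \<noteq> v}"
    by auto
  then have "card {v \<in> V n. \<not> Q n (act n v g)} \<le> card ({v \<in> ?W. \<not> Q n (act n v g)} \<union> {v \<in> V n. act n (act n v g) (inv g) \<noteq> v})"
    by (intro card_mono) auto
  ultimately show "card {v \<in> V n. \<not> Q n (act n v g)}
     \<le> card {v \<in> V n. \<not> Q n v} + card {v \<in> V n. act n (act n v g) (inv g) \<noteq> v}"
    using card_Un_le[of "{v \<in> ?W. \<not> Q n (act n v g)}" "{v \<in> V n. act n (act n v g) (inv g) \<noteq> v}"] by linarith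
qed

text \<open>The last step of a path starts at a translate of \<open>v\<close> by an element of the
  smaller ball. \<open>aa_nbr\<close>, translated to these finitely many elements, names that step
  by a generator, and associativity absorbs it.\<close>

lemma aa_dist_le:
  "aa (\<lambda>n v. \<forall>u. gdist (E n) v u \<le> enat m \<longrightarrow> (\<exists>h\<in>cball m. u = act n v h))"
proof (induction m)
  case 0
  show ?case
    by (rule aa_mono[OF aa_True]) (auto simp: gdist_le_iff)
next
  case (Suc m)
  have "aa (\<lambda>n v. (\<forall>u. gdist (E n) v u \<le> enat m \<longrightarrow> (\<exists>h\<in>cball m. u = act n v h)) \<and>
     (\<forall>h\<in>cball m. \<forall>u. {act n v h, u} \<in> E n \<longrightarrow> (\<exists>s\<in>S. u = act n (act n v h) s)) \<and>
     (\<forall>h\<in>cball m. \<forall>s\<in>S. act n (act n v h) s = act n v (h \<otimes> s)))"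
    using cball_carrier S_carrier finite_S
    by (intro aa_conj Suc.IH aa_ball aa_translate[OF aa_nbr] aa_act_assoc) auto
  then show ?case
  proof (rule aa_mono, intro allI impI)
    fix n v u
    assume *: "(\<forall>u. gdist (E n) v u \<le> enat m \<longrightarrow> (\<exists>h\<in>cball m. u = act n v h)) \<and>
     (\<forall>h\<in>cball m. \<forall>u. {act n v h, u} \<in> E n \<longrightarrow> (\<exists>s\<in>S. u = act n (act n v h) s)) \<and>
     (\<forall>h\<in>cball m. \<forall>s\<in>S. act n (act n v h) s = act n v (h \<otimes> s))"
    assume "gdist (E n) v u \<le> enat (Suc m)"
    then obtain j where j: "j \<le> Suc m" "((\<lambda>u v. {u, v} \<in> E n) ^^ j) v u" unfolding gdist_le_iff by blast
    show "\<exists>h\<in>cball (Suc m). u = act n v h"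
    proof (cases "j \<le> m")
      case True
      then have "gdist (E n) v u \<le> enat m" using j unfolding gdist_le_iff by blast
      then show ?thesis using * by fastforce
    next
      case False
      then have "j = Suc m" using j by simp
      then obtain z where z: "((\<lambda>u v. {u, v} \<in> E n) ^^ m) v z" "{z, u} \<in> E n" using j by auto
      then have "gdist (E n) v z \<le> enat m" unfolding gdist_le_iff by blast
      then obtain h where h: "h \<in> cball m" "z = act n v h" using * by blast
      then obtain s where "s \<in> S" "u = act n (act n v h) s" using * z by blast
      then have "u = act n v (h \<otimes> s)" "h \<otimes> s \<in> cball (Suc m)" using h * by auto
      then show ?thesis by blast
    qed
  qed
qed

lemma degree_bound: "\<exists>D. \<forall>n. \<forall>v\<in>V n. card {e \<in> E n. v \<in> e} \<le> D"
proof -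
  obtain D where D: "\<And>n v. v \<in> V n \<Longrightarrow> ldegree (G n) v \<le> D"
    using sofic unfolding sofic_approximation_def by blast
  have "card {e \<in> E n. v \<in> e} \<le> ldegree (G n) v" for n v
    unfolding ldegree_def
  proof (rule surj_card_le[where f="\<lambda>(x, s, y). {x, y}"])
    show "finite {(x, s, y). (x, s, y) \<in> A n \<and> (x = v \<or> y = v)}"
      by (rule finite_subset[OF _ finite_A[of n]]) auto
    show "{e \<in> E n. v \<in> e} \<subseteq> (\<lambda>(x, s, y). {x, y}) ` {(x, s, y). (x, s, y) \<in> A n \<and> (x = v \<or> y = v)}"
      unfolding underlying_edges_def by (force simp: image_iff)
  qed
  then show ?thesis using D by (meson order_trans)
qed

end

section \<open>Bernoulli actions\<close>

abbreviation unif :: "real measure" where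
  "unif \<equiv> uniform_measure lborel {0..1}"

abbreviation iid :: "('i \<Rightarrow> real) measure" where
  "iid \<equiv> PiM UNIV (\<lambda>_. unif)"

lemma prob_space_unif: "prob_space unif"
  by (rule prob_space_uniform_measure) auto

lemma AE_unif_neq: "AE x in unif. x \<noteq> u"
  by (rule AE_uniform_measureI) (use AE_lborel_singleton[of u] in auto)

lemma prob_space_iid: "prob_space iid"
  by (rule prob_space_PiM) (rule prob_space_unif)

lemma sets_iid_PiM: "sets iid = sets (PiM UNIV (\<lambda>_. borel))"
  by (rule sets_PiM_cong) auto

lemma sets_iid: "sets (iid :: ('i::countable \<Rightarrow> real) measure) = sets borel"
  using sets_iid_PiM sets_PiM_equal_borel by blast

lemma space_iid [simp]: "space iid = UNIV"
  by (simp add: space_PiM)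

lemma measurable_iid_component [measurable]: "(\<lambda>x. x i) \<in> borel_measurable iid"
  using measurable_component_singleton[of i UNIV "\<lambda>_. unif"] by simp

lemma measurable_iid_reindex [measurable]: "(\<lambda>\<omega> i. \<omega> (t i)) \<in> iid \<rightarrow>\<^sub>M iid"
  by (rule measurable_PiM_single') (auto simp: space_PiM)

lemma distr_iid_reindex:
  assumes "inj t"
  shows "distr iid iid (\<lambda>\<omega> i. \<omega> (t i)) = iid"
  using distr_PiM_reindex[of UNIV "\<lambda>_. unif" t UNIV] prob_space_unif assms
  by (simp add: restrict_UNIV)

text \<open>Coordinate \<open>i\<close> is independent of the others and its law has no atoms; given
  the others, it almost surely avoids the value at \<open>j\<close>.\<close>

lemma AE_iid_neq:
  assumes "i \<noteq> j"
  shows "AE x in iid. x i \<noteq> x j"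
proof -
  let ?I = "UNIV - {i}"
  let ?P = "PiM ?I (\<lambda>_. unif)"
  interpret U: prob_space unif by (rule prob_space_unif)
  interpret P: product_prob_space "\<lambda>_. unif" ?I ..
  interpret UP: pair_prob_space unif ?P ..
  have ins: "insert i ?I = UNIV" by auto
  have "distr (unif \<Otimes>\<^sub>M ?P) (PiM (insert i ?I) (\<lambda>_. unif)) (\<lambda>(x, X). X(i := x)) = PiM (insert i ?I) (\<lambda>_. unif)"
    by (rule distr_pair_PiM_eq_PiM) (rule prob_space_unif)+
  then have d: "distr (unif \<Otimes>\<^sub>M ?P) iid (\<lambda>(x, X). X(i := x)) = iid" unfolding ins .
  have jI: "j \<in> ?I" using assms by auto
  have "measurable ?P unif = borel_measurable ?P"
    by (rule measurable_cong_sets) simp_all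
  with measurable_component_singleton[OF jI, of "\<lambda>_. unif"]
  have mj: "(\<lambda>X. X j) \<in> borel_measurable ?P" by blast
  have "AE p in unif \<Otimes>\<^sub>M ?P. fst p \<noteq> snd p j"
  proof (rule UP.AE_pair_measure)
    have "measurable (unif \<Otimes>\<^sub>M ?P) unif = borel_measurable (unif \<Otimes>\<^sub>M ?P)"
      by (rule measurable_cong_sets) simp_all
    with measurable_fst[of unif ?P]
    have f: "fst \<in> borel_measurable (unif \<Otimes>\<^sub>M ?P)" by blast
    have g: "(\<lambda>p. snd p j) \<in> borel_measurable (unif \<Otimes>\<^sub>M ?P)"
      by (rule measurable_compose[OF measurable_snd mj])
    show "{p \<in> space (unif \<Otimes>\<^sub>M ?P). fst p \<noteq> snd p j} \<in> sets (unif \<Otimes>\<^sub>M ?P)"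
      using f g by (rule borel_measurable_neq)
    show "AE x in unif. AE y in ?P. fst (x, y) \<noteq> snd (x, y) j"
    proof (rule AE_I2)
      fix x :: real
      have "AE y in unif. y \<noteq> x" by (rule AE_unif_neq)
      from P.AE_component[OF jI this] show "AE y in ?P. fst (x, y) \<noteq> snd (x, y) j"
        by eventually_elim auto
    qed
  qed
  then have ae: "AE p in unif \<Otimes>\<^sub>M ?P. (case p of (x, X) \<Rightarrow> X(i := x)) i \<noteq> (case p of (x, X) \<Rightarrow> X(i := x)) j"
  proof eventually_elim
    case (elim p)
    show ?case using elim assms by (cases p) simp
  qed
  have "(\<lambda>p. (snd p)(i := fst p)) \<in> unif \<Otimes>\<^sub>M ?P \<rightarrow>\<^sub>M PiM (insert i ?I) (\<lambda>_. unif)"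
    by (rule measurable_fun_upd[OF _ measurable_snd measurable_fst]) blast
  then have m: "(\<lambda>(x, X). X(i := x)) \<in> unif \<Otimes>\<^sub>M ?P \<rightarrow>\<^sub>M iid"
    unfolding ins case_prod_beta' .
  have "{x \<in> space iid. x i \<noteq> x j} \<in> sets iid"
    by (rule borel_measurable_neq) (rule measurable_iid_component)+
  from AE_distr_iff[OF m this] ae
  have "AE x in distr (unif \<Otimes>\<^sub>M ?P) iid (\<lambda>(x, X). X(i := x)). x i \<noteq> x j" by blast
  then show ?thesis unfolding d .
qed

text \<open>The set depends on the coordinates in \<open>J\<close> alone; it need not be a product
  set. The value type is left open because real labels and bits both occur.\<close>

definition cylinder :: "'i set \<Rightarrow> ('i \<Rightarrow> 'a) set \<Rightarrow> bool" where
  "cylinder J B \<longleftrightarrow> (\<forall>x y. (\<forall>i\<in>J. x i = y i) \<longrightarrow> (x \<in> B \<longleftrightarrow> y \<in> B))"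

lemma cylinderD: "cylinder J B \<Longrightarrow> (\<And>i. i \<in> J \<Longrightarrow> x i = y i) \<Longrightarrow> x \<in> B \<longleftrightarrow> y \<in> B"
  unfolding cylinder_def by blast

lemma cylinder_mono: "cylinder J B \<Longrightarrow> J \<subseteq> K \<Longrightarrow> cylinder K B"
  unfolding cylinder_def by blast

text \<open>The sets that can be approximated form a sigma-algebra containing the generators. For a
  countable union one first truncates it and then approximates finitely many members.\<close>

lemma iid_approx_cylinder:
  assumes "A \<in> sets iid" and "\<delta> > 0"
  shows "\<exists>B\<in>sets iid. \<exists>J. finite J \<and> cylinder J B \<and> measure iid ((A - B) \<union> (B - A)) < \<delta>"
proof -
  interpret prob_space iid by (rule prob_space_iid)
  have "A \<in> sigma_sets (\<Pi>\<^sub>E i\<in>UNIV. space unif)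
      {{f \<in> \<Pi>\<^sub>E i\<in>UNIV. space unif. f i \<in> A} |i A. i \<in> UNIV \<and> A \<in> sets unif}"
    using assms(1) by (simp add: sets_PiM_single)
  then show ?thesis using assms(2)
  proof (induction arbitrary: \<delta>)
    case (Basic a)
    then obtain i X where a: "a = {f. f i \<in> X}" and X: "X \<in> sets borel" by auto
    have "a = (\<lambda>x. x i) -` X \<inter> space iid" by (auto simp: a)
    also have "\<dots> \<in> sets iid" using X by measurable
    finally show ?case using Basic.prems
      by (intro bexI[of _ a] exI[of _ "{i}"]) (auto simp: a cylinder_def)
  next
    case Empty
    then show ?case by (intro bexI[of _ "{}"] exI[of _ "{}"]) (auto simp: cylinder_def)
  next
    case (Compl a)
    have UN: "(\<Pi>\<^sub>E i\<in>UNIV. space unif) = UNIV" by (simp add: space_PiM)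
    from Compl.IH[OF Compl.prems] obtain B J where B: "B \<in> sets iid" "finite J" "cylinder J B"
      "measure iid ((a - B) \<union> (B - a)) < \<delta>" by blast
    have "((UNIV - a) - (UNIV - B)) \<union> ((UNIV - B) - (UNIV - a)) = (a - B) \<union> (B - a)" by auto
    moreover have "UNIV - B \<in> sets iid" using sets.compl_sets[OF B(1)] by simp
    ultimately show ?case unfolding UN using B
      by (intro bexI[of _ "UNIV - B"] exI[of _ J]) (auto simp: cylinder_def)
  next
    case (Union a)
    have a: "a k \<in> sets iid" for k using Union.hyps[of k] by (simp add: sets_PiM_single)
    define A where "A = (\<Union>k. a k)"
    have A: "A \<in> sets iid" using a by (auto simp: A_def)
    have "(\<lambda>N. measure iid (\<Union>k\<le>N. a k)) \<longlonglongrightarrow> measure iid (\<Union>N. \<Union>k\<le>N. a k)"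
      using a by (intro finite_Lim_measure_incseq) (force simp: incseq_def)+
    moreover have "(\<Union>N. \<Union>k\<le>N. a k) = A" by (auto simp: A_def)
    ultimately have "\<forall>\<^sub>F N in sequentially. measure iid A - \<delta> / 2 < measure iid (\<Union>k\<le>N. a k)"
      using Union.prems by (intro order_tendstoD) auto
    then obtain N where N: "measure iid A - \<delta> / 2 < measure iid (\<Union>k\<le>N. a k)"
      by (auto simp: eventually_sequentially)
    \<comment> \<open>Half of \<open>\<delta>\<close> pays for the truncation, and the other half is
      divided among the \<open>N + 1\<close> sets that remain.\<close>
    have "\<exists>B J. B \<in> sets iid \<and> finite J \<and> cylinder J B \<and> measure iid ((a k - B) \<union> (B - a k)) < \<delta> / (2 * (real N + 1))" for k
      using Union.IH[of "\<delta> / (2 * (real N + 1))" k] Union.prems by auto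
    then obtain B J where B: "\<And>k. B k \<in> sets iid" "\<And>k. finite (J k)" "\<And>k. cylinder (J k) (B k)"
      "\<And>k. measure iid ((a k - B k) \<union> (B k - a k)) < \<delta> / (2 * (real N + 1))" by metis
    define C where "C = (\<Union>k\<le>N. B k)"
    have C: "C \<in> sets iid" unfolding C_def using B(1) by auto
    have "measure iid ((A - C) \<union> (C - A)) \<le>
        measure iid ((A - (\<Union>k\<le>N. a k)) \<union> (\<Union>k\<le>N. (a k - B k) \<union> (B k - a k)))"
      using a B(1) A by (intro finite_measure_mono) (auto simp: A_def C_def)
    also have "\<dots> \<le> measure iid (A - (\<Union>k\<le>N. a k)) + measure iid (\<Union>k\<le>N. (a k - B k) \<union> (B k - a k))"
      using a B(1) A by (intro measure_Un_le) auto
    also have "measure iid (A - (\<Union>k\<le>N. a k)) = measure iid A - measure iid (\<Union>k\<le>N. a k)"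
      using a A by (intro finite_measure_Diff) (auto simp: A_def)
    also have "measure iid (\<Union>k\<le>N. (a k - B k) \<union> (B k - a k)) \<le> (\<Sum>k\<le>N. measure iid ((a k - B k) \<union> (B k - a k)))"
      using a B(1) by (intro finite_measure_subadditive_finite) auto
    also have "\<dots> \<le> (\<Sum>k\<le>N. \<delta> / (2 * (real N + 1)))"
      using B(4) by (intro sum_mono less_imp_le)
    also have "\<dots> = \<delta> / 2" by (simp add: field_simps)
    finally have "measure iid ((A - C) \<union> (C - A)) < \<delta>" using N by linarith
    moreover have "cylinder (\<Union>k\<le>N. J k) C"
    proof -
      have "x \<in> B k \<longleftrightarrow> y \<in> B k" if "k \<le> N" "\<forall>i\<in>(\<Union>k\<le>N. J k). x i = y i" for x y k
        by (rule cylinderD[OF B(3)[of k]]) (use that in blast)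
      then show ?thesis unfolding C_def cylinder_def by blast
    qed
    ultimately show ?case using C B(2) unfolding A_def
      by (intro bexI[of _ C] exI[of _ "\<Union>k\<le>N. J k"]) auto
  qed
qed

text \<open>The reading map \<open>t\<close> is injective only on \<open>J\<close>. The right
  summand of the index type supplies fresh labels for the other coordinates, which extends
  \<open>t\<close> to an injective map without affecting the event.\<close>

lemma iid_law_cylinder:
  assumes B: "B \<in> sets iid" and J: "cylinder J B" and inj: "inj_on t J"
  shows "measure iid {\<omega>. (\<lambda>i. \<omega> (Inl (t i) :: 'k + 'i)) \<in> B} = measure iid (B :: ('i \<Rightarrow> real) set)"
proof -
  define t' :: "'i \<Rightarrow> 'k + 'i" where "t' i = (if i \<in> J then Inl (t i) else Inr i)" for i
  have "inj t'" using inj by (auto simp: inj_def t'_def inj_on_def split: if_splits)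
  have "measure iid {\<omega>. (\<lambda>i. \<omega> (Inl (t i) :: 'k + 'i)) \<in> B} = measure iid ((\<lambda>\<omega> i. \<omega> (t' i)) -` B \<inter> space iid)"
  proof -
    have "(\<lambda>i. \<omega> (Inl (t i))) \<in> B \<longleftrightarrow> (\<lambda>i. \<omega> (t' i)) \<in> B" for \<omega> :: "'k + 'i \<Rightarrow> real"
      by (rule cylinderD[OF J]) (simp add: t'_def)
    then show ?thesis by (simp add: vimage_def)
  qed
  also have "\<dots> = measure (distr iid iid (\<lambda>\<omega> i. \<omega> (t' i))) B"
    using B by (intro measure_distr[symmetric]) auto
  finally show ?thesis by (simp add: distr_iid_reindex[OF \<open>inj t'\<close>])
qed

text \<open>Walks compose on the right, while \<open>pmp_action\<close> speaks of left actions.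
  \<open>lact\<close> passes to inverses, which changes neither orbits nor triviality of
  stabilizers.\<close>

locale right_action = group \<Gamma> for \<Gamma> :: "('g, 'm) monoid_scheme" (structure) +
  fixes R :: "'x \<Rightarrow> 'g \<Rightarrow> 'x"
  assumes R_one [simp]: "R x \<one> = x"
    and R_mult: "\<lbrakk>g \<in> carrier \<Gamma>; h \<in> carrier \<Gamma>\<rbrakk> \<Longrightarrow> R (R x g) h = R x (g \<otimes> h)"
begin

definition lact :: "'g \<Rightarrow> 'x \<Rightarrow> 'x" where
  "lact g x = R x (inv g)"

lemma R_inv [simp]: "g \<in> carrier \<Gamma> \<Longrightarrow> R (R x g) (inv g) = x" "g \<in> carrier \<Gamma> \<Longrightarrow> R (R x (inv g)) g = x"
  by (simp_all add: R_mult)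

lemma group_action_lact: "group_action \<Gamma> UNIV lact"
  unfolding group_action_def group_hom_def group_hom_axioms_def hom_def
proof (intro conjI is_group group_BijGroup CollectI Pi_I ballI)
  have bij: "bij (lact g)" if "g \<in> carrier \<Gamma>" for g
    by (rule bij_betw_byWitness[of _ "\<lambda>x. R x g"]) (use that in \<open>auto simp: lact_def\<close>)
  show "lact g \<in> carrier (BijGroup UNIV)" if "g \<in> carrier \<Gamma>" for g
    using bij[OF that] by (simp add: BijGroup_def Bij_def)
  show "lact (g \<otimes> h) = lact g \<otimes>\<^bsub>BijGroup UNIV\<^esub> lact h" if "g \<in> carrier \<Gamma>" "h \<in> carrier \<Gamma>" for g h
    using bij[OF that(1)] bij[OF that(2)] that
    by (auto simp: BijGroup_def Bij_def compose_def fun_eq_iff lact_def inv_mult_group R_mult)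
qed

lemma pmp_lact:
  assumes "space M = UNIV" and "\<And>g. g \<in> carrier \<Gamma> \<Longrightarrow> (\<lambda>x. R x g) \<in> M \<rightarrow>\<^sub>M M"
    and "\<And>g. g \<in> carrier \<Gamma> \<Longrightarrow> distr M M (\<lambda>x. R x g) = M"
  shows "pmp_action \<Gamma> M lact"
  unfolding pmp_action_def using group_action_lact assms by (simp add: lact_def[abs_def])

lemma orbit_lact: "orbit \<Gamma> lact x = {R x g |g. g \<in> carrier \<Gamma>}"
  unfolding orbit_def lact_def by (auto, metis inv_inv inv_closed)

lemma orbit_rel_lact: "space M = UNIV \<Longrightarrow> (x, y) \<in> orbit_rel \<Gamma> M lact \<longleftrightarrow> (\<exists>g\<in>carrier \<Gamma>. y = R x g)"
  unfolding orbit_rel_def orbit_lact by auto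

lemma stabilizer_lact: "stabilizer \<Gamma> lact x = {\<one>} \<longleftrightarrow> (\<forall>g\<in>carrier \<Gamma>. R x g = x \<longrightarrow> g = \<one>)"
proof -
  have "R x (inv g) = x \<longleftrightarrow> R x g = x" if "g \<in> carrier \<Gamma>" for g
    using R_inv[OF that, of x] by metis
  then show ?thesis unfolding stabilizer_def lact_def by auto
qed

end

context marked_group
begin

text \<open>The component \<open>nat\<close> makes the index set infinite, hence in bijection with all of
  \<open>nat\<close>, even if the group is finite.\<close>

definition idx :: "'g \<times> nat \<Rightarrow> nat" where
  "idx = to_nat_on (carrier \<Gamma> \<times> UNIV)"

definition pos :: "nat \<Rightarrow> 'g" where
  "pos i = fst (from_nat_into (carrier \<Gamma> \<times> (UNIV :: nat set)) i)"

definition tag :: "nat \<Rightarrow> nat" where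
  "tag i = snd (from_nat_into (carrier \<Gamma> \<times> (UNIV :: nat set)) i)"

lemma countable_index: "countable (carrier \<Gamma> \<times> (UNIV :: nat set))"
  using countable_carrier by (intro countable_SIGMA) auto

lemma infinite_index: "infinite (carrier \<Gamma> \<times> (UNIV :: nat set))"
  using one_closed by (auto simp: finite_cartesian_product_iff)

lemma pos_carrier [simp]: "pos i \<in> carrier \<Gamma>"
  using from_nat_into[of "carrier \<Gamma> \<times> (UNIV :: nat set)" i] one_closed
  unfolding pos_def by (metis UNIV_I SigmaE2 SigmaI empty_iff mem_Sigma_iff prod.collapse)

lemma idx_pos_tag [simp]: "idx (pos i, tag i) = i"
  using countable_index infinite_index unfolding idx_def pos_def tag_def
  by (simp add: to_nat_on_from_nat_into_infinite)

lemma pos_idx [simp]: "g \<in> carrier \<Gamma> \<Longrightarrow> pos (idx (g, k)) = g"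
  and tag_idx [simp]: "g \<in> carrier \<Gamma> \<Longrightarrow> tag (idx (g, k)) = k"
  using countable_index unfolding idx_def pos_def tag_def by simp_all

definition shift :: "'g \<Rightarrow> nat \<Rightarrow> nat" where
  "shift g i = idx (g \<otimes> pos i, tag i)"

lemma pos_shift [simp]: "g \<in> carrier \<Gamma> \<Longrightarrow> pos (shift g i) = g \<otimes> pos i"
  and tag_shift [simp]: "g \<in> carrier \<Gamma> \<Longrightarrow> tag (shift g i) = tag i"
  unfolding shift_def by simp_all

lemma shift_one [simp]: "shift \<one> i = i"
  unfolding shift_def by simp

lemma shift_shift: "g \<in> carrier \<Gamma> \<Longrightarrow> h \<in> carrier \<Gamma> \<Longrightarrow> shift g (shift h i) = shift (g \<otimes> h) i"
  unfolding shift_def by (simp add: m_assoc)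

lemma inj_shift: "g \<in> carrier \<Gamma> \<Longrightarrow> inj (shift g)"
  by (rule inj_on_inverseI[of _ "shift (inv g)"]) (simp add: shift_shift)

text \<open>Tag 0 is singled out to represent the group element itself; pairs of nodes will index
  the possible edges of a graph on the group.\<close>

definition node :: "'g \<Rightarrow> nat" where
  "node g = idx (g, 0)"

lemma pos_node [simp]: "g \<in> carrier \<Gamma> \<Longrightarrow> pos (node g) = g"
  by (simp add: node_def)

lemma shift_node [simp]: "g \<in> carrier \<Gamma> \<Longrightarrow> h \<in> carrier \<Gamma> \<Longrightarrow> shift g (node h) = node (g \<otimes> h)"
  by (simp add: shift_def node_def)

text \<open>Left translation of the indices acts contravariantly on labelings, so this is a right
  action, as is the almost action on vertices.\<close>

definition bern :: "(nat \<Rightarrow> real) \<Rightarrow> 'g \<Rightarrow> (nat \<Rightarrow> real)" where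
  "bern x g = (\<lambda>i. x (shift g i))"

sublocale bern: right_action \<Gamma> bern
  by unfold_locales (auto simp: bern_def shift_shift)

lemma measurable_bern [measurable]: "(\<lambda>x. bern x g) \<in> iid \<rightarrow>\<^sub>M iid"
  unfolding bern_def by measurable

lemma distr_bern: "g \<in> carrier \<Gamma> \<Longrightarrow> distr iid iid (\<lambda>x. bern x g) = iid"
  unfolding bern_def by (rule distr_iid_reindex[OF inj_shift])

text \<open>A nontrivial \<open>g\<close> fixing \<open>x\<close> would force equal labels at the
  nodes of the identity and of \<open>g\<close>. The group is countable, so one null set serves for
  all \<open>g\<close>.\<close>

lemma AE_bern_free: "AE x in iid. \<forall>g\<in>carrier \<Gamma>. bern x g = x \<longrightarrow> g = \<one>"
proof -
  have "AE x in iid. bern x g = x \<longrightarrow> g = \<one>" if g: "g \<in> carrier \<Gamma>" for g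
  proof (cases "g = \<one>")
    case False
    then have "node \<one> \<noteq> node g" using g by (metis pos_node one_closed)
    from AE_iid_neq[OF this] show ?thesis
    proof eventually_elim
      case (elim x)
      have "bern x g (node \<one>) = x (node g)" using g by (simp add: bern_def)
      with elim show ?case by auto
    qed
  qed simp
  then show ?thesis using countable_carrier by (subst AE_ball_countable) auto
qed

lemma bern_pmp: "pmp_action \<Gamma> iid bern.lact"
  by (rule bern.pmp_lact[OF space_iid measurable_bern distr_bern])

lemma bern_essentially_free: "essentially_free \<Gamma> iid bern.lact"
  unfolding essentially_free_def bern.stabilizer_lact by (rule AE_bern_free)

lemma bern_action_cost:
  assumes "fixed_price \<Gamma> c"
  shows "action_cost \<Gamma> iid bern.lact = c"
proof -
  obtain f :: "(nat \<Rightarrow> real) \<Rightarrow> real" where "bij f" using ex_bij_fun_reals by blast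
  from action_cost_eq_fixed_price[OF assms is_group this sets_iid prob_space_iid bern_pmp bern_essentially_free]
  show ?thesis .
qed

end

lemma card_doubletons:
  assumes "finite H" "\<And>e. e \<in> H \<Longrightarrow> card e = 2"
  shows "card {(u, w). {u, w} \<in> H} = 2 * card H"
proof -
  have two: "card {(u, w). {u, w} = e} = 2 \<and> finite {(u, w). {u, w} = e}" if eH: "e \<in> H" for e
  proof -
    obtain a b where ab: "e = {a, b}" "a \<noteq> b" using assms(2)[OF eH] by (auto simp: card_2_iff)
    then have "{(u, w). {u, w} = e} = {(a, b), (b, a)}" by (auto simp: doubleton_eq_iff)
    with ab show ?thesis by simp
  qed
  have "{(u, w). {u, w} \<in> H} = (\<Union>e\<in>H. {(u, w). {u, w} = e})" by auto
  also have "card \<dots> = (\<Sum>e\<in>H. card {(u, w). {u, w} = e})"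
    using assms(1) two by (intro card_UN_disjoint) auto
  also have "\<dots> = 2 * card H" using two by simp
  finally show ?thesis .
qed

section \<open>Finite approximation of a cheap graphing of the Bernoulli action\<close>

context marked_group
begin

lemma word_prod_cball: "w \<in> lists S \<Longrightarrow> word_prod w \<in> cball (length w)"
proof (induction w rule: rev_induct)
  case (snoc s w)
  then have s: "s \<in> S" "w \<in> lists S" by auto
  have "word_prod (w @ [s]) = word_prod w \<otimes> s" using s S_carrier by (subst word_prod_append) auto
  then show ?case using snoc.IH[OF s(2)] s(1) by auto
qed simp

lemma Union_cball: "(\<Union>m. cball m) = carrier \<Gamma>"
proof
  show "carrier \<Gamma> \<subseteq> (\<Union>m. cball m)"
  proof
    fix g assume "g \<in> carrier \<Gamma>"
    then show "g \<in> (\<Union>m. cball m)" using word_prod_cball[of "word g"] by (auto simp: word)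
  qed
qed (use cball_carrier in blast)

text \<open>The part inside \<open>F\<close> of the graph that the events \<open>B\<close> draw on
  the orbit of \<open>x\<close>. An edge must be confirmed from both of its ends, so the graph stays
  symmetric when the events are replaced by approximations.\<close>

definition pattern :: "('g \<Rightarrow> (nat \<Rightarrow> real) set) \<Rightarrow> 'g set \<Rightarrow> (nat \<Rightarrow> real) \<Rightarrow> ('g \<times> 'g) set" where
  "pattern B F x = {(h, k). h \<in> F \<and> k \<in> F \<and> bern x h \<in> B (inv h \<otimes> k) \<and> bern x k \<in> B (inv k \<otimes> h)}"

text \<open>Paths are confined to \<open>F\<close>; hence the event depends on finitely many labels
  once each \<open>B\<close> does, and it grows with \<open>F\<close>.\<close>

definition conn :: "('g \<Rightarrow> (nat \<Rightarrow> real) set) \<Rightarrow> 'g set \<Rightarrow> 'g \<Rightarrow> (nat \<Rightarrow> real) set" where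
  "conn B F s = {x. (\<one>, s) \<in> (pattern B F x)\<^sup>*}"

lemma finite_pattern: "finite F \<Longrightarrow> finite (pattern B F x)"
  by (rule finite_subset[of _ "F \<times> F"]) (auto simp: pattern_def)

lemma pattern_mono: "F \<subseteq> F' \<Longrightarrow> pattern B F x \<subseteq> pattern B F' x"
  unfolding pattern_def by auto

lemma conn_mono: "F \<subseteq> F' \<Longrightarrow> conn B F s \<subseteq> conn B F' s"
  unfolding conn_def using rtrancl_mono[OF pattern_mono] by blast

lemma sets_bern_vimage: "B \<in> sets iid \<Longrightarrow> {x. bern x h \<in> B} \<in> sets iid"
  using measurable_sets[OF measurable_bern[of h]] by (simp add: vimage_def)

text \<open>A finite \<open>F\<close> carries finitely many patterns, and each pattern is prescribed
  by finitely many measurable conditions.\<close>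

lemma sets_conn:
  assumes F: "finite F" and B: "\<And>h k. h \<in> F \<Longrightarrow> k \<in> F \<Longrightarrow> B (inv h \<otimes> k) \<in> sets iid"
  shows "conn B F s \<in> sets iid"
proof -
  have eq: "{x. pattern B F x = T} = (\<Inter>p\<in>F \<times> F. {x. p \<in> pattern B F x \<longleftrightarrow> p \<in> T}) \<inter> (if T \<subseteq> F \<times> F then UNIV else {})" for T
    unfolding pattern_def by auto
  have one: "{x. p \<in> pattern B F x} \<in> sets iid" if pF: "p \<in> F \<times> F" for p
  proof -
    obtain h k where p: "p = (h, k)" "h \<in> F" "k \<in> F" using pF by auto
    have "{x. p \<in> pattern B F x} = {x. bern x h \<in> B (inv h \<otimes> k)} \<inter> {x. bern x k \<in> B (inv k \<otimes> h)}"
      using p by (auto simp: pattern_def)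
    also have "\<dots> \<in> sets iid"
      by (rule sets.Int[OF sets_bern_vimage[OF B[OF p(2,3)]] sets_bern_vimage[OF B[OF p(3,2)]]])
    finally show ?thesis .
  qed
  have "{x. p \<in> pattern B F x \<longleftrightarrow> p \<in> T} \<in> sets iid" if "p \<in> F \<times> F" for p T
  proof (cases "p \<in> T")
    case False
    then have "{x. p \<in> pattern B F x \<longleftrightarrow> p \<in> T} = space iid - {x. p \<in> pattern B F x}" by auto
    then show ?thesis using sets.compl_sets[OF one[OF that]] by (simp only:)
  qed (use one[OF that] in simp)
  note two = this
  have UNIV: "UNIV \<in> sets (iid :: (nat \<Rightarrow> real) measure)" using sets.top[of "iid :: (nat \<Rightarrow> real) measure"] by simp
  have T: "{x. pattern B F x = T} \<in> sets iid" for T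
  proof (cases "F = {}")
    case False
    then have "(\<Inter>p\<in>F \<times> F. {x. p \<in> pattern B F x \<longleftrightarrow> p \<in> T}) \<in> sets iid"
      using F two by (intro sets.finite_INT) auto
    then show ?thesis unfolding eq using UNIV by (intro sets.Int) (simp_all split: if_split)
  next
    case True
    then show ?thesis using UNIV by (cases "T = {}") (auto simp: pattern_def)
  qed
  have "conn B F s = (\<Union>T\<in>{T. T \<subseteq> F \<times> F \<and> (\<one>, s) \<in> T\<^sup>*}. {x. pattern B F x = T})"
    unfolding conn_def pattern_def by auto
  also have "\<dots> \<in> sets iid"
    using F T by (intro sets.finite_UN) auto
  finally show ?thesis .
qed

lemma cylinder_conn:
  assumes B: "\<And>h k. h \<in> F \<Longrightarrow> k \<in> F \<Longrightarrow> cylinder J (B (inv h \<otimes> k))"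
  shows "cylinder (\<Union>h\<in>F. shift h ` J) (conn B F s)"
  unfolding cylinder_def
proof (intro allI impI)
  fix x y :: "nat \<Rightarrow> real" assume eq: "\<forall>i\<in>\<Union>h\<in>F. shift h ` J. x i = y i"
  have "bern x h \<in> B (inv h \<otimes> k) \<longleftrightarrow> bern y h \<in> B (inv h \<otimes> k)" if "h \<in> F" "k \<in> F" for h k
    by (rule cylinderD[OF B[OF that]]) (use eq that in \<open>auto simp: bern_def\<close>)
  then have "pattern B F x = pattern B F y" unfolding pattern_def by auto
  then show "x \<in> conn B F s \<longleftrightarrow> y \<in> conn B F s" unfolding conn_def by simp
qed

lemma bern_eq_iff:
  assumes free: "\<forall>g\<in>carrier \<Gamma>. bern x g = x \<longrightarrow> g = \<one>" and g: "g \<in> carrier \<Gamma>" and h: "h \<in> carrier \<Gamma>"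
  shows "bern x g = bern x h \<longleftrightarrow> g = h"
proof
  assume "bern x g = bern x h"
  then have "bern x (g \<otimes> inv h) = x"
    using g h by (metis bern.R_inv(1) bern.R_mult inv_closed)
  then have "g \<otimes> inv h = \<one>" using free g h by auto
  then show "g = h" using g h by (metis inv_equality inv_inv inv_closed)
qed simp

lemma bern_vimage_measure:
  assumes "h \<in> carrier \<Gamma>" "B \<in> sets iid"
  shows "measure iid {x. bern x h \<in> B} = measure iid B"
proof -
  have "measure iid B = measure (distr iid iid (\<lambda>x. bern x h)) B" by (simp add: distr_bern[OF assms(1)])
  also have "\<dots> = measure iid {x. bern x h \<in> B}"
    using measure_distr[OF measurable_bern assms(2)] by (simp add: vimage_def)
  finally show ?thesis by simp
qed

text \<open>The infimum need not be attained, hence \<open>\<epsilon>\<close>; the factor 2 undoes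
  the halving in \<open>rel_cost\<close>.\<close>

lemma ex_bern_graphing:
  assumes fp: "fixed_price \<Gamma> (ennreal c)" and c: "0 \<le> c" and \<epsilon>: "0 < \<epsilon>"
  shows "\<exists>H. graphing iid (orbit_rel \<Gamma> iid bern.lact) H \<and>
    (\<integral>\<^sup>+ x. emeasure (count_space UNIV) (H `` {x}) \<partial>iid) < ennreal (2 * c + \<epsilon>)"
proof (rule ccontr)
  let ?R = "orbit_rel \<Gamma> iid bern.lact"
  assume "\<not> ?thesis"
  then have "ennreal (2 * c + \<epsilon>) \<le> (INF H\<in>{H. graphing iid ?R H}. \<integral>\<^sup>+ x. emeasure (count_space UNIV) (H `` {x}) \<partial>iid)"
    by (intro INF_greatest) (auto simp: not_less)
  then have "ennreal (2 * c + \<epsilon>) / 2 \<le> rel_cost iid ?R"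
    unfolding rel_cost_def by (rule divide_right_mono_ennreal)
  also have "\<dots> = ennreal c" using bern_action_cost[OF fp] by (simp add: action_cost_def)
  finally have "ennreal ((2 * c + \<epsilon>) / 2) \<le> ennreal c"
    using divide_ennreal[of "2 * c + \<epsilon>" 2] c \<epsilon> by simp
  then show False using c \<epsilon> by (simp add: ennreal_le_iff)
qed

text \<open>Two approximations are combined. Restricting a cheap graphing to a large finite ball
  keeps \<open>\<one>\<close> and \<open>s\<close> joined with probability close to 1; then the
  finitely many events involved are replaced by cylinder sets, with errors so small that a union
  bound leaves the pattern unchanged with high probability.\<close>

lemma bern_finite_approx:
  assumes fp: "fixed_price \<Gamma> (ennreal c)" and c: "0 \<le> c" and \<epsilon>: "0 < \<epsilon>"
  obtains F J B where "finite F" "F \<subseteq> carrier \<Gamma>" "finite J"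
    "\<And>h k. h \<in> F \<Longrightarrow> k \<in> F \<Longrightarrow> B (inv h \<otimes> k) \<in> sets iid \<and> cylinder J (B (inv h \<otimes> k))"
    "(\<Sum>g\<in>(\<lambda>(h, k). inv h \<otimes> k) ` (F \<times> F). measure iid (B g)) \<le> 2 * c + \<epsilon>"
    "\<And>s. s \<in> S \<Longrightarrow> 1 - \<epsilon> \<le> measure iid (conn B F s)"
proof -
  interpret P: prob_space "iid :: (nat \<Rightarrow> real) measure" by (rule prob_space_iid)
  let ?R = "orbit_rel \<Gamma> iid bern.lact"
  obtain H where H: "graphing iid ?R H"
    and deg: "(\<integral>\<^sup>+ x. emeasure (count_space UNIV) (H `` {x}) \<partial>iid) < ennreal (2 * c + \<epsilon> / 2)"
    using ex_bern_graphing[OF fp c, of "\<epsilon> / 2"] \<epsilon> by auto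
  have Hs: "H \<in> sets (iid \<Otimes>\<^sub>M iid)" and symH: "sym H" and HR: "H \<subseteq> ?R"
    and conH: "AE x in iid. H\<^sup>* `` {x} = ?R `` {x}" using H unfolding graphing_def by auto
  \<comment> \<open>By freeness the graphing is encoded by these events, one for each group element
    along which an edge may run.\<close>
  define A where "A g = {x. (x, bern x g) \<in> H}" for g
  have A: "A g \<in> sets iid" for g
  proof -
    have "(\<lambda>x. (x, bern x g)) \<in> iid \<rightarrow>\<^sub>M iid \<Otimes>\<^sub>M iid"
      by (intro measurable_Pair measurable_ident_sets measurable_bern) auto
    from measurable_sets[OF this Hs] show ?thesis by (simp add: A_def vimage_def)
  qed
  have A_iff: "bern x h \<in> A (inv h \<otimes> k) \<longleftrightarrow> (bern x h, bern x k) \<in> H"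
    if "h \<in> carrier \<Gamma>" "k \<in> carrier \<Gamma>" for x h k
    using that by (simp add: A_def bern.R_mult m_assoc[symmetric])
  have pat: "pattern A F x = {(h, k). h \<in> F \<and> k \<in> F \<and> (bern x h, bern x k) \<in> H}" if "F \<subseteq> carrier \<Gamma>" for F x
    unfolding pattern_def using that A_iff symH by (auto simp: subset_iff dest: symD)
  have sumA: "(\<Sum>g\<in>Q. measure iid (A g)) \<le> 2 * c + \<epsilon> / 2" if Q: "finite Q" "Q \<subseteq> carrier \<Gamma>" for Q
  proof -
    have "ennreal (\<Sum>g\<in>Q. measure iid (A g)) = (\<Sum>g\<in>Q. emeasure iid (A g))"
      by (simp add: P.emeasure_eq_measure)
    also have "\<dots> = (\<Sum>g\<in>Q. \<integral>\<^sup>+ x. indicator (A g) x \<partial>iid)" using A by simp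
    also have "\<dots> = (\<integral>\<^sup>+ x. (\<Sum>g\<in>Q. indicator (A g) x) \<partial>iid)"
      using A by (intro nn_integral_sum[symmetric]) auto
    finally have eq: "ennreal (\<Sum>g\<in>Q. measure iid (A g)) = (\<integral>\<^sup>+ x. (\<Sum>g\<in>Q. indicator (A g) x) \<partial>iid)" .
    \<comment> \<open>At a free point the translates by elements of \<open>Q\<close> are distinct,
      so the sum counts some of the neighbors of \<open>x\<close> without repetition.\<close>
    have "AE x in iid. (\<Sum>g\<in>Q. indicator (A g) x) \<le> emeasure (count_space UNIV) (H `` {x})"
      using AE_bern_free
    proof eventually_elim
      case (elim x)
      let ?Q = "{g \<in> Q. x \<in> A g}"
      have fin: "finite ?Q" using Q by auto
      have inj: "inj_on (bern x) ?Q"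
        using bern_eq_iff[OF elim] Q by (auto simp: inj_on_def subset_iff)
      have "(\<Sum>g\<in>Q. indicator (A g) x :: ennreal) = of_nat (card ?Q)"
        using Q by (simp add: indicator_def sum.If_cases Int_def)
      also have "\<dots> = emeasure (count_space UNIV) (bern x ` ?Q)"
        using fin inj by (simp add: emeasure_count_space_finite card_image)
      also have "\<dots> \<le> emeasure (count_space UNIV) (H `` {x})"
        by (rule emeasure_mono) (auto simp: A_def)
      finally show ?case .
    qed
    then have "ennreal (\<Sum>g\<in>Q. measure iid (A g)) \<le> (\<integral>\<^sup>+ x. emeasure (count_space UNIV) (H `` {x}) \<partial>iid)"
      unfolding eq by (rule nn_integral_mono_AE)
    also note deg
    finally have "ennreal (\<Sum>g\<in>Q. measure iid (A g)) \<le> ennreal (2 * c + \<epsilon> / 2)" by simp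
    then show ?thesis using c \<epsilon> by (subst (asm) ennreal_le_iff) auto
  qed
  \<comment> \<open>A finite path in the orbit lifts to a path in the group, and its finitely many
    vertices fit into one ball.\<close>
  have path: "\<exists>m h. h \<in> cball m \<and> y = bern x h \<and> (\<one>, h) \<in> (pattern A (cball m) x)\<^sup>*"
    if "(x, y) \<in> H\<^sup>*" for x y
    using that
  proof induction
    case base
    show ?case by (intro exI[of _ 0] exI[of _ \<one>]) simp
  next
    case (step y z)
    then obtain m h where h: "h \<in> cball m" "y = bern x h" "(\<one>, h) \<in> (pattern A (cball m) x)\<^sup>*" by blast
    have hc: "h \<in> carrier \<Gamma>" using h cball_carrier by blast
    obtain g where g: "g \<in> carrier \<Gamma>" "z = bern y g"
      using step(2) HR bern.orbit_rel_lact[OF space_iid] by blast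
    then obtain m' where m': "h \<otimes> g \<in> cball m'" using hc Union_cball by blast
    let ?m = "max m m'"
    have sub: "cball m \<subseteq> cball ?m" "cball m' \<subseteq> cball ?m" by (auto intro!: cball_mono)
    have z: "z = bern x (h \<otimes> g)" using g h hc by (simp add: bern.R_mult)
    have "(h, h \<otimes> g) \<in> pattern A (cball ?m) x"
      unfolding pat[OF cball_carrier] using h m' sub step(2) z by auto
    moreover have "(\<one>, h) \<in> (pattern A (cball ?m) x)\<^sup>*"
      using h(3) rtrancl_mono[OF pattern_mono[OF sub(1)]] by blast
    ultimately have "(\<one>, h \<otimes> g) \<in> (pattern A (cball ?m) x)\<^sup>*" by (rule rtrancl.rtrancl_into_rtrancl[rotated])
    then show ?case using z m' sub by (intro exI[of _ ?m] exI[of _ "h \<otimes> g"]) auto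
  qed
  have lim: "(\<lambda>m. measure iid (conn A (cball m) s)) \<longlonglongrightarrow> 1" if s: "s \<in> S" for s
  proof -
    have sc: "s \<in> carrier \<Gamma>" using s S_carrier by auto
    have "(\<lambda>m. measure iid (conn A (cball m) s)) \<longlonglongrightarrow> measure iid (\<Union>m. conn A (cball m) s)"
      using A by (intro P.finite_Lim_measure_incseq incseq_SucI conn_mono) (auto intro!: sets_conn)
    moreover have "AE x in iid. x \<in> (\<Union>m. conn A (cball m) s)"
      using AE_bern_free conH
    proof eventually_elim
      case (elim x)
      have "(x, bern x s) \<in> ?R" unfolding bern.orbit_rel_lact[OF space_iid] using sc by blast
      then have "(x, bern x s) \<in> H\<^sup>*" using elim(2) by blast
      then obtain m h where h: "h \<in> cball m" "bern x s = bern x h" "(\<one>, h) \<in> (pattern A (cball m) x)\<^sup>*"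
        using path by blast
      then have "h = s" using bern_eq_iff[OF elim(1)] sc cball_carrier by blast
      with h show ?case by (auto simp: conn_def)
    qed
    then have "measure iid (\<Union>m. conn A (cball m) s) = 1"
      by (subst P.prob_eq_1) (use A in \<open>auto intro!: sets_conn\<close>)
    ultimately show ?thesis by simp
  qed
  have "\<forall>\<^sub>F m in sequentially. \<forall>s\<in>S. 1 - \<epsilon> / 2 < measure iid (conn A (cball m) s)"
    using finite_S lim \<epsilon> by (intro eventually_ball_finite ballI order_tendstoD) auto
  then obtain m where m: "\<And>s. s \<in> S \<Longrightarrow> 1 - \<epsilon> / 2 < measure iid (conn A (cball m) s)"
    by (auto simp: eventually_sequentially)
  define F where "F = cball m"
  define Q where "Q = (\<lambda>(h, k). inv h \<otimes> k) ` (F \<times> F)"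
  have F: "finite F" "F \<subseteq> carrier \<Gamma>" using cball_carrier by (auto simp: F_def)
  have Q: "finite Q" "Q \<subseteq> carrier \<Gamma>" using F by (auto simp: Q_def)
  \<comment> \<open>Number of errors to be paid for: \<open>card Q\<close> in the degree sum,
    \<open>card F * card Q\<close> in the union bound over translates, and 1 to keep the denominator
    positive. All of them together cost \<open>\<epsilon> / 2\<close>.\<close>
  define N where "N = real (card F * card Q + card Q + 1)"
  define \<delta> where "\<delta> = \<epsilon> / (2 * N)"
  have N: "N > 0" unfolding N_def by linarith
  then have \<delta>: "\<delta> > 0" using \<epsilon> by (simp add: \<delta>_def)
  have N\<delta>: "N * \<delta> = \<epsilon> / 2" using N by (simp add: \<delta>_def)
  have "\<forall>g. \<exists>B J. B \<in> sets iid \<and> finite J \<and> cylinder J B \<and> measure iid ((A g - B) \<union> (B - A g)) < \<delta>"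
    using iid_approx_cylinder[OF A \<delta>] by blast
  then obtain B Jf where B: "\<And>g. B g \<in> sets iid" "\<And>g. finite (Jf g)" "\<And>g. cylinder (Jf g) (B g)"
    "\<And>g. measure iid ((A g - B g) \<union> (B g - A g)) < \<delta>" by metis
  define X where "X g = (A g - B g) \<union> (B g - A g)" for g
  have X: "X g \<in> sets iid" for g using A B by (auto simp: X_def)
  show thesis
  proof (rule that[of F "\<Union>g\<in>Q. Jf g" B])
    show "finite F" "F \<subseteq> carrier \<Gamma>" "finite (\<Union>g\<in>Q. Jf g)" using F Q B(2) by auto
    show "B (inv h \<otimes> k) \<in> sets iid \<and> cylinder (\<Union>g\<in>Q. Jf g) (B (inv h \<otimes> k))" if "h \<in> F" "k \<in> F" for h k
    proof
      show "cylinder (\<Union>g\<in>Q. Jf g) (B (inv h \<otimes> k))"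
        by (rule cylinder_mono[OF B(3)]) (use that in \<open>auto simp: Q_def\<close>)
    qed (rule B)
    have "(\<Sum>g\<in>Q. measure iid (B g)) \<le> (\<Sum>g\<in>Q. measure iid (A g) + \<delta>)"
    proof (rule sum_mono)
      fix g
      have "measure iid (B g) \<le> measure iid (A g \<union> X g)"
        using A X by (intro P.finite_measure_mono) (auto simp: X_def)
      also have "\<dots> \<le> measure iid (A g) + measure iid (X g)" using A X by (intro measure_Un_le) auto
      finally show "measure iid (B g) \<le> measure iid (A g) + \<delta>" using B(4)[of g] by (simp add: X_def)
    qed
    also have "\<dots> = (\<Sum>g\<in>Q. measure iid (A g)) + real (card Q) * \<delta>" by (simp add: sum.distrib)
    also have "real (card Q) * \<delta> \<le> N * \<delta>" using \<delta> by (intro mult_right_mono) (auto simp: N_def)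
    finally show "(\<Sum>g\<in>(\<lambda>(h, k). inv h \<otimes> k) ` (F \<times> F). measure iid (B g)) \<le> 2 * c + \<epsilon>"
      using sumA[OF Q] N\<delta> by (simp add: Q_def[symmetric])
    fix s assume s: "s \<in> S"
    let ?Y = "\<Union>p\<in>F \<times> Q. {x. bern x (fst p) \<in> X (snd p)}"
    have Y: "?Y \<in> sets iid" using F Q X by (intro sets.finite_UN) (auto intro!: sets_bern_vimage)
    \<comment> \<open>Outside \<open>?Y\<close> no error event occurs at any translate by an element
      of \<open>F\<close>, so the two patterns coincide.\<close>
    have "conn A F s \<subseteq> conn B F s \<union> ?Y"
    proof
      fix x assume x: "x \<in> conn A F s"
      show "x \<in> conn B F s \<union> ?Y"
      proof (cases "x \<in> ?Y")
        case False
        then have *: "bern x h \<in> A g \<longleftrightarrow> bern x h \<in> B g" if "h \<in> F" "g \<in> Q" for h g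
          using that by (force simp: X_def)
        have "pattern A F x = pattern B F x" unfolding pattern_def using * by (auto simp: Q_def)
        then show ?thesis using x by (simp add: conn_def)
      qed simp
    qed
    then have "measure iid (conn A F s) \<le> measure iid (conn B F s \<union> ?Y)"
      using F B Y by (intro P.finite_measure_mono sets.Un sets_conn) auto
    also have "\<dots> \<le> measure iid (conn B F s) + measure iid ?Y"
      using F B Y by (intro measure_Un_le sets_conn) auto
    also have "measure iid ?Y \<le> (\<Sum>p\<in>F \<times> Q. measure iid {x. bern x (fst p) \<in> X (snd p)})"
      using F Q X by (intro P.finite_measure_subadditive_finite) (auto intro!: sets_bern_vimage)
    also have "\<dots> \<le> (\<Sum>p\<in>F \<times> Q. \<delta>)"
    proof (rule sum_mono)
      fix p assume "p \<in> F \<times> Q"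
      then show "measure iid {x. bern x (fst p) \<in> X (snd p)} \<le> \<delta>"
        using bern_vimage_measure[of "fst p" "X (snd p)"] F X B(4)[of "snd p"] by (auto simp: X_def)
    qed
    also have "\<dots> = real (card F * card Q) * \<delta>" by (simp add: card_cartesian_product)
    also have "\<dots> \<le> N * \<delta>" using \<delta> by (intro mult_right_mono) (auto simp: N_def)
    finally show "1 - \<epsilon> \<le> measure iid (conn B F s)" using m[OF s] N\<delta> by (simp add: F_def)
  qed
qed

end

section \<open>The first moment bound\<close>

lemma (in prob_space) ex_le_expectation:
  fixes X :: "'a \<Rightarrow> real"
  assumes "integrable M X"
  shows "\<exists>\<omega>\<in>space M. X \<omega> \<le> expectation X"
proof (rule ccontr)
  assume "\<not> ?thesis"
  then have "AE \<omega> in M. expectation X < X \<omega>" by (intro AE_I2) (auto simp: not_le)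
  from expectation_greater[OF assms this] show False by simp
qed

lemma gdist_mono: "E \<subseteq> E' \<Longrightarrow> gdist E x y \<le> enat k \<Longrightarrow> gdist E' x y \<le> enat k"
proof -
  assume E: "E \<subseteq> E'" and le: "gdist E x y \<le> enat k"
  have "((\<lambda>u v. {u, v} \<in> E') ^^ j) x y" if "((\<lambda>u v. {u, v} \<in> E) ^^ j) x y" for j
    using that
  proof (induction j arbitrary: y)
    case (Suc j)
    then show ?case using E by auto
  qed simp
  then show ?thesis using le unfolding gdist_le_iff by blast
qed

context sofic
begin

text \<open>The labeling of the vertices pulled back to the group along the orbit map of
  \<open>v\<close>. Vertex labels sit in the left summand; the right one is the reserve required by
  \<open>iid_law_cylinder\<close>.\<close>

definition label :: "nat \<Rightarrow> (('v \<times> nat) + nat \<Rightarrow> real) \<Rightarrow> 'v \<Rightarrow> nat \<Rightarrow> real" where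
  "label n \<omega> v i = \<omega> (Inl (act n v (pos i), tag i))"

text \<open>The rewired graph: \<open>wire\<close> copies the graphing, approximated by cylinder sets and read off
  the random labels; \<open>repair\<close> puts back those edges whose ends it might leave unconnected.\<close>

definition wire :: "('g \<Rightarrow> (nat \<Rightarrow> real) set) \<Rightarrow> 'g set \<Rightarrow> nat \<Rightarrow> (('v \<times> nat) + nat \<Rightarrow> real) \<Rightarrow> 'v \<Rightarrow> 'v \<Rightarrow> bool" where
  "wire B Q n \<omega> u w \<longleftrightarrow> u \<in> V n \<and> w \<in> V n \<and> u \<noteq> w \<and>
     (\<exists>g\<in>Q. w = act n u g \<and> u = act n w (inv g) \<and> label n \<omega> u \<in> B g \<and> label n \<omega> w \<in> B (inv g))"

definition wires :: "('g \<Rightarrow> (nat \<Rightarrow> real) set) \<Rightarrow> 'g set \<Rightarrow> nat \<Rightarrow> (('v \<times> nat) + nat \<Rightarrow> real) \<Rightarrow> 'v set set" where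
  "wires B Q n \<omega> = {{u, w} |u w. wire B Q n \<omega> u w}"

definition repair :: "('g \<Rightarrow> (nat \<Rightarrow> real) set) \<Rightarrow> 'v set \<Rightarrow> nat \<Rightarrow> (('v \<times> nat) + nat \<Rightarrow> real) \<Rightarrow> 'v set set" where
  "repair C Z n \<omega> = {e \<in> E n. \<exists>v\<in>e. v \<in> Z \<or> (\<exists>s\<in>S. e = {v, act n v s} \<and> label n \<omega> v \<notin> C s)}"

text \<open>The local laws used at \<open>v\<close>, in order: the label at a translate is the
  translated label, wires end where the pattern says, the labels consulted are independent, and
  every edge at \<open>v\<close> is given by a generator.\<close>

definition regular :: "'g set \<Rightarrow> nat set \<Rightarrow> nat \<Rightarrow> 'v \<Rightarrow> bool" where
  "regular F J n v \<longleftrightarrow>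
     (\<forall>h\<in>F. \<forall>i\<in>J. act n (act n v h) (pos i) = act n v (h \<otimes> pos i)) \<and>
     (\<forall>h\<in>F. \<forall>g\<in>(\<lambda>(h, k). inv h \<otimes> k) ` (F \<times> F). act n (act n v h) g = act n v (h \<otimes> g)) \<and>
     inj_on (act n v) (pos ` (J \<union> (\<Union>h\<in>F. shift h ` J))) \<and>
     (\<forall>u. {v, u} \<in> E n \<longrightarrow> (\<exists>s\<in>S. u = act n v s))"

lemma aa_regular:
  assumes "finite F" "F \<subseteq> carrier \<Gamma>" "finite J"
  shows "aa (regular F J)"
  unfolding regular_def
proof (intro aa_conj aa_nbr)
  show "aa (\<lambda>n v. \<forall>h\<in>F. \<forall>i\<in>J. act n (act n v h) (pos i) = act n v (h \<otimes> pos i))"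
    by (intro aa_ball aa_act_assoc) (use assms in auto)
  show "aa (\<lambda>n v. \<forall>h\<in>F. \<forall>g\<in>(\<lambda>(h, k). inv h \<otimes> k) ` (F \<times> F). act n (act n v h) g = act n v (h \<otimes> g))"
    by (intro aa_ball aa_act_assoc) (use assms in auto)
  show "aa (\<lambda>n v. inj_on (act n v) (pos ` (J \<union> (\<Union>h\<in>F. shift h ` J))))"
    by (rule aa_act_inj) (use assms in auto)
qed

text \<open>Different indices read different labels: if they reach the same vertex, injectivity
  makes their positions equal, and then their tags differ.\<close>

lemma label_law:
  assumes "inj_on (act n v) (pos ` J)" "B \<in> sets iid" "cylinder J B"
  shows "measure iid {\<omega>. label n \<omega> v \<in> B} = measure iid B"
proof -
  have "inj_on (\<lambda>i. (act n v (pos i), tag i)) J"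
  proof (rule inj_onI)
    fix i j assume ij: "i \<in> J" "j \<in> J" "(act n v (pos i), tag i) = (act n v (pos j), tag j)"
    then have "pos i = pos j" using assms(1) by (auto dest: inj_onD)
    then have "idx (pos i, tag i) = idx (pos j, tag j)" using ij(3) by simp
    then show "i = j" by simp
  qed
  moreover have "label n \<omega> v = (\<lambda>i. \<omega> (Inl (act n v (pos i), tag i)))" for \<omega>
    by (simp add: label_def fun_eq_iff)
  ultimately show ?thesis by (simp only: iid_law_cylinder[OF assms(2,3)])
qed

lemma measurable_label: "(\<lambda>\<omega>. label n \<omega> v) \<in> iid \<rightarrow>\<^sub>M iid"
proof -
  have "(\<lambda>\<omega>. label n \<omega> v) = (\<lambda>\<omega> i. \<omega> (Inl (act n v (pos i), tag i)))"
    by (simp add: label_def fun_eq_iff)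
  then show ?thesis by (simp only: measurable_iid_reindex)
qed

lemma sets_label: "B \<in> sets iid \<Longrightarrow> {\<omega>. label n \<omega> v \<in> B} \<in> sets iid"
  using measurable_sets[OF measurable_label] by (simp add: vimage_def)

lemma wire_sym:
  assumes "F \<subseteq> carrier \<Gamma>" "wire B ((\<lambda>(h, k). inv h \<otimes> k) ` (F \<times> F)) n \<omega> u w"
  shows "wire B ((\<lambda>(h, k). inv h \<otimes> k) ` (F \<times> F)) n \<omega> w u"
proof -
  obtain h k where hk: "h \<in> F" "k \<in> F" and g: "w = act n u (inv h \<otimes> k)" "u = act n w (inv (inv h \<otimes> k))"
    "label n \<omega> u \<in> B (inv h \<otimes> k)" "label n \<omega> w \<in> B (inv (inv h \<otimes> k))"
    and uw: "u \<in> V n" "w \<in> V n" "u \<noteq> w"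
    using assms(2) unfolding wire_def by auto
  have inv: "inv (inv h \<otimes> k) = inv k \<otimes> h" "inv (inv k \<otimes> h) = inv h \<otimes> k"
    using hk assms(1) by (auto simp: inv_mult_group subset_iff)
  show ?thesis unfolding wire_def
    using hk g uw unfolding inv by (intro conjI bexI[of _ "inv k \<otimes> h"]) (auto simp: inv)
qed

text \<open>The orbit map of \<open>v\<close> carries the pattern seen at \<open>v\<close> to wires,
  collapsing an edge at worst. A connection in the pattern needs no more steps than there are pairs
  in \<open>F \<times> F\<close>, a bound independent of \<open>n\<close>.\<close>

lemma gdist_wires:
  assumes F: "F \<subseteq> carrier \<Gamma>" "finite F"
    and cyl: "\<And>h k. h \<in> F \<Longrightarrow> k \<in> F \<Longrightarrow> cylinder J (B (inv h \<otimes> k))"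
    and v: "v \<in> V n" and reg: "regular F J n v" and s: "s \<in> S" and con: "label n \<omega> v \<in> conn B F s"
  shows "gdist (wires B ((\<lambda>(h, k). inv h \<otimes> k) ` (F \<times> F)) n \<omega>) v (act n v s) \<le> enat (card (F \<times> F))"
proof -
  let ?Q = "(\<lambda>(h, k). inv h \<otimes> k) ` (F \<times> F)"
  let ?W = "wires B ?Q n \<omega>"
  let ?P = "pattern B F (label n \<omega> v)"
  have step: "gdist ?W (act n v h) (act n v k) \<le> enat 1" if hk: "(h, k) \<in> ?P" for h k
  proof (cases "act n v h = act n v k")
    case False
    have hkF: "h \<in> F" "k \<in> F" and hB: "bern (label n \<omega> v) h \<in> B (inv h \<otimes> k)" and kB: "bern (label n \<omega> v) k \<in> B (inv k \<otimes> h)"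
      using hk by (auto simp: pattern_def)
    have hkc: "h \<in> carrier \<Gamma>" "k \<in> carrier \<Gamma>" using hkF F by auto
    have Q: "inv h \<otimes> k \<in> ?Q" "inv k \<otimes> h \<in> ?Q" using hkF by (auto simp: image_iff)
    have inv: "inv (inv h \<otimes> k) = inv k \<otimes> h" using hkc by (simp add: inv_mult_group)
    have lab: "label n \<omega> (act n v g) i = bern (label n \<omega> v) g i" if "g \<in> F" "i \<in> J" for g i
      using reg that F unfolding regular_def label_def bern_def by (auto simp: subset_iff)
    have hB': "label n \<omega> (act n v h) \<in> B (inv h \<otimes> k)"
      using cylinderD[OF cyl[OF hkF], of "label n \<omega> (act n v h)" "bern (label n \<omega> v) h", OF lab[OF hkF(1)]] hB by blast
    have kB': "label n \<omega> (act n v k) \<in> B (inv k \<otimes> h)"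
      using cylinderD[OF cyl[OF hkF(2,1)], of "label n \<omega> (act n v k)" "bern (label n \<omega> v) k", OF lab[OF hkF(2)]] kB by blast
    have a1: "act n (act n v h) (inv h \<otimes> k) = act n v (h \<otimes> (inv h \<otimes> k))"
      and a2: "act n (act n v k) (inv k \<otimes> h) = act n v (k \<otimes> (inv k \<otimes> h))"
      using reg hkF Q unfolding regular_def by blast+
    have "h \<otimes> (inv h \<otimes> k) = k" "k \<otimes> (inv k \<otimes> h) = h" using hkc by (auto simp: m_assoc[symmetric])
    then have "wire B ?Q n \<omega> (act n v h) (act n v k)"
      unfolding wire_def using False v Q(1) hB' kB' a1 a2
      by (intro conjI bexI[of _ "inv h \<otimes> k"]) (auto simp: inv)
    then have "{act n v h, act n v k} \<in> ?W" unfolding wires_def by blast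
    then show ?thesis by (rule gdist_edge)
  qed (simp add: zero_enat_def[symmetric])
  have rel: "gdist ?W (act n v h) (act n v k) \<le> enat j" if "(h, k) \<in> ?P ^^ j" for j h k
    using that
  proof (induction j arbitrary: k)
    case (Suc j)
    then obtain l where l: "(h, l) \<in> ?P ^^ j" "(l, k) \<in> ?P" by auto
    from gdist_trans[OF Suc.IH[OF l(1)] step[OF l(2)]] show ?case by simp
  qed (simp add: zero_enat_def[symmetric])
  have "finite ?P" using F by (intro finite_pattern)
  moreover have "(\<one>, s) \<in> ?P\<^sup>*" using con by (simp add: conn_def)
  ultimately obtain j where j: "j \<le> card ?P" "(\<one>, s) \<in> ?P ^^ j"
    by (auto simp: rtrancl_finite_eq_relpow)
  have "card ?P \<le> card (F \<times> F)" using F by (intro card_mono) (auto simp: pattern_def)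
  then show ?thesis using rel[OF j(2)] j(1) by (auto elim: order_trans)
qed

text \<open>A wire is counted from both ends. The other end of a wire at \<open>u\<close> is reached
  by some \<open>g\<close> whose event holds at \<open>u\<close>, and different ends require
  different \<open>g\<close>.\<close>

lemma card_wires_le:
  assumes F: "F \<subseteq> carrier \<Gamma>" "finite F"
  shows "2 * card (wires B ((\<lambda>(h, k). inv h \<otimes> k) ` (F \<times> F)) n \<omega>)
    \<le> (\<Sum>u\<in>V n. card {g \<in> (\<lambda>(h, k). inv h \<otimes> k) ` (F \<times> F). label n \<omega> u \<in> B g})"
proof -
  let ?Q = "(\<lambda>(h, k). inv h \<otimes> k) ` (F \<times> F)"
  let ?W = "wires B ?Q n \<omega>"
  have finQ: "finite ?Q" using F by auto
  have W: "?W \<subseteq> {e. e \<subseteq> V n \<and> card e = 2}"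
    unfolding wires_def wire_def by (auto simp: card_2_iff)
  have finW: "finite ?W" by (rule finite_subset[of _ "Pow (V n)"]) (use W in auto)
  have "2 * card ?W = card {(u, w). {u, w} \<in> ?W}"
    by (rule card_doubletons[symmetric]) (use finW W in auto)
  also have "\<dots> \<le> card (SIGMA u:V n. (act n u) ` {g \<in> ?Q. label n \<omega> u \<in> B g})"
  proof (rule card_mono)
    show "finite (SIGMA u:V n. (act n u) ` {g \<in> ?Q. label n \<omega> u \<in> B g})"
      using finQ by (intro finite_SigmaI finite_imageI) auto
    have "wire B ?Q n \<omega> u w" if uw: "{u, w} \<in> ?W" for u w
    proof -
      obtain u' w' where "{u, w} = {u', w'}" "wire B ?Q n \<omega> u' w'"
        using uw unfolding wires_def by blast
      then show ?thesis using wire_sym[OF F(1)] by (auto simp: doubleton_eq_iff)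
    qed
    then show "{(u, w). {u, w} \<in> ?W} \<subseteq> (SIGMA u:V n. (act n u) ` {g \<in> ?Q. label n \<omega> u \<in> B g})"
      unfolding wire_def by blast
  qed
  also have "\<dots> = (\<Sum>u\<in>V n. card ((act n u) ` {g \<in> ?Q. label n \<omega> u \<in> B g}))"
    using finQ by (intro card_SigmaI) auto
  also have "\<dots> \<le> (\<Sum>u\<in>V n. card {g \<in> ?Q. label n \<omega> u \<in> B g})"
    using finQ by (intro sum_mono card_image_le) auto
  finally show ?thesis .
qed

text \<open>A vertex of \<open>Z\<close> may cause all its edges to be restored; any other vertex
  causes at most one for each generator whose connection event fails.\<close>

lemma card_repair_le:
  assumes D: "\<And>v. v \<in> V n \<Longrightarrow> card {e \<in> E n. v \<in> e} \<le> D" and Z: "Z \<subseteq> V n"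
  shows "card (repair C Z n \<omega>) \<le> D * card Z + (\<Sum>v\<in>V n - Z. card {s \<in> S. label n \<omega> v \<notin> C s})"
proof -
  let ?A = "\<Union>v\<in>Z. {e \<in> E n. v \<in> e}"
  let ?B = "\<Union>v\<in>V n - Z. (\<lambda>s. {v, act n v s}) ` {s \<in> S. label n \<omega> v \<notin> C s}"
  have finZ: "finite Z" using finite_subset[OF Z finite_V] .
  have "repair C Z n \<omega> \<subseteq> ?A \<union> ?B"
  proof
    fix e assume "e \<in> repair C Z n \<omega>"
    then obtain v where v: "e \<in> E n" "v \<in> e" "v \<in> Z \<or> (\<exists>s\<in>S. e = {v, act n v s} \<and> label n \<omega> v \<notin> C s)"
      unfolding repair_def by blast
    have "v \<in> V n" using v(1,2) E_sub by blast
    then show "e \<in> ?A \<union> ?B" using v by (cases "v \<in> Z") auto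
  qed
  moreover have "finite (?A \<union> ?B)" using finZ finite_E finite_S by auto
  ultimately have "card (repair C Z n \<omega>) \<le> card (?A \<union> ?B)" by (rule card_mono[rotated])
  also have "\<dots> \<le> card ?A + card ?B" by (rule card_Un_le)
  also have "card ?A \<le> (\<Sum>v\<in>Z. card {e \<in> E n. v \<in> e})" using finZ by (rule card_UN_le)
  also have "\<dots> \<le> (\<Sum>v\<in>Z. D)" using D Z by (intro sum_mono) auto
  also have "card ?B \<le> (\<Sum>v\<in>V n - Z. card ((\<lambda>s. {v, act n v s}) ` {s \<in> S. label n \<omega> v \<notin> C s}))"
    by (rule card_UN_le) simp
  also have "\<dots> \<le> (\<Sum>v\<in>V n - Z. card {s \<in> S. label n \<omega> v \<notin> C s})"
    using finite_S by (intro sum_mono card_image_le) auto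
  finally show ?thesis by (simp add: mult.commute)
qed

text \<open>Wires and repairs are charged to one random variable, so that a single labeling keeps
  their sum below its mean. Halving accounts for wires being seen from both ends. Regularity makes
  the mean at each vertex the one computed in the Bernoulli space.\<close>

lemma ex_good_labels:
  assumes F: "finite F" "F \<subseteq> carrier \<Gamma>"
    and B: "\<And>h k. h \<in> F \<Longrightarrow> k \<in> F \<Longrightarrow> B (inv h \<otimes> k) \<in> sets iid \<and> cylinder J (B (inv h \<otimes> k))"
    and Y: "Y \<subseteq> V n" "\<And>v. v \<in> Y \<Longrightarrow> regular F J n v"
  shows "\<exists>\<omega>. (\<Sum>v\<in>Y. real (card {g \<in> (\<lambda>(h, k). inv h \<otimes> k) ` (F \<times> F). label n \<omega> v \<in> B g}) / 2
        + real (card {s \<in> S. label n \<omega> v \<notin> conn B F s}))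
    \<le> real (card Y) * ((\<Sum>g\<in>(\<lambda>(h, k). inv h \<otimes> k) ` (F \<times> F). measure iid (B g)) / 2
        + (\<Sum>s\<in>S. 1 - measure iid (conn B F s)))"
proof -
  interpret P: prob_space "iid :: (('v \<times> nat) + nat \<Rightarrow> real) measure" by (rule prob_space_iid)
  interpret P1: prob_space "iid :: (nat \<Rightarrow> real) measure" by (rule prob_space_iid)
  let ?Q = "(\<lambda>(h, k). inv h \<otimes> k) ` (F \<times> F)"
  let ?T = "\<lambda>v C. {\<omega>. label n \<omega> v \<in> C}"
  have finQ: "finite ?Q" using F by auto
  have Bs: "B g \<in> sets iid" "cylinder J (B g)" if "g \<in> ?Q" for g using B that by auto
  have Cs: "conn B F s \<in> sets iid" for s using F B by (intro sets_conn) auto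
  have Ccyl: "cylinder (\<Union>h\<in>F. shift h ` J) (conn B F s)" for s using B by (intro cylinder_conn) auto
  let ?X = "\<lambda>\<omega>. \<Sum>v\<in>Y. (\<Sum>g\<in>?Q. indicator (?T v (B g)) \<omega>) / 2 + (\<Sum>s\<in>S. 1 - indicator (?T v (conn B F s)) \<omega> :: real)"
  have card1: "real (card {g \<in> ?Q. label n \<omega> v \<in> B g}) = (\<Sum>g\<in>?Q. indicator (?T v (B g)) \<omega>)" for \<omega> v
    using finQ by (simp add: indicator_def sum.If_cases Int_def)
  have card2: "real (card {s \<in> S. label n \<omega> v \<notin> conn B F s}) = (\<Sum>s\<in>S. 1 - indicator (?T v (conn B F s)) \<omega>)" for \<omega> v
  proof -
    have "(\<Sum>s\<in>S. 1 - indicator (?T v (conn B F s)) \<omega> :: real) = (\<Sum>s\<in>S. if label n \<omega> v \<notin> conn B F s then 1 else 0)"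
      by (intro sum.cong) auto
    then show ?thesis using finite_S by (simp add: sum.If_cases Int_def)
  qed
  have i1: "integrable iid (\<lambda>\<omega>. indicator (?T v (B g)) \<omega> :: real)" if "g \<in> ?Q" for v g
    using sets_label[OF Bs(1)[OF that]] by (intro integrable_real_indicator) (auto simp: P.emeasure_eq_measure)
  have i2: "integrable iid (\<lambda>\<omega>. indicator (?T v (conn B F s)) \<omega> :: real)" for v s
    using sets_label[OF Cs] by (intro integrable_real_indicator) (auto simp: P.emeasure_eq_measure)
  have int: "integrable iid ?X"
    using i1 i2 by (intro Bochner_Integration.integrable_sum Bochner_Integration.integrable_add
        integrable_divide Bochner_Integration.integrable_diff P.integrable_const) auto
  have "P.expectation ?X = (\<Sum>v\<in>Y. (\<Sum>g\<in>?Q. measure iid (?T v (B g))) / 2 + (\<Sum>s\<in>S. 1 - measure iid (?T v (conn B F s))))"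
  proof -
    have e1: "P.expectation (\<lambda>\<omega>. \<Sum>g\<in>?Q. indicator (?T v (B g)) \<omega> :: real) = (\<Sum>g\<in>?Q. measure iid (?T v (B g)))" for v
      using i1 by (subst Bochner_Integration.integral_sum) (auto)
    have e2: "P.expectation (\<lambda>\<omega>. \<Sum>s\<in>S. 1 - indicator (?T v (conn B F s)) \<omega> :: real) = (\<Sum>s\<in>S. 1 - measure iid (?T v (conn B F s)))" for v
      using i2 by (subst Bochner_Integration.integral_sum)
        (auto simp: P.prob_space[simplified] intro!: Bochner_Integration.integrable_diff)
    have "P.expectation ?X = (\<Sum>v\<in>Y. P.expectation (\<lambda>\<omega>. (\<Sum>g\<in>?Q. indicator (?T v (B g)) \<omega>) / 2 + (\<Sum>s\<in>S. 1 - indicator (?T v (conn B F s)) \<omega> :: real)))"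
      using i1 i2 by (intro Bochner_Integration.integral_sum Bochner_Integration.integrable_sum Bochner_Integration.integrable_add
        integrable_divide Bochner_Integration.integrable_diff P.integrable_const) auto
    also have "\<dots> = (\<Sum>v\<in>Y. P.expectation (\<lambda>\<omega>. (\<Sum>g\<in>?Q. indicator (?T v (B g)) \<omega>) / 2) + P.expectation (\<lambda>\<omega>. \<Sum>s\<in>S. 1 - indicator (?T v (conn B F s)) \<omega> :: real))"
      using i1 i2 by (intro sum.cong refl Bochner_Integration.integral_add Bochner_Integration.integrable_sum
        integrable_divide Bochner_Integration.integrable_diff P.integrable_const) auto
    finally show ?thesis by (simp only: integral_divide_zero e1 e2)
  qed
  also have "\<dots> = (\<Sum>v\<in>Y. (\<Sum>g\<in>?Q. measure iid (B g)) / 2 + (\<Sum>s\<in>S. 1 - measure iid (conn B F s)))"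
  proof (rule sum.cong[OF refl])
    fix v assume "v \<in> Y"
    then have inj: "inj_on (act n v) (pos ` (J \<union> (\<Union>h\<in>F. shift h ` J)))"
      using Y(2) unfolding regular_def by blast
    have inj1: "inj_on (act n v) (pos ` J)" and inj2: "inj_on (act n v) (pos ` (\<Union>h\<in>F. shift h ` J))"
      by (rule inj_on_subset[OF inj]; blast)+
    have "measure iid (?T v (B g)) = measure iid (B g)" if "g \<in> ?Q" for g
      by (rule label_law[OF inj1 Bs[OF that]])
    moreover have "measure iid (?T v (conn B F s)) = measure iid (conn B F s)" for s
      by (rule label_law[OF inj2 Cs Ccyl])
    ultimately show "(\<Sum>g\<in>?Q. measure iid (?T v (B g))) / 2 + (\<Sum>s\<in>S. 1 - measure iid (?T v (conn B F s)))
      = (\<Sum>g\<in>?Q. measure iid (B g)) / 2 + (\<Sum>s\<in>S. 1 - measure iid (conn B F s))"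
      by simp
  qed
  also have "\<dots> = real (card Y) * ((\<Sum>g\<in>?Q. measure iid (B g)) / 2 + (\<Sum>s\<in>S. 1 - measure iid (conn B F s)))"
    by simp
  finally show ?thesis
    using P.ex_le_expectation[OF int] unfolding card1 card2 by auto
qed

lemma comb_cost_le_fixed_price:
  assumes fp: "fixed_price \<Gamma> (ennreal c)" and c: "0 \<le> c"
  shows "comb_cost G \<le> ennreal c"
proof (rule ennreal_le_epsilon)
  fix e :: real assume e: "0 < e"
  \<comment> \<open>Repairs cost at most \<open>\<epsilon>\<close> per generator and the wires at
    most another \<open>\<epsilon> / 2\<close>, so the total excess is at most
    \<open>e\<close>.\<close>
  define \<epsilon> where "\<epsilon> = e / (real (card S) + 1)"
  have \<epsilon>: "\<epsilon> > 0" using e by (simp add: \<epsilon>_def)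
  have \<epsilon>e: "real (card S) * \<epsilon> + \<epsilon> = e"
  proof -
    have "real (card S) + 1 \<noteq> 0" by linarith
    then have "(real (card S) + 1) * \<epsilon> = e" unfolding \<epsilon>_def by simp
    then show ?thesis by (simp add: algebra_simps)
  qed
  obtain F J B where F: "finite F" "F \<subseteq> carrier \<Gamma>" and J: "finite J"
    and B: "\<And>h k. h \<in> F \<Longrightarrow> k \<in> F \<Longrightarrow> B (inv h \<otimes> k) \<in> sets iid \<and> cylinder J (B (inv h \<otimes> k))"
    and sumB: "(\<Sum>g\<in>(\<lambda>(h, k). inv h \<otimes> k) ` (F \<times> F). measure iid (B g)) \<le> 2 * c + \<epsilon>"
    and con: "\<And>s. s \<in> S \<Longrightarrow> 1 - \<epsilon> \<le> measure iid (conn B F s)"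
    using bern_finite_approx[OF fp c \<epsilon>] by metis
  define Q where "Q = (\<lambda>(h, k). inv h \<otimes> k) ` (F \<times> F)"
  have Q: "finite Q" using F by (simp add: Q_def)
  define \<kappa> where "\<kappa> = (\<Sum>g\<in>Q. measure iid (B g)) / 2 + (\<Sum>s\<in>S. 1 - measure iid (conn B F s))"
  have "(\<Sum>s\<in>S. 1 - measure iid (conn B F s)) \<le> (\<Sum>s\<in>S. \<epsilon>)"
    using con by (intro sum_mono) (auto simp: algebra_simps)
  then have \<kappa>: "\<kappa> \<le> c + e" using sumB \<epsilon>e \<epsilon> by (simp add: \<kappa>_def Q_def)
  interpret P1: prob_space "iid :: (nat \<Rightarrow> real) measure" by (rule prob_space_iid)
  have \<kappa>0: "0 \<le> \<kappa>" unfolding \<kappa>_def by (intro add_nonneg_nonneg divide_nonneg_nonneg sum_nonneg) auto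
  obtain D where D: "\<And>n v. v \<in> V n \<Longrightarrow> card {e \<in> E n. v \<in> e} \<le> D" using degree_bound by blast
  \<comment> \<open>Nothing is known about the labels seen from irregular vertices. Each is charged
    the maximal amount, \<open>D\<close> edges and \<open>card Q\<close> wires, which is negligible
    because their proportion vanishes.\<close>
  define Z where "Z n = {v \<in> V n. \<not> regular F J n v}" for n
  have Z: "Z n \<subseteq> V n" for n by (auto simp: Z_def)
  have finZ: "finite (Z n)" for n using finite_subset[OF Z finite_V] .
  have "\<forall>n. \<exists>\<omega>. (\<Sum>v\<in>V n - Z n. real (card {g \<in> Q. label n \<omega> v \<in> B g}) / 2
        + real (card {s \<in> S. label n \<omega> v \<notin> conn B F s})) \<le> real (card (V n - Z n)) * \<kappa>"
    unfolding Q_def \<kappa>_def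
    by (rule allI, rule ex_good_labels[where F=F and B=B and J=J, OF F B]) (auto simp: Z_def)
  from choice[OF this] obtain \<omega> where \<omega>: "\<And>n. (\<Sum>v\<in>V n - Z n. real (card {g \<in> Q. label n (\<omega> n) v \<in> B g}) / 2
        + real (card {s \<in> S. label n (\<omega> n) v \<notin> conn B F s})) \<le> real (card (V n - Z n)) * \<kappa>" by blast
  define H where "H n = wires B Q n (\<omega> n) \<union> repair (conn B F) (Z n) n (\<omega> n)" for n
  have card_H: "real (card (H n)) \<le> real (card (V n)) * \<kappa> + (real D + real (card Q)) * real (card (Z n))" for n
  proof -
    have VZ: "V n = (V n - Z n) \<union> Z n" using Z by auto
    have "2 * real (card (wires B Q n (\<omega> n))) \<le> real (\<Sum>u\<in>V n. card {g \<in> Q. label n (\<omega> n) u \<in> B g})"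
      using card_wires_le[OF F(2,1), of B n "\<omega> n"] unfolding Q_def by linarith
    also have "\<dots> = (\<Sum>u\<in>V n - Z n. real (card {g \<in> Q. label n (\<omega> n) u \<in> B g})) + (\<Sum>u\<in>Z n. real (card {g \<in> Q. label n (\<omega> n) u \<in> B g}))"
      by (subst VZ, subst sum.union_disjoint) (use finZ in auto)
    also have "(\<Sum>u\<in>Z n. real (card {g \<in> Q. label n (\<omega> n) u \<in> B g})) \<le> (\<Sum>u\<in>Z n. real (card Q))"
      using Q by (intro sum_mono of_nat_mono card_mono) auto
    finally have "2 * real (card (wires B Q n (\<omega> n))) \<le>
        (\<Sum>u\<in>V n - Z n. real (card {g \<in> Q. label n (\<omega> n) u \<in> B g})) + real (card Q) * real (card (Z n))"
      by (simp add: mult.commute)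
    moreover have "0 \<le> real (card Q) * real (card (Z n))" by (rule mult_nonneg_nonneg) simp_all
    ultimately have w: "real (card (wires B Q n (\<omega> n))) \<le>
        (\<Sum>u\<in>V n - Z n. real (card {g \<in> Q. label n (\<omega> n) u \<in> B g}) / 2) + real (card Q) * real (card (Z n))"
      unfolding sum_divide_distrib[symmetric] by linarith
    have r: "real (card (repair (conn B F) (Z n) n (\<omega> n))) \<le>
        real D * real (card (Z n)) + (\<Sum>v\<in>V n - Z n. real (card {s \<in> S. label n (\<omega> n) v \<notin> conn B F s}))"
      using of_nat_mono[OF card_repair_le[OF D Z, where C="conn B F" and \<omega>="\<omega> n"], where 'a=real] by simp
    have "real (card (H n)) \<le> real (card (wires B Q n (\<omega> n))) + real (card (repair (conn B F) (Z n) n (\<omega> n)))"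
      unfolding H_def using card_Un_le by (metis of_nat_add of_nat_mono)
    also have "\<dots> \<le> real (card (V n - Z n)) * \<kappa> + (real D + real (card Q)) * real (card (Z n))"
      using w r \<omega>[of n] by (simp add: sum.distrib algebra_simps)
    also have "real (card (V n - Z n)) * \<kappa> \<le> real (card (V n)) * \<kappa>"
      using \<kappa>0 by (intro mult_right_mono of_nat_mono card_mono) auto
    finally show ?thesis by simp
  qed
  \<comment> \<open>The 1 covers edges of \<open>E n\<close> that are kept,
    \<open>card (F \<times> F)\<close> the detour along wires around a dropped edge, and the word
    lengths the distance in \<open>G n\<close> between the ends of a wire.\<close>
  define L where "L = 1 + card (F \<times> F) + (\<Sum>g\<in>Q. length (word g))"
  have "rewiring G H"
    unfolding rewiring_def
  proof (intro conjI allI exI[of _ L] ballI)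
    show "1 \<le> L" by (simp add: L_def)
    fix n
    show "H n \<subseteq> {e. e \<subseteq> V n \<and> card e = 2}"
      using E_sub by (auto simp: H_def wires_def wire_def repair_def)
    fix x y
    show "gdist (H n) x y \<le> enat L * gdist (E n) x y"
    proof (rule gdist_le_mult)
      fix v u assume e: "{v, u} \<in> E n"
      have v: "v \<in> V n" using e E_sub by auto
      show "gdist (H n) v u \<le> enat L"
      proof (cases "{v, u} \<in> repair (conn B F) (Z n) n (\<omega> n)")
        case True
        then have "gdist (H n) v u \<le> enat 1" by (intro gdist_edge) (simp add: H_def)
        also have "\<dots> \<le> enat L" by (simp add: L_def)
        finally show ?thesis .
      next
        case False
        \<comment> \<open>An edge that was not repaired has no irregular end, and the connection
          event for its generator holds at \<open>v\<close>; wires therefore join its ends.\<close>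
        then have reg: "regular F J n v" using e v by (auto simp: repair_def Z_def)
        then obtain s where s: "s \<in> S" "u = act n v s" using e unfolding regular_def by blast
        then have "label n (\<omega> n) v \<in> conn B F s" using False e by (auto simp: repair_def)
        then have "gdist (wires B Q n (\<omega> n)) v u \<le> enat (card (F \<times> F))"
          unfolding Q_def s(2) using B by (intro gdist_wires[where F=F and B=B and J=J, OF F(2,1) _ v reg s(1)]) auto
        then have "gdist (H n) v u \<le> enat (card (F \<times> F))"
          by (rule gdist_mono[rotated]) (auto simp: H_def)
        also have "\<dots> \<le> enat L" by (simp add: L_def)
        finally show ?thesis .
      qed
    qed (simp add: L_def)
    show "gdist (E n) x y \<le> enat L * gdist (H n) x y"
    proof (rule gdist_le_mult)
      fix v u assume e: "{v, u} \<in> H n"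
      show "gdist (E n) v u \<le> enat L"
      proof (cases "{v, u} \<in> E n")
        case True
        then have "gdist (E n) v u \<le> enat 1" by (rule gdist_edge)
        also have "\<dots> \<le> enat L" by (simp add: L_def)
        finally show ?thesis .
      next
        case False
        then have "{v, u} \<in> wires B Q n (\<omega> n)" using e by (auto simp: H_def repair_def)
        then obtain v' u' where "{v, u} = {v', u'}" "wire B Q n (\<omega> n) v' u'" unfolding wires_def by blast
        then have "wire B Q n (\<omega> n) v u"
          using wire_sym[OF F(2), of B n "\<omega> n" v' u'] unfolding Q_def by (auto simp: doubleton_eq_iff)
        then obtain g where g: "g \<in> Q" "u = act n v g" unfolding wire_def by blast
        have "gdist (E n) v u \<le> enat (length (word g))" unfolding g(2) by (rule gdist_act)
        also have "\<dots> \<le> enat (\<Sum>g\<in>Q. length (word g))"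
          using member_le_sum[OF g(1), of "\<lambda>g. length (word g)"] Q by simp
        also have "\<dots> \<le> enat L" by (simp add: L_def)
        finally show ?thesis .
      qed
    qed (simp add: L_def)
  qed
  then have "comb_cost G \<le> liminf (\<lambda>n. ennreal (real (card (H n)) / real (card (V n))))"
    unfolding comb_cost_def by (intro INF_lower) simp
  also have "\<dots> \<le> liminf (\<lambda>n. ennreal (\<kappa> + (real D + real (card Q)) * (real (card (Z n)) / real (card (V n)))))"
  proof (rule Liminf_mono)
    show "\<forall>\<^sub>F n in sequentially. ennreal (real (card (H n)) / real (card (V n)))
        \<le> ennreal (\<kappa> + (real D + real (card Q)) * (real (card (Z n)) / real (card (V n))))"
      using eventually_card_pos
    proof eventually_elim
      case (elim n)
      have "real (card (H n)) / real (card (V n)) \<le>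
         (real (card (V n)) * \<kappa> + (real D + real (card Q)) * real (card (Z n))) / real (card (V n))"
        using card_H by (rule divide_right_mono) simp
      also have "\<dots> = \<kappa> + (real D + real (card Q)) * (real (card (Z n)) / real (card (V n)))"
        using elim by (auto simp: add_divide_distrib)
      finally show ?case by (rule ennreal_leI)
    qed
  qed
  also have "\<dots> = ennreal \<kappa>"
  proof (rule lim_imp_Liminf)
    have "(\<lambda>n. real (card (Z n)) / real (card (V n))) \<longlonglongrightarrow> 0"
      using aa_regular[OF F J] unfolding aa_def Z_def .
    then have "(\<lambda>n. \<kappa> + (real D + real (card Q)) * (real (card (Z n)) / real (card (V n)))) \<longlonglongrightarrow> \<kappa> + (real D + real (card Q)) * 0"
      by (intro tendsto_intros)
    then show "(\<lambda>n. ennreal (\<kappa> + (real D + real (card Q)) * (real (card (Z n)) / real (card (V n))))) \<longlonglongrightarrow> ennreal \<kappa>"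
      by (intro tendsto_ennrealI) simp
  qed simp
  also have "\<dots> \<le> ennreal c + ennreal e"
    using \<kappa> c e by (simp add: ennreal_plus[symmetric] ennreal_leI del: ennreal_plus)
  finally show "comb_cost G \<le> ennreal c + ennreal e" .
qed

end

section \<open>Invariant random graphs\<close>

context marked_group
begin

definition shift2 :: "'g \<Rightarrow> (nat \<times> nat \<Rightarrow> 'a) \<Rightarrow> nat \<times> nat \<Rightarrow> 'a" where
  "shift2 g b = (\<lambda>p. b (shift g (fst p), shift g (snd p)))"

definition joint :: "(nat \<times> nat \<Rightarrow> real) \<times> (nat \<Rightarrow> real) \<Rightarrow> 'g \<Rightarrow> (nat \<times> nat \<Rightarrow> real) \<times> (nat \<Rightarrow> real)" where
  "joint y g = (shift2 g (fst y), bern (snd y) g)"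

sublocale joint: right_action \<Gamma> joint
  by unfold_locales (auto simp: joint_def shift2_def shift_shift bern.R_mult)

text \<open>A bit array need not be symmetric; the disjunction turns it into an undirected graph on
  the group.\<close>

definition edge :: "(nat \<times> nat \<Rightarrow> bool) \<Rightarrow> 'g \<Rightarrow> 'g \<Rightarrow> bool" where
  "edge b h k \<longleftrightarrow> b (node h, node k) \<or> b (node k, node h)"

lemma edge_shift2:
  "g \<in> carrier \<Gamma> \<Longrightarrow> h \<in> carrier \<Gamma> \<Longrightarrow> k \<in> carrier \<Gamma> \<Longrightarrow> edge (shift2 g b) h k = edge b (g \<otimes> h) (g \<otimes> k)"
  by (simp add: edge_def shift2_def)

definition linked :: "'g set \<Rightarrow> (nat \<times> nat \<Rightarrow> bool) \<Rightarrow> 'g \<Rightarrow> bool" where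
  "linked F b s \<longleftrightarrow> (\<one>, s) \<in> {(h, k). h \<in> F \<and> k \<in> F \<and> edge b h k}\<^sup>*"

lemma linked_mono: "F \<subseteq> F' \<Longrightarrow> linked F b s \<Longrightarrow> linked F' b s"
  unfolding linked_def by (erule rev_subsetD, rule rtrancl_mono) auto

text \<open>The random graph transferred to orbits: \<open>y\<close> is joined to its translate by
  \<open>g\<close> when its graph joins \<open>\<one>\<close> to \<open>g\<close>. Bits are read
  from real coordinates by a threshold, which keeps the space within the types covered by
  \<open>action_cost_eq_fixed_price\<close>.\<close>

definition random_graph_set :: "((nat \<times> nat \<Rightarrow> real) \<times> (nat \<Rightarrow> real)) rel" where
  "random_graph_set = {(y, z). z \<noteq> y \<and> (\<exists>g\<in>carrier \<Gamma>. z = joint y g \<and> edge (\<lambda>p. fst y p > 1/2) \<one> g)}"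

text \<open>Translating by \<open>h\<close> moves the edge to the identity. The reflexive closure
  allows for points where the action is not free and the two translates coincide.\<close>

lemma joint_edge:
  assumes "h \<in> carrier \<Gamma>" "k \<in> carrier \<Gamma>" "edge (\<lambda>p. fst y p > 1/2) h k"
  shows "(joint y h, joint y k) \<in> random_graph_set\<^sup>="
proof -
  have "(\<lambda>p. fst (joint y h) p > 1/2) = shift2 h (\<lambda>p. fst y p > 1/2)"
    by (simp add: joint_def shift2_def fun_eq_iff)
  then have "edge (\<lambda>p. fst (joint y h) p > 1/2) \<one> (inv h \<otimes> k)"
    using assms by (simp add: edge_shift2 m_assoc[symmetric])
  moreover have "joint y k = joint (joint y h) (inv h \<otimes> k)"
    using assms by (simp add: joint.R_mult m_assoc[symmetric])
  ultimately show ?thesis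
    unfolding random_graph_set_def using assms by (cases "joint y k = joint y h") auto
qed

lemma sym_random_graph_set: "sym random_graph_set"
proof (rule symI)
  fix y z assume yz: "(y, z) \<in> random_graph_set"
  then obtain g where g: "g \<in> carrier \<Gamma>" "z = joint y g" "edge (\<lambda>p. fst y p > 1/2) \<one> g" and ne: "z \<noteq> y"
    unfolding random_graph_set_def by blast
  have "edge (\<lambda>p. fst y p > 1/2) g \<one>" using g(3) by (auto simp: edge_def)
  from joint_edge[OF g(1) one_closed this] ne g(2) show "(z, y) \<in> random_graph_set" by auto
qed

lemma linked_joint:
  assumes "linked (carrier \<Gamma>) (\<lambda>p. fst y p > 1/2) s"
  shows "(y, joint y s) \<in> random_graph_set\<^sup>*"
proof -
  have "(joint y \<one>, joint y h) \<in> random_graph_set\<^sup>*"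
    if "(\<one>, h) \<in> {(h, k). h \<in> carrier \<Gamma> \<and> k \<in> carrier \<Gamma> \<and> edge (\<lambda>p. fst y p > 1/2) h k}\<^sup>*" for h
    using that
  proof induction
    case (step h k)
    then have "(joint y h, joint y k) \<in> random_graph_set\<^sup>=" by (intro joint_edge) auto
    with step.IH show ?case by (auto intro: rtrancl.rtrancl_into_rtrancl)
  qed simp
  then show ?thesis using assms unfolding linked_def by simp
qed

text \<open>It suffices to join \<open>\<one>\<close> to each generator in the graph of every
  translate: following a word letter by letter then reaches the whole orbit.\<close>

lemma joint_class:
  assumes "\<And>g s. g \<in> carrier \<Gamma> \<Longrightarrow> s \<in> S \<Longrightarrow> linked (carrier \<Gamma>) (\<lambda>p. fst (joint y g) p > 1/2) s"
  shows "random_graph_set\<^sup>* `` {y} = {joint y g |g. g \<in> carrier \<Gamma>}"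
proof (intro equalityI subsetI)
  fix z assume "z \<in> random_graph_set\<^sup>* `` {y}"
  then have "(y, z) \<in> random_graph_set\<^sup>*" by simp
  then show "z \<in> {joint y g |g. g \<in> carrier \<Gamma>}"
  proof induction
    case base
    show ?case using joint.R_one[of y] one_closed by (metis (mono_tags, lifting) mem_Collect_eq)
  next
    case (step z z')
    then obtain g h where "g \<in> carrier \<Gamma>" "h \<in> carrier \<Gamma>" "z = joint y g" "z' = joint z h"
      unfolding random_graph_set_def by blast
    then have "z' = joint y (g \<otimes> h)" "g \<otimes> h \<in> carrier \<Gamma>" by (auto simp: joint.R_mult)
    then show ?case by blast
  qed
next
  fix z assume "z \<in> {joint y g |g. g \<in> carrier \<Gamma>}"
  then obtain g where g: "g \<in> carrier \<Gamma>" "z = joint y g" by blast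
  have "(y, joint y (word_prod w)) \<in> random_graph_set\<^sup>*" if "w \<in> lists S" for w
    using that
  proof (induction w rule: rev_induct)
    case (snoc s w)
    then have s: "s \<in> S" "w \<in> lists S" by auto
    have sc: "s \<in> carrier \<Gamma>" using s S_carrier by auto
    have "word_prod (w @ [s]) = word_prod w \<otimes> s" using s sc by (subst word_prod_append) auto
    then have "joint y (word_prod (w @ [s])) = joint (joint y (word_prod w)) s"
      using s sc by (simp add: joint.R_mult)
    moreover have "(joint y (word_prod w), joint (joint y (word_prod w)) s) \<in> random_graph_set\<^sup>*"
      using assms[OF _ s(1), of "word_prod w"] s(2) by (intro linked_joint) simp
    ultimately show ?case using snoc.IH[OF s(2)] by simp
  qed simp
  then show "z \<in> random_graph_set\<^sup>* `` {y}" using word[OF g(1)] g by fastforce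
qed

section \<open>Measurability of the random graph and the resulting cost bound\<close>

lemma measurable_shift2: "shift2 g \<in> borel_measurable (borel :: (nat \<times> nat \<Rightarrow> real) measure)"
proof (rule measurable_coordinatewise_then_product)
  fix i
  have "(\<lambda>x::nat \<times> nat \<Rightarrow> real. x (shift g (fst i), shift g (snd i))) \<in> borel_measurable borel"
    by (rule measurable_product_coordinates)
  then show "(\<lambda>x. shift2 g x i) \<in> borel_measurable (borel :: (nat \<times> nat \<Rightarrow> real) measure)"
    by (simp add: shift2_def)
qed

lemma measurable_bern_borel: "(\<lambda>x. bern x g) \<in> borel_measurable borel"
proof (rule measurable_coordinatewise_then_product)
  fix i
  have "(\<lambda>x::nat \<Rightarrow> real. x (shift g i)) \<in> borel_measurable borel"
    by (rule measurable_product_coordinates)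
  then show "(\<lambda>x. bern x g i) \<in> borel_measurable borel" by (simp add: bern_def)
qed

lemma measurable_joint: "(\<lambda>y. joint y g) \<in> borel_measurable borel"
  unfolding joint_def
  by (intro borel_measurable_Pair measurable_compose[OF _ measurable_shift2] measurable_compose[OF _ measurable_bern_borel])
    (auto intro!: borel_measurable_continuous_onI continuous_on_fst continuous_on_snd continuous_on_id)

lemma sets_edge:
  "{y :: (nat \<times> nat \<Rightarrow> real) \<times> (nat \<Rightarrow> real). edge (\<lambda>p. fst y p > 1/2) h k} \<in> sets borel"
proof -
  have m: "(\<lambda>y :: (nat \<times> nat \<Rightarrow> real) \<times> (nat \<Rightarrow> real). fst y p) \<in> borel_measurable borel" for p
  proof (rule measurable_compose[OF _ measurable_product_coordinates])
    show "fst \<in> borel_measurable (borel :: ((nat \<times> nat \<Rightarrow> real) \<times> (nat \<Rightarrow> real)) measure)"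
      by (intro borel_measurable_continuous_onI continuous_on_fst continuous_on_id)
  qed
  have one: "{y :: (nat \<times> nat \<Rightarrow> real) \<times> (nat \<Rightarrow> real). 1/2 < fst y p} \<in> sets borel" for p
  proof -
    have "{y :: (nat \<times> nat \<Rightarrow> real) \<times> (nat \<Rightarrow> real). 1/2 < fst y p} = (\<lambda>y. fst y p) -` {1/2<..} \<inter> space borel"
      by auto
    then show ?thesis using measurable_sets[OF m[of p] borel_open[OF open_greaterThan]] by (simp only:)
  qed
  have "{y. 1/2 < fst y (node h, node k)} \<union> {y :: (nat \<times> nat \<Rightarrow> real) \<times> (nat \<Rightarrow> real). 1/2 < fst y (node k, node h)} \<in> sets borel"
    by (rule sets.Un[OF one one])
  moreover have "{y :: (nat \<times> nat \<Rightarrow> real) \<times> (nat \<Rightarrow> real). edge (\<lambda>p. fst y p > 1/2) h k} =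
      {y. 1/2 < fst y (node h, node k)} \<union> {y. 1/2 < fst y (node k, node h)}"
    by (auto simp: edge_def)
  ultimately show ?thesis by (simp only:)
qed

text \<open>The relation is a countable union, over group elements, of pieces of graphs of
  measurable maps, minus the diagonal.\<close>

lemma sets_random_graph_set: "random_graph_set \<in> sets (borel \<Otimes>\<^sub>M borel)"
proof -
  have f: "fst \<in> borel_measurable (borel \<Otimes>\<^sub>M (borel :: ((nat \<times> nat \<Rightarrow> real) \<times> (nat \<Rightarrow> real)) measure))"
    and s: "snd \<in> borel_measurable ((borel :: ((nat \<times> nat \<Rightarrow> real) \<times> (nat \<Rightarrow> real)) measure) \<Otimes>\<^sub>M borel)" by measurable
  let ?X = "(borel :: ((nat \<times> nat \<Rightarrow> real) \<times> (nat \<Rightarrow> real)) measure)"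
  have sp: "space (?X \<Otimes>\<^sub>M ?X) = UNIV" by (simp add: space_pair_measure)
  have eq: "{p. snd p = joint (fst p) g} \<in> sets (?X \<Otimes>\<^sub>M ?X)" for g
    using measurable_equality_set[OF s measurable_compose[OF f measurable_joint[of g]]] sp by simp
  have diag: "{p. snd p = fst p} \<in> sets (?X \<Otimes>\<^sub>M ?X)"
    using measurable_equality_set[OF s f] sp by simp
  have e: "{p. edge (\<lambda>q. fst (fst p) q > 1/2) \<one> g} \<in> sets (?X \<Otimes>\<^sub>M ?X)" for g
    using measurable_sets[OF f sets_edge[of \<one> g]] sp by (simp add: vimage_def)
  have "random_graph_set = (\<Union>g\<in>carrier \<Gamma>. {p. snd p = joint (fst p) g} \<inter> {p. edge (\<lambda>q. fst (fst p) q > 1/2) \<one> g}) - {p. snd p = fst p}"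
    unfolding random_graph_set_def by auto
  also have "\<dots> \<in> sets (?X \<Otimes>\<^sub>M ?X)"
    by (intro sets.Diff sets.countable_UN' countable_carrier image_subsetI sets.Int eq e diag)
  finally show ?thesis .
qed

text \<open>The interface to the limit argument: invariance, degree and connectedness are all
  demanded in terms of finitely many coordinates, the only form in which a weak limit supplies
  them.\<close>

lemma fixed_price_le_random_graph:
  fixes M :: "real measure" and D :: "real \<Rightarrow> nat \<times> nat \<Rightarrow> bool"
  assumes fp: "fixed_price \<Gamma> c" and M: "prob_space M" "sets M = sets borel"
    and D: "\<And>p. {z. D z p} \<in> sets M"
    and inv: "\<And>g J \<Phi>. g \<in> carrier \<Gamma> \<Longrightarrow> finite J \<Longrightarrow> cylinder J (Collect \<Phi>) \<Longrightarrow>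
      measure M {z. \<Phi> (shift2 g (D z))} = measure M {z. \<Phi> (D z)}"
    and sum: "\<And>K. finite K \<Longrightarrow> K \<subseteq> carrier \<Gamma> \<Longrightarrow> (\<Sum>g\<in>K. measure M {z. edge (D z) \<one> g}) \<le> 2 * t"
    and lnk: "\<And>s. s \<in> S \<Longrightarrow> \<exists>F. finite F \<and> F \<subseteq> carrier \<Gamma> \<and> measure M {z. linked F (D z) s} = 1"
  shows "c \<le> ennreal t"
proof -
  interpret M: prob_space M by fact
  have spM: "space M = UNIV" using sets_eq_imp_space_eq[OF M(2)] by simp
  define N where "N = (iid :: (nat \<Rightarrow> real) measure)"
  have pN: "prob_space N" unfolding N_def by (rule prob_space_iid)
  interpret N: prob_space N by (rule pN)
  have sN: "sets N = sets borel" unfolding N_def by (rule sets_iid)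
  have dN: "distr N N (\<lambda>x. bern x g) = N" if "g \<in> carrier \<Gamma>" for g
    unfolding N_def by (rule distr_bern[OF that])
  have mN: "(\<lambda>x. bern x g) \<in> N \<rightarrow>\<^sub>M N" for g unfolding N_def by (rule measurable_bern)
  have freeN: "AE x in N. \<forall>g\<in>carrier \<Gamma>. bern x g = x \<longrightarrow> g = \<one>" unfolding N_def by (rule AE_bern_free)
  define E where "E z = (\<lambda>p. of_bool (D z p) :: real)" for z
  have DE: "(\<lambda>p. E z p > 1/2) = D z" for z by (auto simp: E_def fun_eq_iff)
  have Em: "E \<in> M \<rightarrow>\<^sub>M (borel :: (nat \<times> nat \<Rightarrow> real) measure)"
  proof (rule measurable_coordinatewise_then_product)
    fix p
    have "(\<lambda>z. E z p) = indicator {z. D z p}" by (auto simp: E_def indicator_def)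
    then show "(\<lambda>z. E z p) \<in> borel_measurable M" using D[of p] by simp
  qed
  define \<nu> where "\<nu> = distr M borel E"
  have s\<nu>: "sets \<nu> = sets borel" and sp\<nu>: "space \<nu> = UNIV" by (simp_all add: \<nu>_def)
  interpret \<nu>: prob_space \<nu> unfolding \<nu>_def using Em by (rule M.prob_space_distr)
  have m\<nu>: "shift2 g \<in> \<nu> \<rightarrow>\<^sub>M \<nu>" for g
    using measurable_shift2[of g] measurable_cong_sets[OF s\<nu> s\<nu>] by blast
  \<comment> \<open>Boxes over finitely many coordinates determine the law. The coordinates take the
    values 0 and 1, so a box becomes a cylinder event of the bits, to which \<open>inv\<close>
    applies.\<close>
  have d\<nu>: "distr \<nu> \<nu> (shift2 g) = \<nu>" if g: "g \<in> carrier \<Gamma>" for g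
  proof (rule measure_eqI_PiM_infinite[where I=UNIV and M="\<lambda>_. borel"])
    show "sets (distr \<nu> \<nu> (shift2 g)) = sets (PiM UNIV (\<lambda>_. borel))" "sets \<nu> = sets (PiM UNIV (\<lambda>_. borel))"
      by (simp_all add: s\<nu> sets_PiM_equal_borel)
    show "finite_measure (distr \<nu> \<nu> (shift2 g))"
      by (rule prob_space.finite_measure[OF \<nu>.prob_space_distr[OF m\<nu>]])
    fix A :: "nat \<times> nat \<Rightarrow> real set" and J assume J: "finite J" "J \<subseteq> UNIV" and A: "\<And>i. i \<in> J \<Longrightarrow> A i \<in> sets borel"
    let ?B = "prod_emb UNIV (\<lambda>_. borel) J (Pi\<^sub>E J A)"
    have B: "?B \<in> sets \<nu>"
      unfolding s\<nu> sets_PiM_equal_borel[symmetric] using J A by (intro sets_PiM_I) auto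
    have Beq: "?B = {x. \<forall>i\<in>J. x i \<in> A i}" by (auto simp: prod_emb_def PiE_def Pi_def)
    define \<Phi> where "\<Phi> b \<longleftrightarrow> (\<forall>i\<in>J. (of_bool (b i) :: real) \<in> A i)" for b
    have cyl: "cylinder J (Collect \<Phi>)" by (auto simp: cylinder_def \<Phi>_def)
    have "measure \<nu> ?B = measure M {z. \<Phi> (D z)}"
      using B s\<nu> Em by (simp add: \<nu>_def measure_distr vimage_def spM Beq \<Phi>_def E_def)
    moreover have "measure (distr \<nu> \<nu> (shift2 g)) ?B = measure \<nu> (shift2 g -` ?B \<inter> space \<nu>)"
      using B m\<nu> by (intro measure_distr)
    moreover have "measure \<nu> (shift2 g -` ?B \<inter> space \<nu>) = measure M {z. \<Phi> (shift2 g (D z))}"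
    proof -
      have "shift2 g -` ?B \<inter> space \<nu> \<in> sets borel" using measurable_sets[OF m\<nu> B] s\<nu> by simp
      moreover have "E -` (shift2 g -` ?B \<inter> space \<nu>) \<inter> space M = {z. \<Phi> (shift2 g (D z))}"
        by (auto simp: spM sp\<nu> Beq \<Phi>_def E_def shift2_def)
      ultimately show ?thesis using Em by (simp add: \<nu>_def measure_distr)
    qed
    ultimately have "measure (distr \<nu> \<nu> (shift2 g)) ?B = measure \<nu> ?B"
      using inv[OF g J(1) cyl] by simp
    then show "emeasure (distr \<nu> \<nu> (shift2 g)) ?B = emeasure \<nu> ?B"
      using \<nu>.emeasure_eq_measure prob_space.finite_measure[OF \<nu>.prob_space_distr[OF m\<nu>[of g]]]
      by (simp add: finite_measure.emeasure_eq_measure)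
  qed
  define X where "X = \<nu> \<Otimes>\<^sub>M N"
  interpret \<nu>N: pair_prob_space \<nu> N ..
  have pX: "prob_space X" unfolding X_def by (rule \<nu>N.P.prob_space_axioms)
  interpret X: prob_space X by (rule pX)
  have sX: "sets X = sets borel"
  proof -
    have "sets X = sets (borel \<Otimes>\<^sub>M borel)" unfolding X_def by (rule sets_pair_measure_cong[OF s\<nu> sN])
    then show ?thesis by (simp only: borel_prod)
  qed
  have spX: "space X = UNIV" using sets_eq_imp_space_eq[OF sX] by simp
  have mX: "(\<lambda>y. joint y g) \<in> X \<rightarrow>\<^sub>M X" for g
    using measurable_joint[of g] measurable_cong_sets[OF sX sX] by blast
  have dX: "distr X X (\<lambda>y. joint y g) = X" if g: "g \<in> carrier \<Gamma>" for g
  proof -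
    have "sigma_finite_measure (distr N N (\<lambda>x. bern x g))" unfolding dN[OF g] ..
    from pair_measure_distr[OF m\<nu>[of g] mN[of g] this]
    show ?thesis unfolding d\<nu>[OF g] dN[OF g] X_def joint_def case_prod_beta' by simp
  qed
  have pmp: "pmp_action \<Gamma> X joint.lact" by (rule joint.pmp_lact[OF spX mX dX])
  have dsnd: "distr X N snd = N"
  proof -
    have "distr X N snd = distr (distr (N \<Otimes>\<^sub>M \<nu>) (\<nu> \<Otimes>\<^sub>M N) (\<lambda>(x, y). (y, x))) N snd"
      unfolding X_def by (subst \<nu>N.distr_pair_swap) simp
    also have "\<dots> = distr (N \<Otimes>\<^sub>M \<nu>) N (snd \<circ> (\<lambda>(x, y). (y, x)))"
      by (rule distr_distr[OF measurable_snd measurable_pair_swap'])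
    finally have "distr X N snd = distr (N \<Otimes>\<^sub>M \<nu>) N (snd \<circ> (\<lambda>(x, y). (y, x)))" .
    moreover have "snd \<circ> (\<lambda>(x, y). (y, x)) = (fst :: (nat \<Rightarrow> real) \<times> (nat \<times> nat \<Rightarrow> real) \<Rightarrow> _)"
      by (auto simp: fun_eq_iff)
    ultimately show ?thesis by (simp only: \<nu>.distr_pair_fst)
  qed
  have dfst: "distr X \<nu> fst = \<nu>" unfolding X_def by (rule N.distr_pair_fst)
  have msnd: "snd \<in> X \<rightarrow>\<^sub>M N" and mfst: "fst \<in> X \<rightarrow>\<^sub>M \<nu>" unfolding X_def by (rule measurable_snd, rule measurable_fst)
  \<comment> \<open>An element that fixes a pair fixes its second component, where the Bernoulli
    action is free.\<close>
  have "AE y in X. \<forall>g\<in>carrier \<Gamma>. bern (snd y) g = snd y \<longrightarrow> g = \<one>"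
    by (rule AE_distrD[OF msnd]) (unfold dsnd, rule freeN)
  then have free: "essentially_free \<Gamma> X joint.lact"
    unfolding essentially_free_def joint.stabilizer_lact
    by eventually_elim (auto simp: joint_def prod_eq_iff)
  obtain f :: "(nat \<times> nat \<Rightarrow> real) \<times> (nat \<Rightarrow> real) \<Rightarrow> real" where "bij f" using ex_bij_fun_prod_reals by blast
  from action_cost_eq_fixed_price[OF fp is_group this sX pX pmp free]
  have cost: "action_cost \<Gamma> X joint.lact = c" .
  have transfer: "AE y in X. P (\<lambda>p. fst y p > 1/2)" if ae: "AE z in M. P (D z)" and
    meas: "{x :: nat \<times> nat \<Rightarrow> real. P (\<lambda>p. x p > 1/2)} \<in> sets borel" for P
  proof -
    have "{x \<in> space (borel :: (nat \<times> nat \<Rightarrow> real) measure). P (\<lambda>p. x p > 1/2)} = {x :: nat \<times> nat \<Rightarrow> real. P (\<lambda>p. x p > 1/2)}" by simp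
    then have "{x \<in> space (borel :: (nat \<times> nat \<Rightarrow> real) measure). P (\<lambda>p. x p > 1/2)} \<in> sets borel" using meas by (simp only:)
    from AE_distr_iff[OF Em this] have "AE x in \<nu>. P (\<lambda>p. x p > 1/2)"
      unfolding \<nu>_def DE using ae by blast
    then have "AE x in distr X \<nu> fst. P (\<lambda>p. x p > 1/2)" unfolding dfst .
    then show ?thesis by (rule AE_distrD[OF mfst])
  qed
  have sl: "{x::nat \<times> nat \<Rightarrow> real. linked F (\<lambda>p. x p > 1/2) s} \<in> sets borel" if F: "finite F" for F s
  proof -
    have one: "{x::nat \<times> nat \<Rightarrow> real. edge (\<lambda>p. x p > 1/2) h k} \<in> sets borel" for h k
    proof -
      have "(\<lambda>x::nat \<times> nat \<Rightarrow> real. (x, \<lambda>_::nat. 0::real)) \<in> borel_measurable borel"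
        by (intro borel_measurable_continuous_onI continuous_intros)
      from measurable_sets[OF this sets_edge[of h k]] show ?thesis by (simp add: vimage_def)
    qed
    have two: "{x::nat \<times> nat \<Rightarrow> real. edge (\<lambda>p. x p > 1/2) h k \<longleftrightarrow> a} \<in> sets borel" for h k a
    proof (cases a)
      case False
      have "{x::nat \<times> nat \<Rightarrow> real. edge (\<lambda>p. x p > 1/2) h k \<longleftrightarrow> a} = space borel - {x. edge (\<lambda>p. x p > 1/2) h k}"
        using False by auto
      then show ?thesis using sets.compl_sets[OF one[of h k]] by (simp only:)
    qed (use one in simp)
    have "{x::nat \<times> nat \<Rightarrow> real. linked F (\<lambda>p. x p > 1/2) s} =
      (\<Union>T\<in>{T. T \<subseteq> F \<times> F \<and> (\<one>, s) \<in> T\<^sup>*}. {x. {(h, k). h \<in> F \<and> k \<in> F \<and> edge (\<lambda>p. x p > 1/2) h k} = T})"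
      unfolding linked_def by auto
    also have "\<dots> = (\<Union>T\<in>{T. T \<subseteq> F \<times> F \<and> (\<one>, s) \<in> T\<^sup>*}. \<Inter>h\<in>F. \<Inter>k\<in>F. {x. edge (\<lambda>p. x p > 1/2) h k \<longleftrightarrow> (h, k) \<in> T})"
      by (intro SUP_cong refl) auto
    also have "\<dots> \<in> sets borel"
    proof (intro sets.finite_UN)
      show "finite {T. T \<subseteq> F \<times> F \<and> (\<one>, s) \<in> T\<^sup>*}" using F by auto
      fix T assume "T \<in> {T. T \<subseteq> F \<times> F \<and> (\<one>, s) \<in> T\<^sup>*}"
      have "(\<Inter>h\<in>F. B h) \<in> sets borel" if "\<And>h. B h \<in> sets (borel :: (nat \<times> nat \<Rightarrow> real) measure)" for B
        using that F by (cases "F = {}") auto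
      then show "(\<Inter>h\<in>F. \<Inter>k\<in>F. {x::nat \<times> nat \<Rightarrow> real. edge (\<lambda>p. x p > 1/2) h k \<longleftrightarrow> (h, k) \<in> T}) \<in> sets borel"
        using two by simp
    qed
    finally show ?thesis .
  qed
  have AEl: "AE y in X. linked (carrier \<Gamma>) (\<lambda>p. fst y p > 1/2) s" if s: "s \<in> S" for s
  proof -
    obtain F where F: "finite F" "F \<subseteq> carrier \<Gamma>" "measure M {z. linked F (D z) s} = 1" using lnk[OF s] by blast
    have "{z. linked F (D z) s} = E -` {x. linked F (\<lambda>p. x p > 1/2) s} \<inter> space M" by (simp only: DE spM vimage_def Int_UNIV_right mem_Collect_eq)
    then have "{z. linked F (D z) s} \<in> sets M" using measurable_sets[OF Em sl[OF F(1), of s]] by simp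
    then have "AE z in M. linked F (D z) s" using M.prob_eq_1[of "{z. linked F (D z) s}"] F(3) by simp
    from transfer[OF this sl[OF F(1)]] show ?thesis
      by eventually_elim (rule linked_mono[OF F(2)])
  qed
  \<comment> \<open>Invariance carries the link from the identity to every translate; countability
    then gathers all translates into one almost sure event.\<close>
  have "AE y in X. linked (carrier \<Gamma>) (\<lambda>p. fst (joint y g) p > 1/2) s" if "s \<in> S" "g \<in> carrier \<Gamma>" for s g
    by (rule AE_distrD[OF mX[of g]]) (unfold dX[OF that(2)], rule AEl[OF that(1)])
  then have "AE y in X. \<forall>s\<in>S. \<forall>g\<in>carrier \<Gamma>. linked (carrier \<Gamma>) (\<lambda>p. fst (joint y g) p > 1/2) s"
    using countable_carrier finite_S by (intro AE_ball_countable[THEN iffD2] ballI) (auto simp: countable_finite)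
  then have cls: "AE y in X. random_graph_set\<^sup>* `` {y} = orbit_rel \<Gamma> X joint.lact `` {y}"
  proof eventually_elim
    case (elim y)
    have "orbit_rel \<Gamma> X joint.lact `` {y} = {joint y g |g. g \<in> carrier \<Gamma>}"
      unfolding set_eq_iff Image_singleton_iff joint.orbit_rel_lact[OF spX] by blast
    then show ?case using joint_class[of y] elim by simp
  qed
  have "graphing X (orbit_rel \<Gamma> X joint.lact) random_graph_set"
    unfolding graphing_def
  proof (intro conjI cls sym_random_graph_set)
    show "random_graph_set \<in> sets (X \<Otimes>\<^sub>M X)"
      using sets_random_graph_set sets_pair_measure_cong[OF sX sX] by simp
    show "irrefl random_graph_set" by (auto simp: irrefl_def random_graph_set_def)
    show "random_graph_set \<subseteq> orbit_rel \<Gamma> X joint.lact"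
      using joint.orbit_rel_lact[OF spX] unfolding random_graph_set_def by blast
  qed
  then have "c \<le> (\<integral>\<^sup>+ y. emeasure (count_space UNIV) (random_graph_set `` {y}) \<partial>X) / 2"
    unfolding cost[symmetric] action_cost_def rel_cost_def
    by (intro divide_right_mono_ennreal INF_lower) simp
  also have "\<dots> \<le> ennreal (2 * t) / 2"
  proof (rule divide_right_mono_ennreal)
    define Ed where "Ed g = {y :: (nat \<times> nat \<Rightarrow> real) \<times> (nat \<Rightarrow> real). edge (\<lambda>p. fst y p > 1/2) \<one> g}" for g
    have Ed: "Ed g \<in> sets X" for g unfolding Ed_def sX by (rule sets_edge)
    \<comment> \<open>Counting group elements instead of neighbors bounds the degree from above by a
      measurable function, even where the action is not free. The balls increase, so monotone
      convergence reduces the bound to finite sums.\<close>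
    define C where "C m y = (\<Sum>g\<in>cball m. indicator (Ed g) y :: ennreal)" for m y
    have Cm: "C m \<in> borel_measurable X" for m unfolding C_def using Ed by simp
    have mEd: "measure X (Ed g) = measure M {z. edge (D z) \<one> g}" for g
    proof -
      let ?A = "{x::nat \<times> nat \<Rightarrow> real. edge (\<lambda>p. x p > 1/2) \<one> g}"
      have "(\<lambda>x::nat \<times> nat \<Rightarrow> real. (x, \<lambda>_::nat. 0::real)) \<in> borel_measurable borel"
        by (intro borel_measurable_continuous_onI continuous_intros)
      from measurable_sets[OF this sets_edge[of \<one> g]] have A: "?A \<in> sets borel" by (simp add: vimage_def)
      have "measure X (Ed g) = measure X (fst -` ?A \<inter> space X)" by (simp add: Ed_def spX vimage_def)
      also have "\<dots> = measure \<nu> ?A" using measure_distr[OF mfst, of ?A] A s\<nu> dfst by simp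
      also have "\<dots> = measure M (E -` ?A \<inter> space M)" unfolding \<nu>_def using measure_distr[OF Em A] by simp
      finally show ?thesis by (simp only: DE spM vimage_def Int_UNIV_right mem_Collect_eq)
    qed
    have "(\<integral>\<^sup>+ y. emeasure (count_space UNIV) (random_graph_set `` {y}) \<partial>X) \<le> (\<integral>\<^sup>+ y. (SUP m. C m y) \<partial>X)"
    proof (rule nn_integral_mono)
      fix y
      define W where "W m = joint y ` {g \<in> cball m. y \<in> Ed g}" for m
      have incW: "incseq W" unfolding W_def incseq_def using cball_mono by blast
      have "random_graph_set `` {y} \<subseteq> (\<Union>m. W m)"
        unfolding random_graph_set_def W_def Ed_def using Union_cball by blast
      then have "emeasure (count_space UNIV) (random_graph_set `` {y}) \<le> emeasure (count_space UNIV) (\<Union>m. W m)"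
        by (intro emeasure_mono) auto
      also have "\<dots> = (SUP m. emeasure (count_space UNIV) (W m))"
        using incW by (intro SUP_emeasure_incseq[symmetric]) auto
      also have "\<dots> \<le> (SUP m. C m y)"
      proof (rule SUP_mono)
        fix m
        have "emeasure (count_space UNIV) (W m) = of_nat (card (W m))"
          by (simp add: W_def emeasure_count_space_finite)
        also have "\<dots> \<le> of_nat (card {g \<in> cball m. y \<in> Ed g})"
          unfolding W_def by (intro of_nat_mono card_image_le) simp
        also have "\<dots> = C m y" unfolding C_def by (simp add: indicator_def sum.If_cases Int_def)
        finally show "\<exists>m'\<in>UNIV. emeasure (count_space UNIV) (W m) \<le> C m' y" by blast
      qed
      finally show "emeasure (count_space UNIV) (random_graph_set `` {y}) \<le> (SUP m. C m y)" .
    qed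
    also have "\<dots> = (SUP m. \<integral>\<^sup>+ y. C m y \<partial>X)"
    proof (rule nn_integral_monotone_convergence_SUP[OF _ Cm])
      show "incseq C"
        unfolding incseq_def le_fun_def C_def using cball_mono by (auto intro!: sum_mono2)
    qed
    also have "\<dots> \<le> ennreal (2 * t)"
    proof (rule SUP_least)
      fix m
      have "(\<integral>\<^sup>+ y. C m y \<partial>X) = (\<Sum>g\<in>cball m. emeasure X (Ed g))"
        unfolding C_def using Ed by (subst nn_integral_sum) auto
      also have "\<dots> = ennreal (\<Sum>g\<in>cball m. measure M {z. edge (D z) \<one> g})"
        unfolding X.emeasure_eq_measure mEd by (simp add: sum_ennreal)
      also have "\<dots> \<le> ennreal (2 * t)" by (intro ennreal_leI sum cball_carrier) simp
      finally show "(\<integral>\<^sup>+ y. C m y \<partial>X) \<le> ennreal (2 * t)" .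
    qed
    finally show "(\<integral>\<^sup>+ y. emeasure (count_space UNIV) (random_graph_set `` {y}) \<partial>X) \<le> ennreal (2 * t)" .
  qed
  also have "\<dots> = ennreal t"
  proof -
    \<comment> \<open>The degree bound for the empty set of group elements.\<close>
    have "0 \<le> 2 * t" using sum[of "{}"] by simp
    then show ?thesis using divide_ennreal[of "2 * t" 2] by simp
  qed
  finally show ?thesis .
qed

end

section \<open>Weak limits of random bit sequences\<close>

text \<open>Base 4 with digits 0 and 1 produces a Cantor set: codes with different leading digits
  are separated by a gap, so digits can be recovered by continuous functions.\<close>

definition encode4 :: "(nat \<Rightarrow> bool) \<Rightarrow> real" where
  "encode4 b = (\<Sum>i. of_bool (b i) / 4 ^ Suc i)"

text \<open>A code with leading digit 0 is at most 1/12, one with leading digit 1 at least 1/4. The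
  function is 0 up to the first value, 1 from the second on, and linear in between.\<close>

definition digit0 :: "real \<Rightarrow> real" where
  "digit0 z = max 0 (min 1 (6 * z - 1/2))"

primrec digit :: "nat \<Rightarrow> real \<Rightarrow> real" where
  "digit 0 z = digit0 z"
| "digit (Suc i) z = digit i (4 * z - digit0 z)"

lemma summable_encode4: "summable (\<lambda>i. of_bool (b i) / 4 ^ Suc i :: real)"
proof (rule summable_comparison_test'[where N=0 and g="\<lambda>i. (1/4) ^ i"])
  show "summable (\<lambda>i. (1/4) ^ i :: real)" by (rule summable_geometric) simp
  show "norm (of_bool (b i) / 4 ^ Suc i :: real) \<le> (1/4) ^ i" for i
    by (simp add: power_one_over divide_simps)
qed

lemma encode4_Suc: "encode4 b = (of_bool (b 0) + encode4 (\<lambda>i. b (Suc i))) / 4"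
proof -
  have "encode4 b = of_bool (b 0) / 4 + (\<Sum>i. of_bool (b (Suc i)) / 4 ^ Suc (Suc i))"
    unfolding encode4_def using suminf_split_head[OF summable_encode4[of b]] by simp
  also have "(\<Sum>i. of_bool (b (Suc i)) / 4 ^ Suc (Suc i) :: real) = (\<Sum>i. of_bool (b (Suc i)) / 4 ^ Suc i / 4)"
    by (simp add: field_simps)
  also have "\<dots> = encode4 (\<lambda>i. b (Suc i)) / 4"
    unfolding encode4_def by (rule suminf_divide[OF summable_encode4])
  finally show ?thesis by (simp add: add_divide_distrib)
qed

lemma encode4_bounds: "0 \<le> encode4 b" "encode4 b \<le> 1/3"
proof -
  show "0 \<le> encode4 b" unfolding encode4_def by (rule suminf_nonneg[OF summable_encode4]) simp
  have g: "(\<lambda>i. (1/4) ^ i * (1/4) :: real) sums (1 / (1 - 1/4) * (1/4))"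
    by (intro sums_mult2 geometric_sums) simp
  have "encode4 b \<le> (\<Sum>i. (1/4) ^ i * (1/4))"
    unfolding encode4_def
    by (rule suminf_le[OF _ summable_encode4 sums_summable[OF g]]) (auto simp: field_simps)
  also have "\<dots> = 1/3" using sums_unique[OF g] by simp
  finally show "encode4 b \<le> 1/3" .
qed

lemma digit0_encode4: "digit0 (encode4 b) = of_bool (b 0)"
  using encode4_bounds[of "\<lambda>i. b (Suc i)"] unfolding digit0_def encode4_Suc[of b]
  by (cases "b 0") (auto simp: max_def min_def field_simps)

lemma digit_encode4: "digit i (encode4 b) = of_bool (b i)"
proof (induction i arbitrary: b)
  case (Suc i)
  have "4 * encode4 b - digit0 (encode4 b) = encode4 (\<lambda>i. b (Suc i))"
    unfolding digit0_encode4 by (subst encode4_Suc) (simp add: field_simps)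
  then show ?case using Suc.IH[of "\<lambda>i. b (Suc i)"] by simp
qed (simp add: digit0_encode4)

lemma isCont_digit: "isCont (digit i) z"
proof (induction i arbitrary: z)
  case 0
  show ?case unfolding digit.simps(1)[abs_def] digit0_def by (intro continuous_intros)
next
  case (Suc i)
  have "isCont (\<lambda>z. 4 * z - digit0 z) z" unfolding digit0_def by (intro continuous_intros)
  from isCont_o2[OF this Suc.IH] show ?case unfolding digit.simps(2)[abs_def] .
qed

lemma digit_bounds: "0 \<le> digit i z" "digit i z \<le> 1"
proof -
  have "0 \<le> digit i z \<and> digit i z \<le> 1" by (induction i arbitrary: z) (auto simp: digit0_def)
  then show "0 \<le> digit i z" "digit i z \<le> 1" by auto
qed

text \<open>The indicator of a cylinder event as a polynomial in the coordinates: it agrees with the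
  indicator when all coordinates are 0 or 1, and is continuous in general.\<close>

definition cyl_poly :: "'i set \<Rightarrow> (('i \<Rightarrow> bool) \<Rightarrow> bool) \<Rightarrow> ('i \<Rightarrow> real) \<Rightarrow> real" where
  "cyl_poly J \<Phi> d = (\<Sum>T\<in>{T \<in> Pow J. \<Phi> (\<lambda>i. i \<in> T)}. \<Prod>i\<in>J. if i \<in> T then d i else 1 - d i)"

text \<open>On 0/1 coordinates the product belonging to \<open>T\<close> tests whether exactly the
  coordinates in \<open>T\<close> are true, so at most one summand survives.\<close>

lemma cyl_poly_eq:
  assumes J: "finite J" and cyl: "cylinder J (Collect \<Phi>)" and d: "\<And>i. i \<in> J \<Longrightarrow> d i = of_bool (b i)"
  shows "cyl_poly J \<Phi> d = of_bool (\<Phi> b)"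
proof -
  let ?T0 = "{i \<in> J. b i}"
  have pr: "(\<Prod>i\<in>J. if i \<in> T then d i else 1 - d i) = of_bool (T = ?T0)" if T: "T \<subseteq> J" for T
  proof (cases "T = ?T0")
    case True
    then have "(\<Prod>i\<in>J. if i \<in> T then d i else 1 - d i) = (\<Prod>i\<in>J. 1)"
      by (intro prod.cong) (auto simp: d)
    then show ?thesis using True by simp
  next
    case False
    then obtain i where i: "i \<in> J" "i \<in> T \<longleftrightarrow> \<not> b i" using T by blast
    then have "(if i \<in> T then d i else 1 - d i) = 0" by (auto simp: d)
    then have "(\<Prod>i\<in>J. if i \<in> T then d i else 1 - d i) = 0" by (intro prod_zero[OF J] bexI[OF _ i(1)])
    then show ?thesis using False by simp
  qed
  have "cyl_poly J \<Phi> d = (\<Sum>T\<in>{T \<in> Pow J. \<Phi> (\<lambda>i. i \<in> T)}. of_bool (T = ?T0))"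
    unfolding cyl_poly_def by (intro sum.cong refl pr) auto
  also have "\<dots> = of_bool (?T0 \<in> {T \<in> Pow J. \<Phi> (\<lambda>i. i \<in> T)})"
  proof -
    have "finite {T \<in> Pow J. \<Phi> (\<lambda>i. i \<in> T)}" using J by simp
    then show ?thesis unfolding of_bool_def by (rule sum.delta)
  qed
  also have "?T0 \<in> {T \<in> Pow J. \<Phi> (\<lambda>i. i \<in> T)} \<longleftrightarrow> \<Phi> b"
  proof -
    have "(\<lambda>i. i \<in> ?T0) \<in> Collect \<Phi> \<longleftrightarrow> b \<in> Collect \<Phi>" by (rule cylinderD[OF cyl]) simp
    then show ?thesis by simp
  qed
  finally show ?thesis .
qed

lemma isCont_cyl_poly:
  assumes "\<And>i. isCont (\<lambda>z. d z i) z"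
  shows "isCont (\<lambda>z :: real. cyl_poly J \<Phi> (d z)) z"
proof -
  have "isCont (\<lambda>z. if i \<in> T then d z i else 1 - d z i) z" for i T
    using assms[of i] by (cases "i \<in> T") (auto intro!: continuous_intros)
  then show ?thesis unfolding cyl_poly_def by (intro continuous_intros)
qed

lemma cyl_poly_bound:
  assumes "finite J" "\<And>i. 0 \<le> d i" "\<And>i. d i \<le> 1"
  shows "\<bar>cyl_poly J \<Phi> d\<bar> \<le> real (card (Pow J))"
proof -
  have "\<bar>cyl_poly J \<Phi> d\<bar> \<le> (\<Sum>T\<in>{T \<in> Pow J. \<Phi> (\<lambda>i. i \<in> T)}. \<bar>\<Prod>i\<in>J. if i \<in> T then d i else 1 - d i\<bar>)"
    unfolding cyl_poly_def by (rule sum_abs)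
  also have "\<dots> \<le> (\<Sum>T\<in>{T \<in> Pow J. \<Phi> (\<lambda>i. i \<in> T)}. 1)"
  proof (rule sum_mono)
    fix T
    have "\<bar>\<Prod>i\<in>J. if i \<in> T then d i else 1 - d i\<bar> = (\<Prod>i\<in>J. \<bar>if i \<in> T then d i else 1 - d i\<bar>)"
      by (rule abs_prod)
    also have "\<dots> \<le> (\<Prod>i\<in>J. 1)" using assms by (intro prod_mono) auto
    finally show "\<bar>\<Prod>i\<in>J. if i \<in> T then d i else 1 - d i\<bar> \<le> 1" by simp
  qed
  also have "\<dots> \<le> real (card (Pow J))"
    using assms(1) by (simp only: sum_constant mult_1_right of_nat_le_iff) (auto intro!: card_mono)
  finally show ?thesis .
qed

text \<open>Coding bit sequences by reals whose digits extend continuously to the whole line turns Helly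
  selection into compactness of the space of laws of random bit sequences.\<close>

lemma bool_process_limit:
  fixes V :: "nat \<Rightarrow> 'v set" and a :: "nat \<Rightarrow> 'v \<Rightarrow> 'i::countable \<Rightarrow> bool"
  assumes finV: "\<And>n. finite (V n)" and neV: "\<And>n. V n \<noteq> {}"
  obtains r :: "nat \<Rightarrow> nat" and M :: "real measure" and D :: "real \<Rightarrow> 'i \<Rightarrow> bool"
  where "strict_mono r" "prob_space M" "sets M = sets borel" "\<And>i. {z. D z i} \<in> sets M"
    "\<And>J (\<Phi> :: ('i \<Rightarrow> bool) \<Rightarrow> bool). finite J \<Longrightarrow> cylinder J (Collect \<Phi>) \<Longrightarrow>
       (\<lambda>n. real (card {v \<in> V (r n). \<Phi> (a (r n) v)}) / real (card (V (r n)))) \<longlonglongrightarrow> measure M {z. \<Phi> (D z)}"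
proof -
  define X where "X n v = encode4 (\<lambda>k. a n v (from_nat k))" for n v
  define \<mu> where "\<mu> n = distr (measure_pmf (pmf_of_set (V n))) borel (X n)" for n
  define d where "d z i = digit (to_nat (i::'i)) z" for z i
  have rd: "real_distribution (\<mu> n)" for n
    unfolding \<mu>_def by (rule prob_space.real_distribution_distr[OF prob_space_measure_pmf]) simp
  \<comment> \<open>All codes lie in one bounded interval, which yields tightness; the left end is
    negative because the interval excludes it and 0 is a possible code.\<close>
  have X: "X n v \<in> {-1<..1}" for n v
    using encode4_bounds[of "\<lambda>k. a n v (from_nat k)"] unfolding X_def by auto
  have "measure (\<mu> n) {-1<..1} = 1" for n
  proof -
    have "measure (\<mu> n) {-1<..1} = measure (measure_pmf (pmf_of_set (V n))) (X n -` {-1<..1} \<inter> space (measure_pmf (pmf_of_set (V n))))"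
      unfolding \<mu>_def by (rule measure_distr) simp_all
    also have "X n -` {-1<..1} \<inter> space (measure_pmf (pmf_of_set (V n))) = UNIV" using X by auto
    finally show ?thesis using measure_pmf.prob_space[of "pmf_of_set (V n)"] by simp
  qed
  then have "tight \<mu>"
    unfolding tight_def using rd
    by (intro conjI allI impI exI[of _ "-1"] exI[of _ 1]) simp_all
  from tight_imp_convergent_subsubsequence[OF this strict_mono_id]
  obtain r M where r: "strict_mono r" and M: "real_distribution M" and wc: "weak_conv_m (\<mu> \<circ> r) M" by (auto simp: id_def comp_def)
  interpret M: real_distribution M by fact
  have spM: "space M = UNIV" using sets_eq_imp_space_eq[OF M.events_eq_borel] by simp
  have rdr: "real_distribution ((\<mu> \<circ> r) n)" for n by (simp add: rd)
  note conv = weak_conv_imp_integral_bdd_continuous_conv[OF rdr M wc]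
  have dX: "d (X n v) i = of_bool (a n v i)" for n v i
    by (simp add: d_def X_def digit_encode4)
  have d01: "0 \<le> d z i" "d z i \<le> 1" for z i unfolding d_def by (rule digit_bounds)+
  have contd: "isCont (\<lambda>z. d z i) z" for i z
    unfolding d_def using isCont_digit[where i="to_nat i" and z=z] by simp
  have mM: "f \<in> borel_measurable M" if "f \<in> borel_measurable borel" for f :: "real \<Rightarrow> real"
    using that measurable_cong_sets[OF M.events_eq_borel refl] by blast
  have cb: "f \<in> borel_measurable borel" if "\<And>z. isCont f z" for f :: "real \<Rightarrow> real"
    by (intro borel_measurable_continuous_onI continuous_at_imp_continuous_on ballI that)
  have md: "(\<lambda>z. d z i) \<in> borel_measurable M" for i
    by (intro mM cb contd)
  have integ: "integral\<^sup>L (\<mu> n) f = (\<Sum>v\<in>V n. f (X n v)) / real (card (V n))"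
    if f: "f \<in> borel_measurable borel" for f :: "real \<Rightarrow> real" and n
  proof -
    have "integral\<^sup>L (\<mu> n) f = (\<integral>v. f (X n v) \<partial>measure_pmf (pmf_of_set (V n)))"
      unfolding \<mu>_def by (rule integral_distr[OF _ f]) simp
    then show ?thesis using integral_pmf_of_set[OF neV finV] by simp
  qed
  \<comment> \<open>A priori the continuous digits could take intermediate values under the limit
    law. The function \<open>d * (1 - d)\<close> is nonnegative, bounded and continuous and has
    integral 0 along the sequence, hence also in the limit.\<close>
  have ae01: "AE z in M. d z i = 0 \<or> d z i = 1" for i
  proof -
    let ?f = "\<lambda>z. d z i * (1 - d z i)"
    have c: "isCont ?f z" for z using contd by (intro continuous_intros)
    have bd: "norm (?f z) \<le> 1" for z
      using d01[of z i] by (auto simp: abs_mult intro!: mult_le_one)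
    have fm: "?f \<in> borel_measurable borel"
      by (rule cb[OF c])
    have "integral\<^sup>L ((\<mu> \<circ> r) n) ?f = 0" for n
      unfolding comp_def integ[OF fm] by (auto simp: dX intro!: sum.neutral)
    with conv[OF c bd] have "integral\<^sup>L M ?f = 0" by (simp add: LIMSEQ_const_iff)
    moreover have "integrable M ?f"
      by (rule M.integrable_const_bound[OF AE_I2[OF bd] mM[OF fm]])
    moreover have "AE z in M. 0 \<le> ?f z" by (intro AE_I2 mult_nonneg_nonneg) (simp_all add: d01)
    ultimately have "AE z in M. ?f z = 0" by (subst integral_nonneg_eq_0_iff_AE[symmetric])
    then show ?thesis by eventually_elim auto
  qed
  define D where "D z i \<longleftrightarrow> d z i > 1/2" for z i
  show thesis
  proof (rule that[OF r M.prob_space_axioms M.events_eq_borel])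
    show D: "{z. D z i} \<in> sets M" for i
    proof -
      have "{z. D z i} = (\<lambda>z. d z i) -` {1/2<..} \<inter> space M" by (auto simp: D_def spM)
      then show ?thesis using measurable_sets[OF md[of i] borel_open[OF open_greaterThan]] by (simp only:)
    qed
    fix J :: "'i set" and \<Phi> :: "('i \<Rightarrow> bool) \<Rightarrow> bool" assume J: "finite J" and cyl: "cylinder J (Collect \<Phi>)"
    let ?f = "\<lambda>z. cyl_poly J \<Phi> (d z)"
    have c: "isCont ?f z" for z by (rule isCont_cyl_poly[OF contd])
    have bd: "norm (?f z) \<le> real (card (Pow J))" for z using cyl_poly_bound[OF J d01] by simp
    have fm: "?f \<in> borel_measurable borel"
      by (rule cb[OF c])
    have "integral\<^sup>L ((\<mu> \<circ> r) n) ?f = real (card {v \<in> V (r n). \<Phi> (a (r n) v)}) / real (card (V (r n)))" for n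
    proof -
      have "?f (X (r n) v) = of_bool (\<Phi> (a (r n) v))" for v by (rule cyl_poly_eq[OF J cyl dX])
      then show ?thesis unfolding comp_def integ[OF fm]
        using finV by (simp add: of_bool_def sum.If_cases Int_def)
    qed
    \<comment> \<open>Weak convergence is tested against the bounded continuous polynomial, whose
      integrals along the sequence are exactly the frequencies of the event.\<close>
    with conv[OF c bd] have "(\<lambda>n. real (card {v \<in> V (r n). \<Phi> (a (r n) v)}) / real (card (V (r n)))) \<longlonglongrightarrow> integral\<^sup>L M ?f"
      by simp
    also have "integral\<^sup>L M ?f = measure M {z. \<Phi> (D z)}"
    proof -
      have "{z. \<Phi> (D z)} = (\<Union>T\<in>{T \<in> Pow J. \<Phi> (\<lambda>i. i \<in> T)}. {z. {i \<in> J. D z i} = T})"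
      proof -
        have "(\<lambda>i. i \<in> {i \<in> J. D z i}) \<in> Collect \<Phi> \<longleftrightarrow> D z \<in> Collect \<Phi>" for z
          by (rule cylinderD[OF cyl]) simp
        then show ?thesis by auto
      qed
      also have "\<dots> = (\<Union>T\<in>{T \<in> Pow J. \<Phi> (\<lambda>i. i \<in> T)}. {z \<in> space M. \<forall>i\<in>J. z \<in> {z. D z i} \<longleftrightarrow> i \<in> T})"
        by (intro SUP_cong refl) (auto simp: spM)
      also have "\<dots> \<in> sets M"
      proof (intro sets.finite_UN)
        show "finite {T \<in> Pow J. \<Phi> (\<lambda>i. i \<in> T)}" using J by simp
        fix T
        have "{z \<in> space M. z \<in> {z. D z i} \<longleftrightarrow> i \<in> T} \<in> sets M" for i
        proof (cases "i \<in> T")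
          case True
          have "{z \<in> space M. z \<in> {z. D z i} \<longleftrightarrow> i \<in> T} = {z. D z i}" using True by (auto simp: spM)
          then show ?thesis using D[of i] by (simp only:)
        next
          case False
          have "{z \<in> space M. z \<in> {z. D z i} \<longleftrightarrow> i \<in> T} = space M - {z. D z i}" using False by auto
          then show ?thesis using sets.compl_sets[OF D[of i]] by (simp only:)
        qed
        then show "{z \<in> space M. \<forall>i\<in>J. z \<in> {z. D z i} \<longleftrightarrow> i \<in> T} \<in> sets M"
          by (intro sets.sets_Collect_finite_All J)
      qed
      finally have meas: "{z. \<Phi> (D z)} \<in> sets M" .
      have "AE z in M. \<forall>i\<in>J. d z i = 0 \<or> d z i = 1"
        using J ae01 by (intro AE_finite_allI) auto
      then have "AE z in M. ?f z = indicator {z. \<Phi> (D z)} z"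
      proof eventually_elim
        case (elim z)
        have "?f z = of_bool (\<Phi> (D z))"
          by (rule cyl_poly_eq[OF J cyl]) (use elim in \<open>auto simp: D_def\<close>)
        then show ?case by (simp add: indicator_def)
      qed
      then have "integral\<^sup>L M ?f = integral\<^sup>L M (indicator {z. \<Phi> (D z)} :: real \<Rightarrow> real)"
        by (intro integral_cong_AE mM[OF fm] borel_measurable_indicator meas)
      then show ?thesis using meas spM by simp
    qed
    finally show "(\<lambda>n. real (card {v \<in> V (r n). \<Phi> (a (r n) v)}) / real (card (V (r n)))) \<longlonglongrightarrow> measure M {z. \<Phi> (D z)}" .
  qed
qed

section \<open>Limits of rewirings\<close>

context sofic
begin

definition freq :: "nat \<Rightarrow> ('v \<Rightarrow> bool) \<Rightarrow> real" where
  "freq n P = real (card {v \<in> V n. P v}) / real (card (V n))"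

lemma aa_freq: "aa Q \<longleftrightarrow> (\<lambda>n. freq n (\<lambda>v. \<not> Q n v)) \<longlonglongrightarrow> 0"
  by (simp add: aa_def freq_def)

lemma freq_not: "V n \<noteq> {} \<Longrightarrow> freq n (\<lambda>v. \<not> P v) = 1 - freq n P"
proof -
  assume ne: "V n \<noteq> {}"
  have "card (V n) = card {v \<in> V n. P v} + card {v \<in> V n. \<not> P v}"
    by (subst card_Un_disjoint[symmetric]) (auto intro: arg_cong[where f=card])
  then have "real (card (V n)) = real (card {v \<in> V n. P v}) + real (card {v \<in> V n. \<not> P v})" by linarith
  moreover have "card (V n) > 0" using ne by (simp add: card_gt_0_iff)
  ultimately show ?thesis by (simp add: freq_def field_simps)
qed

text \<open>The rewiring as seen from \<open>v\<close>: its edges pulled back along the orbit map to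
  an array of bits on a fixed index set, so that different vertices and different \<open>n\<close>
  can be compared.\<close>

definition rewire_graph :: "(nat \<Rightarrow> 'v set set) \<Rightarrow> nat \<Rightarrow> 'v \<Rightarrow> nat \<times> nat \<Rightarrow> bool" where
  "rewire_graph H n v p \<longleftrightarrow> {act n v (pos (fst p)), act n v (pos (snd p))} \<in> H n"

lemma edge_rewire_graph:
  "h \<in> carrier \<Gamma> \<Longrightarrow> k \<in> carrier \<Gamma> \<Longrightarrow> edge (rewire_graph H n v) h k \<longleftrightarrow> {act n v h, act n v k} \<in> H n"
  by (simp add: edge_def rewire_graph_def insert_commute)

text \<open>Shifting the array by \<open>g\<close> moves the root from \<open>v\<close> to its
  translate, injectively where \<open>inv g\<close> brings it back. One inequality is enough:
  applied to the complementary event it gives the other.\<close>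

lemma freq_shift2_le:
  assumes g: "g \<in> carrier \<Gamma>" and J: "finite J" and cyl: "cylinder J (Collect \<Phi>)"
  shows "\<exists>W. aa W \<and> (\<forall>n. freq n (\<lambda>v. \<Phi> (shift2 g (rewire_graph H n v)))
      \<le> freq n (\<lambda>v. \<Phi> (rewire_graph H n v)) + freq n (\<lambda>v. \<not> W n v))"
proof (intro exI conjI allI)
  define W where "W n v \<longleftrightarrow>
    (\<forall>p\<in>J. act n (act n v g) (pos (fst p)) = act n v (g \<otimes> pos (fst p))) \<and>
    (\<forall>p\<in>J. act n (act n v g) (pos (snd p)) = act n v (g \<otimes> pos (snd p))) \<and>
    act n (act n v g) (inv g) = act n v (g \<otimes> inv g)" for n v
  show "aa W" unfolding W_def using g J by (intro aa_conj aa_ball aa_act_assoc) auto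
  fix n
  have eq: "\<Phi> (shift2 g (rewire_graph H n v)) \<longleftrightarrow> \<Phi> (rewire_graph H n (act n v g))" if W: "W n v" for v
  proof -
    have "shift2 g (rewire_graph H n v) \<in> Collect \<Phi> \<longleftrightarrow> rewire_graph H n (act n v g) \<in> Collect \<Phi>"
      by (rule cylinderD[OF cyl]) (use W g in \<open>auto simp: W_def shift2_def rewire_graph_def\<close>)
    then show ?thesis by simp
  qed
  let ?A = "{v \<in> V n. \<Phi> (shift2 g (rewire_graph H n v))}"
  have "card {v \<in> ?A. W n v} \<le> card {v \<in> V n. \<Phi> (rewire_graph H n v)}"
  proof (rule card_inj_on_le[of "\<lambda>v. act n v g"])
    show "inj_on (\<lambda>v. act n v g) {v \<in> ?A. W n v}"
      by (rule inj_on_inverseI[of _ "\<lambda>v. act n v (inv g)"]) (use g in \<open>auto simp: W_def\<close>)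
  qed (use eq in auto)
  moreover have "card ?A \<le> card ({v \<in> ?A. W n v} \<union> {v \<in> V n. \<not> W n v})" by (intro card_mono) auto
  ultimately have "card ?A \<le> card {v \<in> V n. \<Phi> (rewire_graph H n v)} + card {v \<in> V n. \<not> W n v}"
    using card_Un_le[of "{v \<in> ?A. W n v}" "{v \<in> V n. \<not> W n v}"] by linarith
  then have "real (card ?A) \<le> real (card {v \<in> V n. \<Phi> (rewire_graph H n v)}) + real (card {v \<in> V n. \<not> W n v})"
    by linarith
  then show "freq n (\<lambda>v. \<Phi> (shift2 g (rewire_graph H n v)))
      \<le> freq n (\<lambda>v. \<Phi> (rewire_graph H n v)) + freq n (\<lambda>v. \<not> W n v)"
    unfolding freq_def by (simp add: divide_right_mono flip: add_divide_distrib)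
qed

text \<open>If the orbit map of \<open>v\<close> is injective on \<open>K\<close>, the left side
  counts neighbors of \<open>v\<close> without repetition, and degrees add up to twice the number of
  edges. The remaining vertices contribute at most \<open>card K\<close> each.\<close>

lemma sum_freq_edges_le:
  assumes K: "finite K" "K \<subseteq> carrier \<Gamma>" and H: "H n \<subseteq> {e. e \<subseteq> V n \<and> card e = 2}"
  shows "(\<Sum>g\<in>K. freq n (\<lambda>v. edge (rewire_graph H n v) \<one> g))
    \<le> 2 * (real (card (H n)) / real (card (V n))) + real (card K) * freq n (\<lambda>v. \<not> inj_on (act n v) K)"
proof -
  have finH: "finite (H n)" by (rule finite_subset[of _ "Pow (V n)"]) (use H in auto)
  have e: "edge (rewire_graph H n v) \<one> g \<longleftrightarrow> {v, act n v g} \<in> H n" if "g \<in> K" for v g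
    using that K edge_rewire_graph[of \<one> g] by auto
  have "(\<Sum>g\<in>K. real (card {v \<in> V n. edge (rewire_graph H n v) \<one> g})) = (\<Sum>g\<in>K. \<Sum>v\<in>V n. of_bool ({v, act n v g} \<in> H n))"
    using e by (intro sum.cong refl) (simp add: of_bool_def sum.If_cases Int_def)
  also have "\<dots> = (\<Sum>v\<in>V n. \<Sum>g\<in>K. of_bool ({v, act n v g} \<in> H n))" by (rule sum.swap)
  also have "\<dots> \<le> (\<Sum>v\<in>V n. real (card {w. {v, w} \<in> H n}) + real (card K) * of_bool (\<not> inj_on (act n v) K))"
  proof (rule sum_mono)
    fix v
    have c: "(\<Sum>g\<in>K. of_bool ({v, act n v g} \<in> H n)) = real (card {g \<in> K. {v, act n v g} \<in> H n})"
      using K by (simp add: of_bool_def sum.If_cases Int_def)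
    show "(\<Sum>g\<in>K. of_bool ({v, act n v g} \<in> H n)) \<le> real (card {w. {v, w} \<in> H n}) + real (card K) * of_bool (\<not> inj_on (act n v) K)"
    proof (cases "inj_on (act n v) K")
      case True
      have "finite {w. {v, w} \<in> H n}" by (rule finite_subset[OF _ finite_V[of n]]) (use H in auto)
      then have "card {g \<in> K. {v, act n v g} \<in> H n} \<le> card {w. {v, w} \<in> H n}"
        by (intro card_inj_on_le[of "act n v"]) (auto intro: inj_on_subset[OF True])
      then show ?thesis unfolding c by simp
    next
      case False
      have "card {g \<in> K. {v, act n v g} \<in> H n} \<le> card K" using K by (intro card_mono) auto
      then show ?thesis unfolding c using False by simp
    qed
  qed
  also have "\<dots> = real (\<Sum>v\<in>V n. card {w. {v, w} \<in> H n}) + real (card K) * real (card {v \<in> V n. \<not> inj_on (act n v) K})"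
    by (simp add: sum.distrib sum_distrib_left[symmetric] of_bool_def sum.If_cases Int_def)
  also have "(\<Sum>v\<in>V n. card {w. {v, w} \<in> H n}) = 2 * card (H n)"
  proof -
    have "(\<Sum>v\<in>V n. card {w. {v, w} \<in> H n}) = card (SIGMA v:V n. {w. {v, w} \<in> H n})"
      by (rule card_SigmaI[symmetric]) (use H in \<open>auto intro: finite_subset[OF _ finite_V[of n]]\<close>)
    also have "(SIGMA v:V n. {w. {v, w} \<in> H n}) = {(u, w). {u, w} \<in> H n}" using H by auto
    also have "card \<dots> = 2 * card (H n)" by (rule card_doubletons) (use finH H in auto)
    finally show ?thesis .
  qed
  finally have "(\<Sum>g\<in>K. real (card {v \<in> V n. edge (rewire_graph H n v) \<one> g})) / real (card (V n))
     \<le> (2 * real (card (H n)) + real (card K) * real (card {v \<in> V n. \<not> inj_on (act n v) K})) / real (card (V n))"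
    by (intro divide_right_mono) simp_all
  then show ?thesis by (simp add: freq_def sum_divide_distrib add_divide_distrib)
qed

text \<open>A uniform \<open>m\<close> is the point: it turns connectedness into a cylinder event,
  which passes to the limit. The path in \<open>H n\<close> from \<open>v\<close> to its translate
  by \<open>s\<close> has bounded length and bounded steps in \<open>G n\<close>, so it lifts to a
  ball of the group.\<close>

lemma aa_linked:
  assumes H: "rewiring G H" and s: "s \<in> S"
  shows "\<exists>m. aa (\<lambda>n v. linked (cball m) (rewire_graph H n v) s)"
proof -
  have H2: "\<And>n. H n \<subseteq> {e. e \<subseteq> V n \<and> card e = 2}" using H unfolding rewiring_def by blast
  obtain L where HE: "\<And>n x y. x \<in> V n \<Longrightarrow> y \<in> V n \<Longrightarrow> gdist (H n) x y \<le> enat L * gdist (E n) x y"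
    and EH: "\<And>n x y. x \<in> V n \<Longrightarrow> y \<in> V n \<Longrightarrow> gdist (E n) x y \<le> enat L * gdist (H n) x y"
    using H unfolding rewiring_def by blast
  \<comment> \<open>\<open>k\<close> bounds the length of the path in \<open>H n\<close>. Each of
    its edges moves by at most \<open>L\<close> in \<open>G n\<close>, so the path stays within
    \<open>L * k\<close>; the extra 1 puts \<open>s\<close> itself into the ball, where injectivity
    identifies it with the end of the lifted path.\<close>
  define k where "k = L * length (word s)"
  define m where "m = L * k + 1"
  have sm: "s \<in> cball m" using S_cball[of m] s by (auto simp: m_def)
  have "aa (\<lambda>n v. (\<forall>u. gdist (E n) v u \<le> enat m \<longrightarrow> (\<exists>h\<in>cball m. u = act n v h)) \<and> inj_on (act n v) (cball m))"
    by (intro aa_conj aa_dist_le aa_act_inj finite_cball cball_carrier)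
  then have "aa (\<lambda>n v. linked (cball m) (rewire_graph H n v) s)"
  proof (rule aa_mono)
    fix n v
    assume v: "v \<in> V n" and W: "(\<forall>u. gdist (E n) v u \<le> enat m \<longrightarrow> (\<exists>h\<in>cball m. u = act n v h)) \<and> inj_on (act n v) (cball m)"
    let ?T = "{(h, k). h \<in> cball m \<and> k \<in> cball m \<and> edge (rewire_graph H n v) h k}"
    have "gdist (H n) v (act n v s) \<le> enat L * gdist (E n) v (act n v s)" using v by (intro HE) auto
    also have "\<dots> \<le> enat L * enat (length (word s))" by (intro mult_left_mono gdist_act) simp
    finally have "gdist (H n) v (act n v s) \<le> enat k" by (simp add: k_def)
    then obtain j where j: "j \<le> k" "((\<lambda>u v. {u, v} \<in> H n) ^^ j) v (act n v s)" unfolding gdist_le_iff by blast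
    have "gdist (E n) v u \<le> enat (L * i) \<and> u \<in> V n \<and> (\<exists>h\<in>cball m. u = act n v h \<and> (\<one>, h) \<in> ?T\<^sup>*)"
      if "((\<lambda>u v. {u, v} \<in> H n) ^^ i) v u" "i \<le> k" for i u
      using that
    proof (induction i arbitrary: u)
      case 0
      then have "u = v" by simp
      then show ?case using v one_in_cball[of m] by (auto intro!: bexI[of _ \<one>])
    next
      case (Suc i)
      then obtain w where w: "((\<lambda>u v. {u, v} \<in> H n) ^^ i) v w" "{w, u} \<in> H n" by auto
      have IH: "gdist (E n) v w \<le> enat (L * i)" "w \<in> V n" and "\<exists>h\<in>cball m. w = act n v h \<and> (\<one>, h) \<in> ?T\<^sup>*"
        using Suc.IH[OF w(1)] Suc.prems by auto
      then obtain h where h: "h \<in> cball m" "w = act n v h" "(\<one>, h) \<in> ?T\<^sup>*" by blast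
      have u: "u \<in> V n" using w(2) H2 by blast
      have "gdist (E n) w u \<le> enat L * gdist (H n) w u" by (rule EH[OF IH(2) u])
      also have "\<dots> \<le> enat L * enat 1" by (intro mult_left_mono gdist_edge w(2)) simp
      finally have "gdist (E n) w u \<le> enat L" by simp
      from gdist_trans[OF IH(1) this] have d: "gdist (E n) v u \<le> enat (L * Suc i)" by (simp add: algebra_simps)
      also have "\<dots> \<le> enat m"
        using mult_le_mono2[OF Suc.prems(2), of L] unfolding m_def by simp
      finally obtain h' where h': "h' \<in> cball m" "u = act n v h'" using W by blast
      have "(h, h') \<in> ?T"
        using h(1) h'(1) w(2) h(2) h'(2) cball_carrier edge_rewire_graph[of h h' H n v] by auto
      with h(3) have "(\<one>, h') \<in> ?T\<^sup>*" by (rule rtrancl.rtrancl_into_rtrancl)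
      with h' d u show ?case by blast
    qed
    from this[OF j(2,1)] obtain h where h: "h \<in> cball m" "act n v s = act n v h" "(\<one>, h) \<in> ?T\<^sup>*" by blast
    then have "s = h" using W sm by (auto dest: inj_onD)
    then show "linked (cball m) (rewire_graph H n v) s" using h(3) unfolding linked_def by simp
  qed
  then show ?thesis by blast
qed

lemma cylinder_edge: "cylinder {(node h, node k), (node k, node h)} {b. edge b h k}"
  unfolding cylinder_def edge_def by auto

lemma cylinder_linked: "cylinder (node ` F \<times> node ` F) {b. linked F b s}"
  unfolding cylinder_def
proof (intro allI impI)
  fix x y :: "nat \<times> nat \<Rightarrow> bool" assume "\<forall>i\<in>node ` F \<times> node ` F. x i = y i"
  then have "{(h, k). h \<in> F \<and> k \<in> F \<and> edge x h k} = {(h, k). h \<in> F \<and> k \<in> F \<and> edge y h k}"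
    unfolding edge_def by auto
  then show "x \<in> {b. linked F b s} \<longleftrightarrow> y \<in> {b. linked F b s}" unfolding linked_def by simp
qed

lemma cylinder_shift2:
  assumes "cylinder J (Collect (\<Phi> :: (nat \<times> nat \<Rightarrow> 'b) \<Rightarrow> bool))"
  shows "cylinder ((\<lambda>p. (shift g (fst p), shift g (snd p))) ` J) {b. \<Phi> (shift2 g b)}"
  unfolding cylinder_def
proof (intro allI impI)
  fix x y :: "nat \<times> nat \<Rightarrow> 'b" assume "\<forall>i\<in>(\<lambda>p. (shift g (fst p), shift g (snd p))) ` J. x i = y i"
  then have "shift2 g x \<in> Collect \<Phi> \<longleftrightarrow> shift2 g y \<in> Collect \<Phi>"
    by (intro cylinderD[OF assms]) (auto simp: shift2_def)
  then show "x \<in> {b. \<Phi> (shift2 g b)} \<longleftrightarrow> y \<in> {b. \<Phi> (shift2 g b)}" by simp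
qed

lemma fixed_price_le_rewiring:
  assumes fp: "fixed_price \<Gamma> c" and H: "rewiring G H"
  shows "c \<le> liminf (\<lambda>n. ennreal (real (card (H n)) / real (card (V n))))"
proof -
  define u where "u n = ennreal (real (card (H n)) / real (card (V n)))" for n
  have H2: "\<And>n. H n \<subseteq> {e. e \<subseteq> V n \<and> card e = 2}" using H unfolding rewiring_def by blast
  have ueq: "(\<lambda>n. ennreal (real (card (H n)) / real (card (V n)))) = u" by (simp add: u_def fun_eq_iff)
  show ?thesis unfolding ueq
  proof (cases "liminf u")
    case top
    then show "c \<le> liminf u" by simp
  next
    case (real t)
    obtain r0 where r0: "strict_mono r0" "(u \<circ> r0) \<longlonglongrightarrow> liminf u" using liminf_subseq_lim by blast
    \<comment> \<open>Finitely many vertex sets may be empty; they are skipped, since a uniform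
      random vertex must exist.\<close>
    obtain N where N: "\<And>n. n \<ge> N \<Longrightarrow> 0 < card (V n)"
      using eventually_card_pos by (auto simp: eventually_sequentially)
    define r1 where "r1 n = r0 (n + N)" for n
    have r1: "strict_mono r1" using r0(1) by (auto simp: r1_def strict_mono_def)
    have V1: "V (r1 n) \<noteq> {}" for n
    proof -
      have "N \<le> r1 n" using seq_suble[OF r0(1), of "n + N"] by (simp add: r1_def)
      from N[OF this] show ?thesis by auto
    qed
    show "c \<le> liminf u"
    proof (rule bool_process_limit[of "\<lambda>n. V (r1 n)" "\<lambda>n. rewire_graph H (r1 n)", OF finite_V V1])
      fix r :: "nat \<Rightarrow> nat" and M :: "real measure" and D :: "real \<Rightarrow> nat \<times> nat \<Rightarrow> bool"
      assume r: "strict_mono r" and M: "prob_space M" "sets M = sets borel"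
        and D: "\<And>i. {z. D z i} \<in> sets M"
        and cv: "\<And>J (\<Phi> :: (nat \<times> nat \<Rightarrow> bool) \<Rightarrow> bool). finite J \<Longrightarrow> cylinder J (Collect \<Phi>) \<Longrightarrow>
         (\<lambda>n. real (card {v \<in> V (r1 (r n)). \<Phi> (rewire_graph H (r1 (r n)) v)}) / real (card (V (r1 (r n)))))
           \<longlonglongrightarrow> measure M {z. \<Phi> (D z)}"
      define q where "q n = r1 (r n)" for n
      have q: "strict_mono q" using r1 r by (auto simp: q_def strict_mono_def)
      have Vq: "V (q n) \<noteq> {}" for n using V1 by (simp add: q_def)
      have conv: "(\<lambda>n. freq (q n) (\<lambda>v. \<Phi> (rewire_graph H (q n) v))) \<longlonglongrightarrow> measure M {z. \<Phi> (D z)}"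
        if "finite J" "cylinder J (Collect \<Phi>)" for J \<Phi>
        using cv[OF that] by (simp add: freq_def q_def)
      have aaq: "(\<lambda>n. freq (q n) (\<lambda>v. \<not> W (q n) v)) \<longlonglongrightarrow> 0" if "aa W" for W
        using LIMSEQ_subseq_LIMSEQ[OF that[unfolded aa_freq] q] by (simp add: comp_def)
      have ut: "(\<lambda>n. real (card (H (q n))) / real (card (V (q n)))) \<longlonglongrightarrow> t"
      proof (rule tendsto_ennrealD)
        have "(\<lambda>n. u (r0 (n + N))) \<longlonglongrightarrow> ennreal t"
          using LIMSEQ_ignore_initial_segment[OF r0(2), of N] real by (simp add: comp_def)
        from LIMSEQ_subseq_LIMSEQ[OF this r]
        show "(\<lambda>n. ennreal (real (card (H (q n))) / real (card (V (q n))))) \<longlonglongrightarrow> ennreal t"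
          by (simp add: comp_def q_def r1_def u_def)
      qed (use real in auto)
      have "c \<le> ennreal t"
      proof (rule fixed_price_le_random_graph[OF fp M D])
        fix g J and \<Phi> :: "(nat \<times> nat \<Rightarrow> bool) \<Rightarrow> bool"
        assume g: "g \<in> carrier \<Gamma>" and J: "finite J" and cyl: "cylinder J (Collect \<Phi>)"
        have le: "measure M {z. \<Psi> (shift2 g (D z))} \<le> measure M {z. \<Psi> (D z)}"
          if cyl: "cylinder J (Collect \<Psi>)" for \<Psi>
        proof -
          obtain W where W: "aa W" "\<And>n. freq n (\<lambda>v. \<Psi> (shift2 g (rewire_graph H n v)))
             \<le> freq n (\<lambda>v. \<Psi> (rewire_graph H n v)) + freq n (\<lambda>v. \<not> W n v)"
            using freq_shift2_le[OF g J cyl, of H] by blast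
          have a: "(\<lambda>n. freq (q n) (\<lambda>v. \<Psi> (shift2 g (rewire_graph H (q n) v)))) \<longlonglongrightarrow> measure M {z. \<Psi> (shift2 g (D z))}"
            by (rule conv[OF _ cylinder_shift2[OF cyl]]) (simp add: J)
          have b: "(\<lambda>n. freq (q n) (\<lambda>v. \<Psi> (rewire_graph H (q n) v)) + freq (q n) (\<lambda>v. \<not> W (q n) v)) \<longlonglongrightarrow> measure M {z. \<Psi> (D z)} + 0"
            by (intro tendsto_add conv[OF J cyl] aaq W)
          show ?thesis using LIMSEQ_le[OF a b] W(2) by auto
        qed
        \<comment> \<open>Complements turn \<open>le\<close> into the reverse inequality. The
          complement rule is itself obtained as a limit of the same rule for frequencies.\<close>
        have neg: "measure M {z. \<not> \<Psi> (D z)} = 1 - measure M {z. \<Psi> (D z)}"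
          if cyl: "finite J'" "cylinder J' (Collect \<Psi>)" for J' \<Psi>
        proof (rule LIMSEQ_unique)
          have "cylinder J' {b. \<not> \<Psi> b}" using cyl(2) by (auto simp: cylinder_def)
          from conv[OF cyl(1) this]
          show "(\<lambda>n. freq (q n) (\<lambda>v. \<not> \<Psi> (rewire_graph H (q n) v))) \<longlonglongrightarrow> measure M {z. \<not> \<Psi> (D z)}" .
          show "(\<lambda>n. freq (q n) (\<lambda>v. \<not> \<Psi> (rewire_graph H (q n) v))) \<longlonglongrightarrow> 1 - measure M {z. \<Psi> (D z)}"
            unfolding freq_not[OF Vq] by (intro tendsto_diff tendsto_const conv[OF cyl])
        qed
        have "cylinder J {b. \<not> \<Phi> b}" using cyl by (auto simp: cylinder_def)
        from le[OF this] have "measure M {z. \<not> \<Phi> (shift2 g (D z))} \<le> measure M {z. \<not> \<Phi> (D z)}" .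
        then have "measure M {z. \<Phi> (D z)} \<le> measure M {z. \<Phi> (shift2 g (D z))}"
          using neg[OF J cyl] neg[OF _ cylinder_shift2[OF cyl], of g] J by simp
        with le[OF cyl] show "measure M {z. \<Phi> (shift2 g (D z))} = measure M {z. \<Phi> (D z)}" by simp
      next
        fix K assume K: "finite K" "K \<subseteq> carrier \<Gamma>"
        have a: "(\<lambda>n. \<Sum>g\<in>K. freq (q n) (\<lambda>v. edge (rewire_graph H (q n) v) \<one> g)) \<longlonglongrightarrow> (\<Sum>g\<in>K. measure M {z. edge (D z) \<one> g})"
          by (intro tendsto_sum conv[OF _ cylinder_edge]) simp
        have b: "(\<lambda>n. 2 * (real (card (H (q n))) / real (card (V (q n)))) + real (card K) * freq (q n) (\<lambda>v. \<not> inj_on (act (q n) v) K))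
           \<longlonglongrightarrow> 2 * t + real (card K) * 0"
          by (intro tendsto_add tendsto_mult tendsto_const ut aaq aa_act_inj K)
        show "(\<Sum>g\<in>K. measure M {z. edge (D z) \<one> g}) \<le> 2 * t"
          using LIMSEQ_le[OF a b] sum_freq_edges_le[where H=H, OF K H2] by auto
      next
        fix s assume s: "s \<in> S"
        obtain m where m: "aa (\<lambda>n v. linked (cball m) (rewire_graph H n v) s)" using aa_linked[OF H s] by blast
        have "measure M {z. linked (cball m) (D z) s} = 1"
        proof (rule LIMSEQ_unique)
          show "(\<lambda>n. freq (q n) (\<lambda>v. linked (cball m) (rewire_graph H (q n) v) s)) \<longlonglongrightarrow> measure M {z. linked (cball m) (D z) s}"
            by (rule conv[OF _ cylinder_linked]) simp
          have "(\<lambda>n. 1 - freq (q n) (\<lambda>v. \<not> linked (cball m) (rewire_graph H (q n) v) s)) \<longlonglongrightarrow> 1 - 0"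
            by (intro tendsto_diff tendsto_const aaq[OF m])
          then show "(\<lambda>n. freq (q n) (\<lambda>v. linked (cball m) (rewire_graph H (q n) v) s)) \<longlonglongrightarrow> 1"
            by (simp add: freq_not[OF Vq])
        qed
        then show "\<exists>F. finite F \<and> F \<subseteq> carrier \<Gamma> \<and> measure M {z. linked F (D z) s} = 1"
          using cball_carrier by (intro exI[of _ "cball m"]) simp
      qed
      then show "c \<le> liminf u" using real by simp
    qed
  qed
qed

end

theorem theorem3:
  fixes \<Gamma> :: "('g, 'm) monoid_scheme"
    and S :: "'g set"
    and c :: ennreal
    and G :: "nat \<Rightarrow> ('v, 'g) ldigraph"
  assumes "group \<Gamma>"
    and "finite S"
    and "symmetric_generating_set \<Gamma> S"
    and "fixed_price \<Gamma> c"
    and "sofic_approximation \<Gamma> S G"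
    and "filterlim (\<lambda>n. card (lverts (G n))) at_top sequentially"
  shows "comb_cost G = c"
proof (rule antisym)
  interpret sofic \<Gamma> S G
    using assms by (intro sofic.intro marked_group.intro marked_group_axioms.intro sofic_axioms.intro)
  show "comb_cost G \<le> c"
  \<comment> \<open>An infinite price makes the upper bound trivial; the approximation argument is
    for real \<open>t\<close>.\<close>
  proof (cases c)
    case (real t)
    then show ?thesis using comb_cost_le_fixed_price[of t] assms(4) by simp
  qed simp
  show "c \<le> comb_cost G"
    unfolding comb_cost_def using fixed_price_le_rewiring[OF assms(4)] by (intro INF_greatest) simp
qed

end
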